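(* Let $X\subset \mathbb{P}^N$ be a projective variety over $K$ of dimension $n\geq 1$. Let $D_1,\ldots, D_q$ be hypersurfaces in $\mathbb{P}^N$ over $K$ such that all intersections amongst $D_1,\ldots, D_q$, and $X$ are transverse. Let $f:K\to X$ be a nonconstant analytic map whose image is not completely contained in any of the hypersurfaces $D_1,\ldots, D_q$. Then $$\sum_{i=1}^q\delta_f(D_i)\leq n-1+\max_{1\le i\le q} \frac{1}{\deg D_i}.$$ In particular, if $\deg D_i=d$ for all $i$, then $$\sum_{i=1}^q\delta_f(D_i)\leq n-1+\frac{1}{d}.$$
   Context: $K$ is an algebraically closed field, of arbitrary characteristic, complete with respect to a non-archimedean absolute value $|\cdot|$. An entire function on $K$ is a power series $g(z)=\sum_{i\ge 0} a_iz^i$ with coefficients in $K$ converging on all of $K$; for real $r\geq 0$ put $|g|_r=\sup_i |a_i|r^i$. An analytic map $f:K\to\mathbb{P}^N$ is written $f=(f_0,\ldots,f_N)$ with $f_0,\ldots,f_N$ entire functions without a common zero; a map $f:K\to X$ is an analytic map to $\mathbb{P}^N$ with image in $X$. Put $\|f\|_r=\max\{|f_0|_r,\ldots,|f_N|_r\}$. The characteristic function is $T_f(r)=\log\|f\|_r$, well defined up to an additive constant independently of the representation of $f$. A hypersurface $D\subset\mathbb{P}^N$ of degree $d\geq 1$ is the closed subscheme defined by a homogeneous polynomial $Q\in K[x_0,\ldots,x_N]$ of degree $d$. If $Q\circ f=Q(f_0,\ldots,f_N)\not\equiv 0$, the proximity function is $$m_f(r,D)=\log\frac{\|f\|_r^d}{|Q\circ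 f|_r},$$ which depends on the choice of $Q$ only up to an additive constant. The defect of $f$ with respect to $D$ is $$\delta_f(D)=\liminf_{r\to\infty} \frac{m_f(r,D)}{(\deg D)T_f(r)}.$$ Transversality (standard meaning): all intersections amongst $D_1,\ldots,D_q$ and $X$ are transverse if for every subfamily with at least two members of the family $D_1,\ldots,D_q,X$ of closed subschemes of $\mathbb{P}^N$, and every point $P$ common to all members of the subfamily, each member is nonsingular at $P$ and the codimension in $T_P\mathbb{P}^N$ of the intersection of the tangent spaces at $P$ of the members equals the sum of the codimensions of the members (1 for each $D_i$, and $N-n$ for $X$). In particular, a subfamily whose codimensions sum to more than $N$ has empty intersection. *)

theory Defs
  imports
    "HOL-Analysis.Analysis"
    "HOL-Computational_Algebra.Polynomial"
    "HOL-Computational_Algebra.Formal_Power_Series"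
    "HOL-Library.Poly_Mapping"
begin

section \<open>Complete non-archimedean fields and entire functions\<close>

definition nonarch_abs :: "('a::field \<Rightarrow> real) \<Rightarrow> bool" where
  "nonarch_abs v \<longleftrightarrow>
     (\<forall>x. 0 \<le> v x) \<and> (\<forall>x. v x = 0 \<longleftrightarrow> x = 0) \<and>
     (\<forall>x y. v (x * y) = v x * v y) \<and>
     (\<forall>x y. v (x + y) \<le> max (v x) (v y))"

definition abs_dist :: "('a::field \<Rightarrow> real) \<Rightarrow> 'a \<Rightarrow> 'a \<Rightarrow> real" where
  "abs_dist v x y = v (x - y)"

definition complete_nonarch_abs :: "('a::field \<Rightarrow> real) \<Rightarrow> bool" where
  "complete_nonarch_abs v \<longleftrightarrow>
     nonarch_abs v \<and> Metric_space.mcomplete UNIV (abs_dist v)"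

definition fps_has_value :: "('a::field \<Rightarrow> real) \<Rightarrow> 'a fps \<Rightarrow> 'a \<Rightarrow> 'a \<Rightarrow> bool" where
  "fps_has_value v g z s \<longleftrightarrow>
     limitin (Metric_space.mtopology UNIV (abs_dist v))
       (\<lambda>n. \<Sum>i<n. fps_nth g i * z ^ i) s sequentially"

definition fps_value :: "('a::field \<Rightarrow> real) \<Rightarrow> 'a fps \<Rightarrow> 'a \<Rightarrow> 'a" where
  "fps_value v g z = (THE s. fps_has_value v g z s)"

definition entire :: "('a::field \<Rightarrow> real) \<Rightarrow> 'a fps \<Rightarrow> bool" where
  "entire v g \<longleftrightarrow> (\<forall>z. \<exists>s. fps_has_value v g z s)"

text \<open>The supremum is taken in \<open>real\<close>; it is a genuine one for entire \<open>g\<close> and \<open>r \<ge> 0\<close>,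
  since then the terms tend to \<open>0\<close>.\<close>

definition fps_norm :: "('a::field \<Rightarrow> real) \<Rightarrow> 'a fps \<Rightarrow> real \<Rightarrow> real" where
  "fps_norm v g r = (SUP i. v (fps_nth g i) * r ^ i)"


section \<open>Polynomials in finitely many variables\<close>

text \<open>The variables are indexed by the finite type \<open>'v\<close>; monomials are exponent vectors.\<close>

type_synonym ('v, 'a) mpoly = "('v \<Rightarrow>\<^sub>0 nat) \<Rightarrow>\<^sub>0 'a"

definition mpoly_insert ::
    "('a::zero \<Rightarrow> 'b::comm_semiring_1) \<Rightarrow> ('v::finite, 'a) mpoly \<Rightarrow> 'b ^ 'v \<Rightarrow> 'b" where
  "mpoly_insert c Q x =
     (\<Sum>m\<in>Poly_Mapping.keys Q.
        c (Poly_Mapping.lookup Q m) * (\<Prod>j\<in>UNIV. (x $ j) ^ Poly_Mapping.lookup m j))"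

definition mpoly_eval :: "('v::finite, 'a::comm_semiring_1) mpoly \<Rightarrow> 'a ^ 'v \<Rightarrow> 'a" where
  "mpoly_eval Q x = mpoly_insert (\<lambda>a. a) Q x"

definition mpoly_comp :: "('v::finite, 'a::comm_ring_1) mpoly \<Rightarrow> 'a fps ^ 'v \<Rightarrow> 'a fps" where
  "mpoly_comp Q f = mpoly_insert fps_const Q f"

definition mpoly_deriv :: "'v \<Rightarrow> ('v::finite, 'a::comm_semiring_1) mpoly \<Rightarrow> ('v, 'a) mpoly" where
  "mpoly_deriv j Q =
     (\<Sum>m\<in>Poly_Mapping.keys Q.
        Poly_Mapping.single (m - Poly_Mapping.single j 1)
          (of_nat (Poly_Mapping.lookup m j) * Poly_Mapping.lookup Q m))"

text \<open>The zero polynomial is homogeneous of every degree.\<close>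

definition homogeneous :: "nat \<Rightarrow> ('v::finite, 'a::zero) mpoly \<Rightarrow> bool" where
  "homogeneous d Q \<longleftrightarrow>
     (\<forall>m\<in>Poly_Mapping.keys Q. (\<Sum>j\<in>UNIV. Poly_Mapping.lookup m j) = d)"


section \<open>Projective geometry\<close>

text \<open>With \<open>CARD('v) = N + 1\<close>, points of projective \<open>N\<close>-space are given by nonzero vectors of
  homogeneous coordinates in \<open>'a ^ 'v\<close>, and a subset of projective space by the set of all
  homogeneous coordinate vectors of its points (the punctured affine cone over it).\<close>

definition proj_zeros :: "('v::finite, 'a::comm_ring_1) mpoly set \<Rightarrow> ('a ^ 'v) set" where
  "proj_zeros S = {P. P \<noteq> 0 \<and> (\<forall>F\<in>S. mpoly_eval F P = 0)}"

definition proj_closed :: "('a::field ^ 'v::finite) set \<Rightarrow> bool" where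
  "proj_closed Z \<longleftrightarrow> (\<exists>S. (\<forall>F\<in>S. \<exists>d. homogeneous d F) \<and> Z = proj_zeros S)"

definition proj_variety :: "('a::field ^ 'v::finite) set \<Rightarrow> bool" where
  "proj_variety Z \<longleftrightarrow>
     proj_closed Z \<and> Z \<noteq> {} \<and>
     (\<forall>A B. proj_closed A \<and> proj_closed B \<and> Z \<subseteq> A \<union> B \<longrightarrow> Z \<subseteq> A \<or> Z \<subseteq> B)"

text \<open>Krull dimension for the Zariski topology.\<close>

definition proj_dim :: "('a::field ^ 'v::finite) set \<Rightarrow> enat" where
  "proj_dim Z =
     Sup {enat k | k. \<exists>C :: nat \<Rightarrow> ('a ^ 'v) set.
       (\<forall>i\<le>k. proj_variety (C i) \<and> C i \<subseteq> Z) \<and> (\<forall>i<k. C i \<subset> C (Suc i))}"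

text \<open>Homogeneous generators of the homogeneous ideal of \<open>Z\<close>: they define \<open>Z\<close> as a reduced closed
  subscheme.\<close>

definition vanishing_forms :: "('a::field ^ 'v::finite) set \<Rightarrow> ('v, 'a) mpoly set" where
  "vanishing_forms Z = {F. (\<exists>d. homogeneous d F) \<and> (\<forall>P\<in>Z. mpoly_eval F P = 0)}"

definition hypersurface :: "nat \<Rightarrow> ('v::finite, 'a::field) mpoly \<Rightarrow> bool" where
  "hypersurface d Q \<longleftrightarrow> d \<ge> 1 \<and> Q \<noteq> 0 \<and> homogeneous d Q"


section \<open>Transversality\<close>

text \<open>A closed subscheme of projective space is given by a set \<open>S\<close> of homogeneous generators of its
  ideal. For \<open>P\<close> in \<open>proj_zeros S\<close>, the following is the preimage of its Zariski tangent space at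
  \<open>P\<close> under the quotient map from \<open>'a ^ 'v\<close> to \<open>'a ^ 'v / 'a P\<close>, the latter being the tangent space
  of projective space at \<open>P\<close>. The preimage contains \<open>P\<close> by Euler's relation, so that taking
  preimages preserves intersections and codimensions.\<close>

definition tangent :: "('v::finite, 'a::field) mpoly set \<Rightarrow> 'a ^ 'v \<Rightarrow> ('a ^ 'v) set" where
  "tangent S P = {w. \<forall>F\<in>S. (\<Sum>j\<in>UNIV. mpoly_eval (mpoly_deriv j F) P * w $ j) = 0}"

definition codim :: "('a::field ^ 'v::finite) set \<Rightarrow> nat" where
  "codim W = CARD('v) - vec.dim W"

text \<open>\<open>c j\<close> is the codimension of the \<open>j\<close>-th member, whose nonsingularity at \<open>P\<close> means that its
  tangent space at \<open>P\<close> has codimension \<open>c j\<close>.\<close>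

definition transverse_family ::
    "'i set \<Rightarrow> ('i \<Rightarrow> ('v::finite, 'a::field) mpoly set) \<Rightarrow> ('i \<Rightarrow> nat) \<Rightarrow> bool" where
  "transverse_family I S c \<longleftrightarrow>
     (\<forall>J P. finite J \<and> J \<subseteq> I \<and> card J \<ge> 2 \<and> (\<forall>j\<in>J. P \<in> proj_zeros (S j)) \<longrightarrow>
        (\<forall>j\<in>J. codim (tangent (S j) P) = c j) \<and>
        codim (\<Inter>j\<in>J. tangent (S j) P) = (\<Sum>j\<in>J. c j))"

text \<open>The index \<open>None\<close> stands for the variety \<open>X\<close> of dimension \<open>n\<close>, and \<open>Some i\<close> for the
  hypersurface defined by \<open>Q i\<close>.\<close>

definition all_intersections_transverse ::
    "nat \<Rightarrow> (nat \<Rightarrow> ('v::finite, 'a::field) mpoly) \<Rightarrow> ('a ^ 'v) set \<Rightarrow> nat \<Rightarrow> bool" where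
  "all_intersections_transverse q Q X n \<longleftrightarrow>
     transverse_family (insert None (Some ` {1..q}))
       (case_option (vanishing_forms X) (\<lambda>i. {Q i}))
       (case_option (CARD('v) - 1 - n) (\<lambda>i. 1))"


section \<open>Analytic maps and defects\<close>

definition map_value :: "('a::field \<Rightarrow> real) \<Rightarrow> 'a fps ^ 'v::finite \<Rightarrow> 'a \<Rightarrow> 'a ^ 'v" where
  "map_value v f z = (\<chi> j. fps_value v (f $ j) z)"

definition analytic_map :: "('a::field \<Rightarrow> real) \<Rightarrow> 'a fps ^ 'v::finite \<Rightarrow> bool" where
  "analytic_map v f \<longleftrightarrow> (\<forall>j. entire v (f $ j)) \<and> (\<forall>z. map_value v f z \<noteq> 0)"

definition analytic_map_into ::
    "('a::field \<Rightarrow> real) \<Rightarrow> 'a fps ^ 'v::finite \<Rightarrow> ('a ^ 'v) set \<Rightarrow> bool" where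
  "analytic_map_into v f X \<longleftrightarrow> analytic_map v f \<and> (\<forall>z. map_value v f z \<in> X)"

definition nonconstant_map :: "('a::field \<Rightarrow> real) \<Rightarrow> 'a fps ^ 'v::finite \<Rightarrow> bool" where
  "nonconstant_map v f \<longleftrightarrow> (\<exists>z w. \<nexists>c. map_value v f w = c *s map_value v f z)"

definition map_norm :: "('a::field \<Rightarrow> real) \<Rightarrow> 'a fps ^ 'v::finite \<Rightarrow> real \<Rightarrow> real" where
  "map_norm v f r = Max (Set.range (\<lambda>j. fps_norm v (f $ j) r))"

definition characteristic :: "('a::field \<Rightarrow> real) \<Rightarrow> 'a fps ^ 'v::finite \<Rightarrow> real \<Rightarrow> real" where
  "characteristic v f r = ln (map_norm v f r)"

text \<open>Here and below \<open>d\<close> is the degree of the hypersurface defined by \<open>Q\<close>.\<close>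

definition proximity ::
    "('a::field \<Rightarrow> real) \<Rightarrow> 'a fps ^ 'v::finite \<Rightarrow> nat \<Rightarrow> ('v, 'a) mpoly \<Rightarrow> real \<Rightarrow> real" where
  "proximity v f d Q r = ln (map_norm v f r ^ d / fps_norm v (mpoly_comp Q f) r)"

definition defect ::
    "('a::field \<Rightarrow> real) \<Rightarrow> 'a fps ^ 'v::finite \<Rightarrow> nat \<Rightarrow> ('v, 'a) mpoly \<Rightarrow> ereal" where
  "defect v f d Q =
     Liminf at_top (\<lambda>r. ereal (proximity v f d Q r / (real d * characteristic v f r)))"

end

theory Submission
  imports Defs
begin

text \<open>
  Why the bound holds. For every radius \<open>r\<close> the norm \<open>\<bar>g\<bar>\<^sub>r\<close> is multiplicative on entire
  series (\<open>norm_mult\<close>). So \<open>f\<close>, at radius \<open>r\<close>, behaves like a point of \<open>X\<close> over a valued field, and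
  the \<^emph>\<open>relative size\<close> \<open>\<bar>Q\<^sub>i \<circ> f\<bar>\<^sub>r / \<parallel>f\<parallel>\<^sub>r ^ d\<^sub>i\<close> says how close this point is to \<open>D\<^sub>i\<close>. The
  proximity function is minus the logarithm of the relative size. Three estimates hold for all large
  \<open>r\<close>, with constants that do not depend on \<open>r\<close>; write \<open>T\<close> for the characteristic function.

  \<^item> Each proximity function is at most \<open>d\<^sub>i T + O(1)\<close>, since \<open>\<bar>Q\<^sub>i \<circ> f\<bar>\<^sub>r\<close> is bounded below.

  \<^item> Among any \<open>n + 1\<close> of the \<open>D\<^sub>i\<close> at least one has bounded proximity. By transversality these have
    no common point on \<open>X\<close>, so by the Nullstellensatz their equations and those of \<open>X\<close> generate a
    power of every variable. If they were all small at \<open>r\<close>, so would be every coordinate of \<open>f\<close>,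
    relative to the largest one (\<open>no_common_zero_bound\<close>).

  \<^item> Among any \<open>n\<close> of the \<open>D\<^sub>i\<close> at least one has proximity at most \<open>T + O(1)\<close>, without the factor
    \<open>d\<^sub>i\<close>. By transversality these meet \<open>X\<close> in reduced isolated points. If all \<open>n\<close> equations are small
    at \<open>r\<close>, then \<open>f\<close> is close to one of these points \<open>P\<close>, and there the equations are local
    coordinates: a linear form \<open>H\<close> vanishing at \<open>P\<close> is, near \<open>P\<close>, a combination of them. So one of
    them has relative size at least a constant times \<open>\<bar>H \<circ> f\<bar>\<^sub>r / \<parallel>f\<parallel>\<^sub>r\<close>. As \<open>f\<close> is not constant, \<open>H\<close>
    can be chosen with \<open>H \<circ> f \<noteq> 0\<close>, and then \<open>\<bar>H \<circ> f\<bar>\<^sub>r\<close> is bounded below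
    (\<open>isolated_zeros_bound\<close>).

  Hence at each radius at most \<open>n\<close> of the hypersurfaces have large proximity. After division by
  \<open>d\<^sub>i T\<close> they contribute at most \<open>1\<close> each, and if there are \<open>n\<close> of them, one contributes at most
  \<open>1 / d\<^sub>i\<close>. The sum is therefore at most \<open>n - 1 + max (1 / d\<^sub>i)\<close> up to a term that tends to \<open>0\<close>,
  and lower limits are superadditive.
\<close>


section \<open>The Gauss norm on entire series\<close>

text \<open>In a finite field the product of all \<open>[:- a, 1:]\<close>, plus \<open>1\<close>, would have no root.\<close>

lemma infinite_UNIV_alg_closed: "infinite (UNIV :: 'a::alg_closed_field set)"
proof
  assume fin: "finite (UNIV :: 'a set)"
  define p :: "'a poly" where "p = (\<Prod>a\<in>UNIV. [:- a, 1:]) + 1"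
  have deg: "degree (\<Prod>a\<in>UNIV. [:- a, 1:] :: 'a poly) = card (UNIV :: 'a set)"
    by (subst degree_prod_eq_sum_degree) auto
  moreover have "0 < card (UNIV :: 'a set)" using fin by (simp add: card_gt_0_iff)
  ultimately have "degree p > 0"
    unfolding p_def by (subst degree_add_eq_left) auto
  then obtain x where "poly p x = 0" using alg_closed_imp_poly_has_root by blast
  moreover have "(\<Prod>a\<in>UNIV. x - a) = 0" using fin by (intro prod_zero) auto
  ultimately show False by (simp add: p_def poly_prod)
qed

locale nonarch_field =
  fixes v :: "'a::field \<Rightarrow> real"
  assumes nonarch: "nonarch_abs v"
begin

lemma v_nonneg [simp]: "0 \<le> v x"
  and v_eq_0 [simp]: "v x = 0 \<longleftrightarrow> x = 0"
  and v_mult: "v (x * y) = v x * v y"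
  and v_add: "v (x + y) \<le> max (v x) (v y)"
  using nonarch by (auto simp: nonarch_abs_def)

lemma v_0 [simp]: "v 0 = 0"
  by simp

lemma v_pos: "x \<noteq> 0 \<Longrightarrow> 0 < v x"
  using v_nonneg[of x] v_eq_0[of x] by linarith

lemma v_1 [simp]: "v 1 = 1"
proof -
  have "v 1 * v 1 = v 1" using v_mult[of 1 1] by simp
  then show ?thesis using v_eq_0[of 1] by simp
qed

lemma v_uminus [simp]: "v (- x) = v x"
proof -
  have "v (-1) * v (-1) = 1" using v_mult[of "-1" "-1"] by simp
  then have "v (-1) = 1" using v_nonneg[of "-1"] by (metis power2_eq_square power2_eq_1_iff
      neg_0_le_iff_le not_one_le_zero)
  then show ?thesis using v_mult[of "-1" x] by simp
qed

lemma v_power: "v (x ^ n) = v x ^ n"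
  by (induction n) (auto simp: v_mult)

lemma v_diff: "v (x - y) \<le> max (v x) (v y)"
  using v_add[of x "- y"] by simp

lemma v_minus_commute: "v (x - y) = v (y - x)"
  using v_uminus[of "x - y"] by simp

lemma v_sum_le: "0 \<le> B \<Longrightarrow> (\<And>x. x \<in> A \<Longrightarrow> v (g x) \<le> B) \<Longrightarrow> v (\<Sum>x\<in>A. g x) \<le> B"
proof (induction A rule: infinite_finite_induct)
  case (insert x A)
  then show ?case using v_add[of "g x" "sum g A"] by fastforce
qed auto

lemma v_add_eq: "v y < v x \<Longrightarrow> v (x + y) = v x"
  using v_add[of x y] v_diff[of "x + y" y] by auto

text \<open>A finite sum with a strictly largest term has the size of that term.\<close>

lemma v_sum_dominant:
  assumes "finite A" "a \<in> A" "g a \<noteq> 0" "\<And>x. x \<in> A - {a} \<Longrightarrow> v (g x) < v (g a)"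
  shows "v (\<Sum>x\<in>A. g x) = v (g a)"
proof -
  have "v (\<Sum>x\<in>A - {a}. g x) < v (g a)"
  proof (cases "A - {a} = {}")
    case True
    then show ?thesis using assms by (metis sum.empty v_0 v_pos)
  next
    case False
    define B where "B = Max ((\<lambda>x. v (g x)) ` (A - {a}))"
    have "B \<in> (\<lambda>x. v (g x)) ` (A - {a})"
      unfolding B_def using False assms by (intro Max_in) auto
    then have "B < v (g a)" "0 \<le> B" using assms(4) by auto
    moreover have "v (\<Sum>x\<in>A - {a}. g x) \<le> B"
      using \<open>0 \<le> B\<close> assms(1) by (intro v_sum_le) (auto simp: B_def)
    ultimately show ?thesis by simp
  qed
  then show ?thesis using v_add_eq assms by (simp add: sum.remove)
qed

text \<open>The coefficientwise form of entireness: it makes the supremum in \<^const>\<open>fps_norm\<close> an attained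
  maximum at every radius, and its closure under products does not involve limits of values.\<close>

definition rapidly_decaying :: "'a fps \<Rightarrow> bool" where
  "rapidly_decaying g \<longleftrightarrow> (\<forall>r\<ge>0. (\<lambda>i. v (fps_nth g i) * r ^ i) \<longlonglongrightarrow> 0)"

lemma term_bounded:
  assumes "rapidly_decaying g" "0 \<le> r"
  shows "bdd_above (range (\<lambda>i. v (fps_nth g i) * r ^ i))"
proof -
  have "(\<lambda>i. v (fps_nth g i) * r ^ i) \<longlonglongrightarrow> 0"
    using assms by (auto simp: rapidly_decaying_def)
  then show ?thesis
    using convergentI convergent_imp_Bseq Bseq_bdd_above by metis
qed

lemma term_le_norm:
  assumes "rapidly_decaying g" "0 \<le> r"
  shows "v (fps_nth g i) * r ^ i \<le> fps_norm v g r"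
  unfolding fps_norm_def using term_bounded[OF assms] by (rule cSUP_upper[rotated]) simp

lemma norm_le: "(\<And>i. v (fps_nth g i) * r ^ i \<le> B) \<Longrightarrow> fps_norm v g r \<le> B"
  unfolding fps_norm_def by (rule cSUP_least) auto

lemma norm_nonneg: "rapidly_decaying g \<Longrightarrow> 0 \<le> r \<Longrightarrow> 0 \<le> fps_norm v g r"
  using order_trans[OF v_nonneg[of "fps_nth g 0"], of "fps_norm v g r"] term_le_norm[of g r 0] by simp

lemma norm_0 [simp]: "fps_norm v 0 r = 0"
  by (simp add: fps_norm_def)

text \<open>The terms tend to \<open>0\<close>, so the supremum is a maximum. The first index that attains it is what
  Gauss's lemma needs.\<close>

lemma norm_attained_first:
  assumes g: "rapidly_decaying g" "g \<noteq> 0" and r: "0 < r"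
  obtains i where "fps_norm v g r = v (fps_nth g i) * r ^ i" "fps_nth g i \<noteq> 0"
    "\<And>j. j < i \<Longrightarrow> v (fps_nth g j) * r ^ j < fps_norm v g r"
proof -
  let ?t = "\<lambda>i. v (fps_nth g i) * r ^ i"
  obtain k where k: "fps_nth g k \<noteq> 0" using g(2) by (auto simp: fps_eq_iff)
  then have kpos: "0 < ?t k" using r by (simp add: v_pos)
  have "?t \<longlonglongrightarrow> 0" using g r by (simp add: rapidly_decaying_def)
  then obtain m where m: "\<And>i. i \<ge> m \<Longrightarrow> ?t i < ?t k"
    using kpos order_tendstoD(2)[of ?t 0 sequentially "?t k"] unfolding eventually_sequentially by blast
  have "k < m" using m[of k] by force
  then have ne: "?t ` {..<m} \<noteq> {}" by auto
  define M where "M = Max (?t ` {..<m})"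
  have "M \<in> ?t ` {..<m}" unfolding M_def using ne by (intro Max_in) auto
  then obtain l where l: "?t l = M" by auto
  have kM: "?t k \<le> M" unfolding M_def using \<open>k < m\<close> by (intro Max_ge) auto
  have le: "?t i \<le> M" for i
  proof (cases "i < m")
    case True
    then show ?thesis unfolding M_def by (intro Max_ge) auto
  next
    case False
    then show ?thesis using m[of i] kM by simp
  qed
  have M: "fps_norm v g r = M"
    using norm_le[of g r M] le term_le_norm[OF g(1), of r l] l r by (intro antisym) auto
  define i where "i = (LEAST i. ?t i = M)"
  have i: "?t i = M" unfolding i_def using l by (rule LeastI)
  have "?t j < M" if "j < i" for j
    using le[of j] not_less_Least[of j "\<lambda>i. ?t i = M"] that unfolding i_def by fastforce
  moreover have "fps_nth g i \<noteq> 0" using i kM kpos by force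
  ultimately show ?thesis using that i M by metis
qed

lemma norm_pos: "rapidly_decaying g \<Longrightarrow> g \<noteq> 0 \<Longrightarrow> 0 < r \<Longrightarrow> 0 < fps_norm v g r"
  by (metis norm_attained_first v_pos zero_less_mult_iff zero_less_power)

lemma rapidly_decaying_const [simp]: "rapidly_decaying (fps_const c)"
proof -
  have "(\<lambda>i. v (fps_nth (fps_const c) i) * r ^ i) \<longlonglongrightarrow> 0" for r
    by (rule tendsto_eventually) (auto simp: eventually_sequentially intro!: exI[of _ 1])
  then show ?thesis by (simp add: rapidly_decaying_def)
qed

lemma norm_const: "0 \<le> r \<Longrightarrow> fps_norm v (fps_const c) r = v c"
  using term_le_norm[of "fps_const c" r 0] norm_le[of "fps_const c" r "v c"]
  by (intro antisym) auto

lemma rapidly_decaying_add: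
  assumes "rapidly_decaying g" "rapidly_decaying h"
  shows "rapidly_decaying (g + h)"
  unfolding rapidly_decaying_def
proof safe
  fix r :: real assume r: "0 \<le> r"
  have "(\<lambda>i. max (v (fps_nth g i) * r ^ i) (v (fps_nth h i) * r ^ i)) \<longlonglongrightarrow> max 0 0"
    using assms r by (intro tendsto_max) (auto simp: rapidly_decaying_def)
  then have lim: "(\<lambda>i. max (v (fps_nth g i)) (v (fps_nth h i)) * r ^ i) \<longlonglongrightarrow> 0"
    using r by (simp add: max_mult_distrib_right)
  have "v (fps_nth (g + h) i) * r ^ i \<le> max (v (fps_nth g i)) (v (fps_nth h i)) * r ^ i" for i
    using r v_add by (intro mult_right_mono) auto
  then show "(\<lambda>i. v (fps_nth (g + h) i) * r ^ i) \<longlonglongrightarrow> 0"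
    using r by (intro tendsto_sandwich[OF _ _ tendsto_const lim]) (auto simp: eventually_sequentially)
qed

lemma norm_add_le:
  assumes "rapidly_decaying g" "rapidly_decaying h" "0 \<le> r"
  shows "fps_norm v (g + h) r \<le> max (fps_norm v g r) (fps_norm v h r)"
proof (rule norm_le)
  fix i
  have "v (fps_nth (g + h) i) * r ^ i \<le> max (v (fps_nth g i)) (v (fps_nth h i)) * r ^ i"
    using assms v_add by (intro mult_right_mono) auto
  also have "\<dots> \<le> max (fps_norm v g r) (fps_norm v h r)"
    using max.mono[OF term_le_norm[of g r i] term_le_norm[of h r i]] assms
    by (simp add: max_mult_distrib_right)
  finally show "v (fps_nth (g + h) i) * r ^ i \<le> max (fps_norm v g r) (fps_norm v h r)" .
qed

lemma term_mult_le:
  assumes "0 \<le> r" "0 \<le> B"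
    and "\<And>i. i \<le> n \<Longrightarrow> (v (fps_nth g i) * r ^ i) * (v (fps_nth h (n - i)) * r ^ (n - i)) \<le> B"
  shows "v (fps_nth (g * h) n) * r ^ n \<le> B"
proof (cases "r ^ n = 0")
  case False
  then have rn: "0 < r ^ n" using zero_le_power[OF assms(1), of n] by linarith
  have "v (fps_nth g i * fps_nth h (n - i)) \<le> B / r ^ n" if "i \<in> {0..n}" for i
  proof -
    have "r ^ i * r ^ (n - i) = r ^ n" using that by (simp flip: power_add)
    then have "v (fps_nth g i * fps_nth h (n - i)) * r ^ n
        = (v (fps_nth g i) * r ^ i) * (v (fps_nth h (n - i)) * r ^ (n - i))"
      by (simp add: v_mult mult.assoc mult.left_commute[of "r ^ i"])
    also have "\<dots> \<le> B" using assms(3) that by simp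
    finally show ?thesis using rn by (simp add: pos_le_divide_eq)
  qed
  then have "v (fps_nth (g * h) n) \<le> B / r ^ n"
    unfolding fps_mult_nth using assms rn by (intro v_sum_le) auto
  then show ?thesis using rn by (simp add: pos_le_divide_eq)
next
  case True
  then show ?thesis using assms(2) by (metis mult_zero_right)
qed

lemma rapidly_decaying_mult:
  assumes g: "rapidly_decaying g" and h: "rapidly_decaying h"
  shows "rapidly_decaying (g * h)"
  unfolding rapidly_decaying_def
proof safe
  fix r :: real assume r: "0 \<le> r"
  let ?s = "\<lambda>i. v (fps_nth g i) * r ^ i" and ?t = "\<lambda>i. v (fps_nth h i) * r ^ i"
  define M where "M = max 1 (max (fps_norm v g r) (fps_norm v h r))"
  have M: "1 \<le> M" "?s i \<le> M" "?t i \<le> M" "0 \<le> ?s i" "0 \<le> ?t i" for i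
    using term_le_norm[OF g r, of i] term_le_norm[OF h r, of i] r by (auto simp: M_def)
  show "(\<lambda>n. v (fps_nth (g * h) n) * r ^ n) \<longlonglongrightarrow> 0"
  proof (rule LIMSEQ_I)
    fix e :: real assume e: "0 < e"
    define e' where "e' = e / (2 * M)"
    have e': "0 < e'" "M * e' < e" using e M(1) by (auto simp: e'_def field_simps)
    have "?s \<longlonglongrightarrow> 0" "?t \<longlonglongrightarrow> 0" using g h r by (auto simp: rapidly_decaying_def)
    then have "\<forall>\<^sub>F i in sequentially. ?s i < e' \<and> ?t i < e'"
      using e'(1) by (intro eventually_conj order_tendstoD(2)) auto
    then obtain m where m: "\<And>i. i \<ge> m \<Longrightarrow> ?s i < e' \<and> ?t i < e'"
      by (auto simp: eventually_sequentially)
    have "v (fps_nth (g * h) n) * r ^ n < e" if n: "n \<ge> 2 * m" for n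
    proof -
      have "v (fps_nth (g * h) n) * r ^ n \<le> M * e'"
      proof (rule term_mult_le[OF r])
        show "0 \<le> M * e'" using e' M(1) by simp
        fix i assume "i \<le> n"
        show "?s i * ?t (n - i) \<le> M * e'"
        proof (cases "i \<ge> m")
          case True
          then show ?thesis using m[of i] M(3,4,5) mult_mono[of "?t (n - i)" M "?s i" e'] M(1)
            by (simp add: mult.commute)
        next
          case False
          then have "n - i \<ge> m" using n by simp
          then show ?thesis using m[of "n - i"] M(2,4,5) M(1) by (intro mult_mono) auto
        qed
      qed
      then show ?thesis using e' by simp
    qed
    then show "\<exists>no. \<forall>n\<ge>no. norm (v (fps_nth (g * h) n) * r ^ n - 0) < e"
      using r by (intro exI[of _ "2 * m"]) auto
  qed
qed

text \<open>Gauss's lemma. Let \<open>i\<close> and \<open>j\<close> be the first indices at which the terms of \<open>g\<close> and \<open>h\<close> attain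
  their norms. In the coefficient of index \<open>i + j\<close> of the product the contribution of this pair is
  strictly larger than all others.\<close>

lemma norm_mult:
  assumes g: "rapidly_decaying g" and h: "rapidly_decaying h" and r: "0 < r"
  shows "fps_norm v (g * h) r = fps_norm v g r * fps_norm v h r"
proof (cases "g = 0 \<or> h = 0")
  case False
  let ?G = "fps_norm v g r" and ?H = "fps_norm v h r"
  have pos: "0 < ?G" "0 < ?H" using False norm_pos g h r by auto
  obtain i where i: "?G = v (fps_nth g i) * r ^ i" "fps_nth g i \<noteq> 0"
    and i_first: "\<And>k. k < i \<Longrightarrow> v (fps_nth g k) * r ^ k < ?G"
    using norm_attained_first g False r by metis
  obtain j where j: "?H = v (fps_nth h j) * r ^ j" "fps_nth h j \<noteq> 0"
    and j_first: "\<And>k. k < j \<Longrightarrow> v (fps_nth h k) * r ^ k < ?H"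
    using norm_attained_first h False r by metis
  have "v (\<Sum>k=0..i + j. fps_nth g k * fps_nth h (i + j - k)) = v (fps_nth g i * fps_nth h (i + j - i))"
  proof (rule v_sum_dominant)
    fix k assume "k \<in> {0..i + j} - {i}"
    then have k: "k \<le> i + j" "k \<noteq> i" by auto
    have lt: "(v (fps_nth g k) * r ^ k) * (v (fps_nth h (i + j - k)) * r ^ (i + j - k)) < ?G * ?H"
    proof (cases "k < i")
      case True
      have "(v (fps_nth g k) * r ^ k) * (v (fps_nth h (i + j - k)) * r ^ (i + j - k))
          \<le> (v (fps_nth g k) * r ^ k) * ?H"
        using term_le_norm[OF h, of r "i + j - k"] r by (intro mult_left_mono) auto
      also have "\<dots> < ?G * ?H"
        using i_first[OF True] pos by (intro mult_strict_right_mono)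
      finally show ?thesis .
    next
      case False
      then have "i + j - k < j" using k by linarith
      have "(v (fps_nth g k) * r ^ k) * (v (fps_nth h (i + j - k)) * r ^ (i + j - k))
          \<le> ?G * (v (fps_nth h (i + j - k)) * r ^ (i + j - k))"
        using term_le_norm[OF g, of r k] r by (intro mult_right_mono) auto
      also have "\<dots> < ?G * ?H"
        using j_first \<open>i + j - k < j\<close> pos by (intro mult_strict_left_mono)
      finally show ?thesis .
    qed
    have "r ^ i * r ^ j = r ^ k * r ^ (i + j - k)" using k by (simp flip: power_add)
    then have "v (fps_nth g k) * v (fps_nth h (i + j - k)) * (r ^ i * r ^ j)
        = (v (fps_nth g k) * r ^ k) * (v (fps_nth h (i + j - k)) * r ^ (i + j - k))"
      by (simp only:) (simp add: mult_ac)
    also have "\<dots> < ?G * ?H" by (rule lt)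
    also have "\<dots> = v (fps_nth g i) * v (fps_nth h j) * (r ^ i * r ^ j)"
      using i(1) j(1) by (simp add: mult_ac)
    finally have "v (fps_nth g k) * v (fps_nth h (i + j - k)) * (r ^ i * r ^ j)
        < v (fps_nth g i) * v (fps_nth h j) * (r ^ i * r ^ j)" .
    then show "v (fps_nth g k * fps_nth h (i + j - k)) < v (fps_nth g i * fps_nth h (i + j - i))"
      using r by (simp add: v_mult)
  qed (use i j in auto)
  then have "v (fps_nth (g * h) (i + j)) * r ^ (i + j) = ?G * ?H"
    using i(1) j(1) by (simp add: fps_mult_nth v_mult power_add mult_ac)
  then have "?G * ?H \<le> fps_norm v (g * h) r"
    using term_le_norm[OF rapidly_decaying_mult[OF g h], of r "i + j"] r by simp
  moreover have "fps_norm v (g * h) r \<le> ?G * ?H"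
    using r pos term_le_norm[OF g, of r] term_le_norm[OF h, of r]
    by (intro norm_le term_mult_le mult_mono) auto
  ultimately show ?thesis by simp
qed auto

lemma rapidly_decaying_0 [simp]: "rapidly_decaying 0"
  using rapidly_decaying_const[of 0] by simp

lemma rapidly_decaying_1 [simp]: "rapidly_decaying 1"
  using rapidly_decaying_const[of 1] by simp

lemma rapidly_decaying_power: "rapidly_decaying g \<Longrightarrow> rapidly_decaying (g ^ n)"
  by (induction n) (auto intro: rapidly_decaying_mult)

lemma rapidly_decaying_sum:
  "(\<And>x. x \<in> A \<Longrightarrow> rapidly_decaying (g x)) \<Longrightarrow> rapidly_decaying (\<Sum>x\<in>A. g x)"
  by (induction A rule: infinite_finite_induct) (auto intro: rapidly_decaying_add)

lemma rapidly_decaying_prod: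
  "(\<And>x. x \<in> A \<Longrightarrow> rapidly_decaying (g x)) \<Longrightarrow> rapidly_decaying (\<Prod>x\<in>A. g x)"
  by (induction A rule: infinite_finite_induct) (auto intro: rapidly_decaying_mult)

lemma norm_1 [simp]: "0 \<le> r \<Longrightarrow> fps_norm v 1 r = 1"
  using norm_const[of r 1] by simp

lemma norm_power:
  "rapidly_decaying g \<Longrightarrow> 0 < r \<Longrightarrow> fps_norm v (g ^ n) r = fps_norm v g r ^ n"
  by (induction n) (auto simp: norm_mult rapidly_decaying_power)

lemma norm_prod:
  "(\<And>x. x \<in> A \<Longrightarrow> rapidly_decaying (g x)) \<Longrightarrow> 0 < r \<Longrightarrow>
    fps_norm v (\<Prod>x\<in>A. g x) r = (\<Prod>x\<in>A. fps_norm v (g x) r)"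
  by (induction A rule: infinite_finite_induct) (auto simp: norm_mult rapidly_decaying_prod)

lemma norm_sum_le:
  assumes "\<And>x. x \<in> A \<Longrightarrow> rapidly_decaying (g x)" "0 \<le> r" "0 \<le> B"
    and "\<And>x. x \<in> A \<Longrightarrow> fps_norm v (g x) r \<le> B"
  shows "fps_norm v (\<Sum>x\<in>A. g x) r \<le> B"
  using assms
proof (induction A rule: infinite_finite_induct)
  case (insert x A)
  then have "fps_norm v (g x + sum g A) r \<le> max (fps_norm v (g x) r) (fps_norm v (sum g A) r)"
    by (intro norm_add_le rapidly_decaying_sum) auto
  then show ?case using insert by fastforce
qed auto

end

section \<open>Values of entire series\<close>

context nonarch_field
begin

sublocale Metric_space UNIV "abs_dist v"
proof
  fix x y z :: 'a
  show "abs_dist v x z \<le> abs_dist v x y + abs_dist v y z"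
    using order_trans[OF v_add[of "x - y" "y - z"] max.boundedI]
      v_nonneg[of "x - y"] v_nonneg[of "y - z"] by (simp add: abs_dist_def)
qed (auto simp: abs_dist_def v_minus_commute)

lemma has_value_iff:
  "fps_has_value v g z s \<longleftrightarrow> (\<lambda>n. v ((\<Sum>i<n. fps_nth g i * z ^ i) - s)) \<longlonglongrightarrow> 0"
  by (simp add: fps_has_value_def limitin_metric abs_dist_def tendsto_iff)

lemma has_value_unique:
  assumes "fps_has_value v g z s" "fps_has_value v g z t" shows "s = t"
  using assms limitin_metric_unique[of _ s sequentially t] unfolding fps_has_value_def by simp

lemma fps_value_eq: "fps_has_value v g z s \<Longrightarrow> fps_value v g z = s"
  unfolding fps_value_def using has_value_unique by blast

lemma entire_has_value: "entire v g \<Longrightarrow> fps_has_value v g z (fps_value v g z)"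
  using fps_value_eq unfolding entire_def by metis

lemma has_value_const [simp]: "fps_has_value v (fps_const c) z c"
proof -
  have "(\<Sum>i<Suc n. fps_nth (fps_const c) i * z ^ i) = c" for n
    by (induction n) auto
  then show ?thesis unfolding has_value_iff
    by (intro tendsto_eventually) (auto simp: eventually_sequentially intro!: exI[of _ 1] elim!: Suc_le_D[THEN exE])
qed

lemma null_by_bound:
  assumes "(\<lambda>n. b n) \<longlonglongrightarrow> 0" "\<And>n. v (x n) \<le> b n"
  shows "(\<lambda>n. v (x n)) \<longlonglongrightarrow> 0"
  using assms by (intro tendsto_sandwich[OF _ _ tendsto_const assms(1)]) auto

lemma null_max:
  assumes "a \<longlonglongrightarrow> 0" "b \<longlonglongrightarrow> 0" shows "(\<lambda>n. max (a n) (b n) :: real) \<longlonglongrightarrow> 0"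
  using tendsto_max[OF assms] by simp

lemma has_value_add:
  assumes "fps_has_value v g z s" "fps_has_value v h z t"
  shows "fps_has_value v (g + h) z (s + t)"
proof -
  let ?S = "\<lambda>g n. \<Sum>i<n. fps_nth g i * z ^ i"
  have eq: "?S (g + h) n - (s + t) = (?S g n - s) + (?S h n - t)" for n
    by (simp add: ring_distribs sum.distrib)
  have "v (?S (g + h) n - (s + t)) \<le> max (v (?S g n - s)) (v (?S h n - t))" for n
    unfolding eq by (rule v_add)
  moreover have "(\<lambda>n. max (v (?S g n - s)) (v (?S h n - t))) \<longlonglongrightarrow> 0"
    using assms by (intro null_max) (auto simp: has_value_iff)
  ultimately show ?thesis unfolding has_value_iff by (rule null_by_bound[rotated])
qed

text \<open>The product of the partial sums of length \<open>n\<close> differs from the partial sum of the product by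
  the terms with indices \<open>i, j < n\<close> and \<open>i + j \<ge> n\<close>. One of the two indices is at least \<open>n / 2\<close>,
  so these terms are uniformly small.\<close>

lemma has_value_mult:
  assumes g: "fps_has_value v g z s" "rapidly_decaying g"
    and h: "fps_has_value v h z t" "rapidly_decaying h"
  shows "fps_has_value v (g * h) z (s * t)"
proof -
  let ?S = "\<lambda>g n. \<Sum>i<n. fps_nth g i * z ^ i"
  let ?a = "\<lambda>i. fps_nth g i * z ^ i" and ?b = "\<lambda>i. fps_nth h i * z ^ i"
  have lim: "(\<lambda>n. v (?a n)) \<longlonglongrightarrow> 0" "(\<lambda>n. v (?b n)) \<longlonglongrightarrow> 0"
    using g h by (auto simp: rapidly_decaying_def v_mult v_power)
  define M where "M = max 1 (max (fps_norm v g (v z)) (fps_norm v h (v z)))"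
  have M: "1 \<le> M" "v (?a i) \<le> M" "v (?b i) \<le> M" for i
    using term_le_norm[OF g(2), of "v z" i] term_le_norm[OF h(2), of "v z" i]
    by (auto simp: M_def v_mult v_power)
  have tail: "(\<lambda>n. v (?S (g * h) n - ?S g n * ?S h n)) \<longlonglongrightarrow> 0"
  proof (rule LIMSEQ_I)
    fix e :: real assume e: "0 < e"
    define e' where "e' = e / (2 * M)"
    have e': "0 < e'" "M * e' < e" using e M(1) by (auto simp: e'_def field_simps)
    have "\<forall>\<^sub>F i in sequentially. v (?a i) < e' \<and> v (?b i) < e'"
      using e'(1) lim by (intro eventually_conj order_tendstoD(2)) auto
    then obtain m where m: "\<And>i. i \<ge> m \<Longrightarrow> v (?a i) < e' \<and> v (?b i) < e'"
      by (auto simp: eventually_sequentially)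
    have "v (?S (g * h) n - ?S g n * ?S h n) \<le> M * e'" if n: "n \<ge> 2 * m" for n
    proof -
      let ?T = "{(i, j). i < n \<and> j < n}" and ?U = "{(i, j). i + j < n}"
      have fin: "finite ?T" "?U \<subseteq> ?T" by (auto intro: finite_subset[of _ "{..<n} \<times> {..<n}"])
      have "?S (g * h) n = (\<Sum>k<n. \<Sum>i\<le>k. ?a i * ?b (k - i))"
      proof (intro sum.cong refl)
        fix k
        have "fps_nth g i * fps_nth h (k - i) * z ^ k = ?a i * ?b (k - i)" if "i \<le> k" for i
        proof -
          have "z ^ k = z ^ i * z ^ (k - i)" using that by (simp flip: power_add)
          then show ?thesis by (simp add: mult_ac)
        qed
        then show "fps_nth (g * h) k * z ^ k = (\<Sum>i\<le>k. ?a i * ?b (k - i))"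
          unfolding fps_mult_nth sum_distrib_right atLeast0AtMost by (intro sum.cong) auto
      qed
      also have "\<dots> = (\<Sum>(i, j)\<in>?U. ?a i * ?b j)"
        by (rule sum.triangle_reindex[symmetric])
      finally have 1: "?S (g * h) n = (\<Sum>(i, j)\<in>?U. ?a i * ?b j)" .
      have T: "?T = {..<n} \<times> {..<n}" by auto
      have "?S g n * ?S h n = (\<Sum>(i, j)\<in>?T. ?a i * ?b j)"
        unfolding T by (simp add: sum_product sum.cartesian_product)
      also have "\<dots> = (\<Sum>(i, j)\<in>?T - ?U. ?a i * ?b j) + (\<Sum>(i, j)\<in>?U. ?a i * ?b j)"
        using fin by (rule sum.subset_diff[rotated])
      finally have "?S g n * ?S h n - ?S (g * h) n = (\<Sum>(i, j)\<in>?T - ?U. ?a i * ?b j)"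
        using 1 by simp
      moreover have "v (\<Sum>(i, j)\<in>?T - ?U. ?a i * ?b j) \<le> M * e'"
      proof (rule v_sum_le)
        fix x assume "x \<in> ?T - ?U"
        then obtain i j where x: "x = (i, j)" "i + j \<ge> n" by (cases x) auto
        have "v (?a i) * v (?b j) \<le> M * e'"
        proof (cases "i \<ge> m")
          case True
          then have "v (?a i) * v (?b j) \<le> e' * M"
            using m[OF True] M(1) M(3)[of j] e' by (intro mult_mono) auto
          then show ?thesis by (simp add: mult.commute)
        next
          case False
          then have "j \<ge> m" using x n by simp
          then show ?thesis using m[of j] M(1) M(2)[of i] by (intro mult_mono) auto
        qed
        then show "v (case x of (i, j) \<Rightarrow> ?a i * ?b j) \<le> M * e'" by (simp add: x v_mult)
      qed (use e' M(1) in auto)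
      ultimately show ?thesis using v_minus_commute by metis
    qed
    then show "\<exists>no. \<forall>n\<ge>no. norm (v (?S (g * h) n - ?S g n * ?S h n) - 0) < e"
      using e' by (intro exI[of _ "2 * m"]) fastforce
  qed
  have lim2: "(\<lambda>n. v (?S g n - s)) \<longlonglongrightarrow> 0" "(\<lambda>n. v (?S h n - t)) \<longlonglongrightarrow> 0"
    using g h by (auto simp: has_value_iff)
  have lim3: "(\<lambda>n. max (v (?S g n - s) * v (?S h n - t))
      (max (v s * v (?S h n - t)) (v (?S g n - s) * v t))) \<longlonglongrightarrow> 0"
    using lim2 by (intro null_max tendsto_mult_zero tendsto_mult_right_zero tendsto_mult_left_zero)
  have "v (?S g n * ?S h n - s * t) \<le> max (v (?S g n - s) * v (?S h n - t))
      (max (v s * v (?S h n - t)) (v (?S g n - s) * v t))" for n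
  proof -
    have "?S g n * ?S h n - s * t
        = (?S g n - s) * (?S h n - t) + (s * (?S h n - t) + (?S g n - s) * t)"
      by (simp add: algebra_simps)
    then show ?thesis
      using v_add[of "(?S g n - s) * (?S h n - t)" "s * (?S h n - t) + (?S g n - s) * t"]
        v_add[of "s * (?S h n - t)" "(?S g n - s) * t"]
      by (simp add: v_mult)
  qed
  then have lim4: "(\<lambda>n. v (?S g n * ?S h n - s * t)) \<longlonglongrightarrow> 0"
    by (rule null_by_bound[OF lim3])
  have "v (?S (g * h) n - s * t) \<le>
      max (v (?S (g * h) n - ?S g n * ?S h n)) (v (?S g n * ?S h n - s * t))" for n
    using v_add[of "?S (g * h) n - ?S g n * ?S h n" "?S g n * ?S h n - s * t"] by simp
  then show ?thesis unfolding has_value_iff by (rule null_by_bound[OF null_max[OF tail lim4]])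
qed

lemma has_value_power:
  "fps_has_value v g z s \<Longrightarrow> rapidly_decaying g \<Longrightarrow> fps_has_value v (g ^ n) z (s ^ n)"
  using has_value_const[of 1 z]
  by (induction n) (auto intro!: has_value_mult rapidly_decaying_power)

lemma has_value_prod:
  "(\<And>x. x \<in> A \<Longrightarrow> fps_has_value v (g x) z (s x) \<and> rapidly_decaying (g x)) \<Longrightarrow>
    fps_has_value v (\<Prod>x\<in>A. g x) z (\<Prod>x\<in>A. s x)"
  using has_value_const[of 1 z]
  by (induction A rule: infinite_finite_induct) (auto intro!: has_value_mult rapidly_decaying_prod)

lemma has_value_sum:
  "(\<And>x. x \<in> A \<Longrightarrow> fps_has_value v (g x) z (s x)) \<Longrightarrow>
    fps_has_value v (\<Sum>x\<in>A. g x) z (\<Sum>x\<in>A. s x)"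
  using has_value_const[of 0 z]
  by (induction A rule: infinite_finite_induct) (auto intro!: has_value_add)

text \<open>Either the absolute value is trivial or it takes arbitrarily large values.\<close>

lemma trivial_or_unbounded:
  obtains "\<And>x. x \<noteq> 0 \<Longrightarrow> v x = 1" | w where "1 < v w"
proof (cases "\<exists>w. 1 < v w")
  case False
  have "v x = 1" if "x \<noteq> 0" for x
  proof -
    have "v x * v (inverse x) = 1" using v_mult[of x "inverse x"] that by simp
    moreover have "v x \<le> 1" "v (inverse x) \<le> 1" using False not_le by blast+
    ultimately show ?thesis using mult_left_le[of "v (inverse x)" "v x"] by simp
  qed
  then show ?thesis using that by blast
qed (use that in blast)

text \<open>The terms of a convergent series tend to \<open>0\<close>. This is used at a point of absolute value at
  least \<open>r\<close>; for the trivial absolute value there is none for \<open>r > 1\<close>, but convergence at \<open>1\<close> already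
  leaves only finitely many nonzero coefficients.\<close>

lemma entire_rapidly_decaying:
  assumes "entire v g" shows "rapidly_decaying g"
  unfolding rapidly_decaying_def
proof safe
  fix r :: real assume r: "0 \<le> r"
  have lim: "(\<lambda>n. v (fps_nth g n) * v z ^ n) \<longlonglongrightarrow> 0" for z
  proof -
    obtain s where "fps_has_value v g z s" using assms by (auto simp: entire_def)
    then have "(\<lambda>n. v ((\<Sum>i<n. fps_nth g i * z ^ i) - s)) \<longlonglongrightarrow> 0" (is "?f \<longlonglongrightarrow> 0")
      by (simp add: has_value_iff)
    then have "(\<lambda>n. max (?f (Suc n)) (?f n)) \<longlonglongrightarrow> 0"
      by (intro null_max LIMSEQ_Suc)
    then have "(\<lambda>n. v (fps_nth g n * z ^ n)) \<longlonglongrightarrow> 0"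
    proof (rule null_by_bound)
      fix n
      show "v (fps_nth g n * z ^ n) \<le> max (?f (Suc n)) (?f n)"
        using v_diff[of "(\<Sum>i<Suc n. fps_nth g i * z ^ i) - s" "(\<Sum>i<n. fps_nth g i * z ^ i) - s"]
        by simp
    qed
    then show ?thesis by (simp add: v_mult v_power)
  qed
  show "(\<lambda>i. v (fps_nth g i) * r ^ i) \<longlonglongrightarrow> 0"
  proof (rule trivial_or_unbounded)
    assume triv: "\<And>x. x \<noteq> 0 \<Longrightarrow> v x = 1"
    have "\<forall>\<^sub>F i in sequentially. v (fps_nth g i) < 1"
      using order_tendstoD(2)[OF lim[of 1], of 1] by simp
    then have "\<forall>\<^sub>F i in sequentially. v (fps_nth g i) * r ^ i = 0"
      by (rule eventually_mono) (use triv in force)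
    then show ?thesis by (rule tendsto_eventually)
  next
    fix w assume w: "1 < v w"
    obtain k where "r < v w ^ k" using real_arch_pow[OF w] by blast
    then have k: "r ^ i \<le> v (w ^ k) ^ i" for i using r by (intro power_mono) (auto simp: v_power)
    show ?thesis
      using r k by (intro tendsto_sandwich[OF _ _ tendsto_const lim[of "w ^ k"]])
        (auto intro!: always_eventually mult_left_mono)
  qed
qed

text \<open>For a nontrivial absolute value the lowest nonzero term dominates at small arguments; for the
  trivial one the series is a polynomial.\<close>

lemma eq_0_if_values_0:
  assumes g: "rapidly_decaying g" and 0: "\<And>z. fps_has_value v g z 0"
    and inf: "infinite (UNIV :: 'a set)"
  shows "g = 0"
proof (rule trivial_or_unbounded)
  assume triv: "\<And>x. x \<noteq> 0 \<Longrightarrow> v x = 1"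
  have "(\<lambda>i. v (fps_nth g i)) \<longlonglongrightarrow> 0"
    using g[unfolded rapidly_decaying_def, rule_format, of 1] by simp
  then have "\<forall>\<^sub>F i in sequentially. v (fps_nth g i) < 1"
    by (rule order_tendstoD(2)) simp
  then obtain m where m: "\<And>i. i \<ge> m \<Longrightarrow> fps_nth g i = 0"
    using triv unfolding eventually_sequentially by (metis less_irrefl)
  define p where "p = (\<Sum>i<m. monom (fps_nth g i) i)"
  have "poly p z = 0" for z
  proof -
    have "poly p z = (\<Sum>i<n. fps_nth g i * z ^ i)" if "n \<ge> m" for n
    proof -
      have "(\<Sum>i<n. fps_nth g i * z ^ i) = (\<Sum>i<m. fps_nth g i * z ^ i)"
        using that m by (intro sum.mono_neutral_right) auto
      then show ?thesis by (simp add: p_def poly_sum poly_monom)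
    qed
    then have "\<forall>\<^sub>F n in sequentially. v ((\<Sum>i<n. fps_nth g i * z ^ i) - 0) = v (poly p z)"
      unfolding eventually_sequentially by (intro exI[of _ m]) auto
    then have "(\<lambda>n. v ((\<Sum>i<n. fps_nth g i * z ^ i) - 0)) \<longlonglongrightarrow> v (poly p z)"
      by (rule tendsto_eventually)
    then have "v (poly p z) = 0"
      using 0[of z] LIMSEQ_unique unfolding has_value_iff by blast
    then show ?thesis by simp
  qed
  then have "p = 0" using inf poly_roots_finite[of p] by auto
  have "fps_nth g i = 0" for i
  proof (cases "i < m")
    case True
    then have "coeff p i = fps_nth g i" by (simp add: p_def coeff_sum)
    then show ?thesis using \<open>p = 0\<close> by simp
  qed (use m in auto)
  then show ?thesis by (simp add: fps_eq_iff)
next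
  fix w assume w: "1 < v w"
  show ?thesis
  proof (rule ccontr)
    assume "g \<noteq> 0"
    define k where "k = (LEAST k. fps_nth g k \<noteq> 0)"
    have "\<exists>k. fps_nth g k \<noteq> 0" using \<open>g \<noteq> 0\<close> by (simp add: fps_nonzero_nth)
    then have k: "fps_nth g k \<noteq> 0" unfolding k_def by (rule LeastI_ex)
    have k_first: "fps_nth g i = 0" if "i < k" for i
      using not_less_Least that unfolding k_def by blast
    define M where "M = max 1 (fps_norm v g 1)"
    have M: "0 < M" "v (fps_nth g i) \<le> M" for i
      using term_le_norm[OF g, of 1 i] by (auto simp: M_def)
    have "w \<noteq> 0" using w by auto
    obtain n where n: "M / v (fps_nth g k) < v w ^ n" using real_arch_pow[OF w] by blast
    define z where "z = inverse w ^ n"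
    have "v (inverse w) = inverse (v w)"
      using v_mult[of w "inverse w"] \<open>w \<noteq> 0\<close> by (simp add: field_simps)
    then have vz: "v z = inverse (v w ^ n)" by (metis z_def v_power power_inverse)
    have "z \<noteq> 0" using \<open>w \<noteq> 0\<close> by (simp add: z_def)
    have z: "v z \<le> 1" "M * v z < v (fps_nth g k)"
      using n w k unfolding vz by (auto simp: field_simps v_pos)
    have "v ((\<Sum>i<l. fps_nth g i * z ^ i) - 0) = v (fps_nth g k * z ^ k)" if l: "l \<ge> Suc k" for l
    proof -
      have "v (\<Sum>i<l. fps_nth g i * z ^ i) = v (fps_nth g k * z ^ k)"
      proof (rule v_sum_dominant)
        fix i assume "i \<in> {..<l} - {k}"
        then have "i < k \<or> Suc k \<le> i" by auto
        then show "v (fps_nth g i * z ^ i) < v (fps_nth g k * z ^ k)"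
        proof
          assume "i < k"
          then show ?thesis using k \<open>z \<noteq> 0\<close> by (simp add: k_first v_pos)
        next
          assume i: "Suc k \<le> i"
          have "v (fps_nth g i * z ^ i) \<le> M * v z ^ Suc k"
            using M(2)[of i] power_decreasing[OF i, of "v z"] z M(1)
            by (auto simp: v_mult v_power intro!: mult_mono)
          also have "\<dots> = (M * v z) * v z ^ k" by simp
          also have "\<dots> < v (fps_nth g k) * v z ^ k"
            using z(2) \<open>z \<noteq> 0\<close> by (intro mult_strict_right_mono) (auto simp: v_pos)
          finally show ?thesis by (simp add: v_mult v_power)
        qed
      qed (use k \<open>z \<noteq> 0\<close> l in auto)
      then show ?thesis by simp
    qed
    then have "\<forall>\<^sub>F l in sequentially. v ((\<Sum>i<l. fps_nth g i * z ^ i) - 0) = v (fps_nth g k * z ^ k)"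
      unfolding eventually_sequentially by blast
    then have "(\<lambda>l. v ((\<Sum>i<l. fps_nth g i * z ^ i) - 0)) \<longlonglongrightarrow> v (fps_nth g k * z ^ k)"
      by (rule tendsto_eventually)
    then have "v (fps_nth g k * z ^ k) = 0"
      using 0[of z] LIMSEQ_unique unfolding has_value_iff by blast
    then show False using k \<open>z \<noteq> 0\<close> by simp
  qed
qed

end

section \<open>Polynomials and ideals\<close>

definition mconst :: "'a::comm_ring_1 \<Rightarrow> ('v::finite, 'a) mpoly" where
  "mconst a = Poly_Mapping.single 0 a"

definition mvar :: "'v \<Rightarrow> ('v::finite, 'a::comm_ring_1) mpoly" where
  "mvar j = Poly_Mapping.single (Poly_Mapping.single j 1) 1"

lemma sum_single_exponents:
  fixes m :: "'v::finite \<Rightarrow>\<^sub>0 nat"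
  shows "(\<Sum>j\<in>UNIV. Poly_Mapping.single j (Poly_Mapping.lookup m j)) = m"
  by (rule poly_mapping_eqI)
    (simp add: Poly_Mapping.lookup_sum Poly_Mapping.lookup_single when_def)

lemma mvar_power: "mvar j ^ n = Poly_Mapping.single (Poly_Mapping.single j n) 1"
  by (induction n) (auto simp: mvar_def mult_single single_add[symmetric])

lemma monomial_eq_prod:
  "Poly_Mapping.single m a = mconst a * (\<Prod>j\<in>UNIV. mvar j ^ Poly_Mapping.lookup m j)"
proof -
  have "(\<Prod>j\<in>A. Poly_Mapping.single (f j) 1) = Poly_Mapping.single (\<Sum>j\<in>A. f j) (1 :: 'b)"
    for A and f :: "'a \<Rightarrow> ('a \<Rightarrow>\<^sub>0 nat)"
    by (induction A rule: infinite_finite_induct) (auto simp: mult_single)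
  then show ?thesis by (simp add: mvar_power sum_single_exponents mconst_def mult_single)
qed

lemma mpoly_eq_sum_monomials:
  "Q = (\<Sum>m\<in>Poly_Mapping.keys Q. Poly_Mapping.single m (Poly_Mapping.lookup Q m))"
  by (rule poly_mapping_eqI)
    (auto simp: Poly_Mapping.lookup_sum Poly_Mapping.lookup_single when_def in_keys_iff)

lemma mpoly_induct [case_names const var add mult]:
  assumes "\<And>a. P (mconst a)" "\<And>j. P (mvar j)"
    and "\<And>F G. P F \<Longrightarrow> P G \<Longrightarrow> P (F + G)" "\<And>F G. P F \<Longrightarrow> P G \<Longrightarrow> P (F * G)"
  shows "P (Q :: ('v::finite, 'a::comm_ring_1) mpoly)"
proof -
  have 01: "P 0" "P 1" using assms(1)[of 0] assms(1)[of 1] by (simp_all add: mconst_def)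
  have pow: "P (F ^ n)" if "P F" for F n
    using that 01 assms(4) by (induction n) auto
  have prod: "P (\<Prod>j\<in>A. f j)" if "\<And>j. P (f j)" for A :: "'v set" and f
    using that 01 assms(4) by (induction A rule: infinite_finite_induct) auto
  have "P (\<Sum>m\<in>A. Poly_Mapping.single m (Poly_Mapping.lookup Q m))" for A
    using 01 assms prod pow
    by (induction A rule: infinite_finite_induct) (auto simp: monomial_eq_prod)
  then show ?thesis using mpoly_eq_sum_monomials[of Q] by metis
qed

text \<open>Substitution into a polynomial after a homomorphism \<open>c\<close> of its coefficients is a ring
  homomorphism. Evaluation, composition with a tuple of power series, restriction to a line and the
  separation of homogeneous components are all of this kind.\<close>

locale coeff_hom =
  fixes c :: "'a::comm_ring_1 \<Rightarrow> 'b::comm_ring_1"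
  assumes c_add: "c (x + y) = c x + c y" and c_mult: "c (x * y) = c x * c y" and c_1: "c 1 = 1"
begin

text \<open>Not a simplification rule, since for the identity homomorphism it would read \<open>0 = 0\<close>.\<close>

lemma c_0: "c 0 = 0"
  using c_add[of 0 0] by simp

lemma insert_eq_sum:
  assumes "finite A" "Poly_Mapping.keys Q \<subseteq> A"
  shows "mpoly_insert c Q x =
    (\<Sum>m\<in>A. c (Poly_Mapping.lookup Q m) * (\<Prod>j\<in>UNIV. (x $ j) ^ Poly_Mapping.lookup m j))"
  unfolding mpoly_insert_def
  using assms by (intro sum.mono_neutral_left) (auto simp: in_keys_iff c_0)

lemma insert_add: "mpoly_insert c (P + Q) x = mpoly_insert c P x + mpoly_insert c Q x"
proof -
  let ?A = "Poly_Mapping.keys P \<union> Poly_Mapping.keys Q"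
  have "Poly_Mapping.keys (P + Q) \<subseteq> ?A" by (rule Poly_Mapping.keys_add)
  then show ?thesis
    by (simp add: insert_eq_sum[of ?A] Poly_Mapping.lookup_add c_add ring_distribs sum.distrib)
qed

lemma insert_0 [simp]: "mpoly_insert c 0 x = 0"
  by (simp add: mpoly_insert_def)

lemma insert_sum: "mpoly_insert c (\<Sum>i\<in>A. P i) x = (\<Sum>i\<in>A. mpoly_insert c (P i) x)"
  by (induction A rule: infinite_finite_induct) (auto simp: insert_add)

lemma insert_single:
  "mpoly_insert c (Poly_Mapping.single m a) x
    = c a * (\<Prod>j\<in>UNIV. (x $ j) ^ Poly_Mapping.lookup m j)"
  by (simp add: insert_eq_sum[of "{m}"])

lemma insert_mult: "mpoly_insert c (P * Q) x = mpoly_insert c P x * mpoly_insert c Q x"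
proof -
  have 1: "mpoly_insert c (Poly_Mapping.single m a * Poly_Mapping.single n b) x
      = mpoly_insert c (Poly_Mapping.single m a) x * mpoly_insert c (Poly_Mapping.single n b) x"
    for m n a b
    by (simp add: mult_single insert_single c_mult Poly_Mapping.lookup_add power_add prod.distrib
        mult_ac)
  define f g where "f m = Poly_Mapping.single m (Poly_Mapping.lookup P m)"
    and "g m = Poly_Mapping.single m (Poly_Mapping.lookup Q m)" for m
  have "P = sum f (Poly_Mapping.keys P)" "Q = sum g (Poly_Mapping.keys Q)"
    unfolding f_def g_def by (rule mpoly_eq_sum_monomials)+
  moreover have "mpoly_insert c (sum f A * sum g B) x
      = mpoly_insert c (sum f A) x * mpoly_insert c (sum g B) x" for A B
    unfolding sum_product insert_sum f_def g_def 1 ..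
  ultimately show ?thesis by metis
qed

lemma insert_mconst [simp]: "mpoly_insert c (mconst a) x = c a"
  by (simp add: mconst_def insert_single)

lemma insert_mvar [simp]: "mpoly_insert c (mvar j) x = x $ j"
proof -
  have "(\<Prod>i\<in>UNIV. (x $ i) ^ Poly_Mapping.lookup (Poly_Mapping.single j 1) i)
      = (\<Prod>i\<in>UNIV. if i = j then x $ i else 1)"
    by (intro prod.cong) (auto simp: Poly_Mapping.lookup_single)
  then show ?thesis by (simp add: mvar_def insert_single c_1)
qed

lemma insert_1 [simp]: "mpoly_insert c 1 x = 1"
  using insert_mconst[of 1] by (simp add: mconst_def c_1)

lemma insert_uminus: "mpoly_insert c (- P) x = - mpoly_insert c P x"
  using insert_add[of "- P" P x] by (simp add: eq_neg_iff_add_eq_0)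

lemma insert_diff: "mpoly_insert c (P - Q) x = mpoly_insert c P x - mpoly_insert c Q x"
  using insert_add[of P "- Q" x] by (simp add: insert_uminus)

lemma insert_power: "mpoly_insert c (P ^ n) x = mpoly_insert c P x ^ n"
  by (induction n) (auto simp: insert_mult)

lemma insert_prod: "mpoly_insert c (\<Prod>i\<in>A. P i) x = (\<Prod>i\<in>A. mpoly_insert c (P i) x)"
  by (induction A rule: infinite_finite_induct) (auto simp: insert_mult)

lemmas insert_simps = insert_add insert_mult insert_sum insert_uminus insert_diff insert_power insert_prod

end

interpretation eval: coeff_hom "\<lambda>a::'a::comm_ring_1. a"
  by standard auto

interpretation comp: coeff_hom "fps_const :: 'a::comm_ring_1 \<Rightarrow> 'a fps"
  by standard auto

lemmas mpoly_eval_simps [simp] =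
  eval.insert_simps[folded mpoly_eval_def] eval.insert_0[folded mpoly_eval_def]
  eval.insert_1[folded mpoly_eval_def] eval.insert_mconst[folded mpoly_eval_def]
  eval.insert_mvar[folded mpoly_eval_def]

lemmas mpoly_comp_simps [simp] =
  comp.insert_simps[folded mpoly_comp_def] comp.insert_0[folded mpoly_comp_def]
  comp.insert_1[folded mpoly_comp_def] comp.insert_mconst[folded mpoly_comp_def]
  comp.insert_mvar[folded mpoly_comp_def]

text \<open>A commutative ring is a module over itself, with the ideals as submodules.\<close>

interpretation ideal: module "(*) :: 'r::comm_ring_1 \<Rightarrow> 'r \<Rightarrow> 'r"
  by standard (auto simp: algebra_simps)

lemmas [simp del] = ideal.scale_scale

definition prime_ideal :: "'r::comm_ring_1 set \<Rightarrow> bool" where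
  "prime_ideal p \<longleftrightarrow> ideal.subspace p \<and> 1 \<notin> p \<and> (\<forall>x y. x * y \<in> p \<longrightarrow> x \<in> p \<or> y \<in> p)"

lemma ideal_mult_right: "ideal.subspace I \<Longrightarrow> x \<in> I \<Longrightarrow> x * y \<in> I"
  using ideal.subspace_scale[of I x y] by (simp add: mult.commute)

lemma prime_ideal_power: "prime_ideal p \<Longrightarrow> x ^ n \<in> p \<Longrightarrow> x \<in> p"
  by (induction n) (auto simp: prime_ideal_def)

text \<open>Krull's construction: an ideal that is maximal among those containing no power of \<open>x\<close> is
  prime. For if \<open>a\<close> and \<open>b\<close> lie outside it, adjoining either of them yields a power of \<open>x\<close>, and
  the product of these two powers lies in the ideal as soon as \<open>a * b\<close> does.\<close>

lemma exists_prime_ideal_avoiding: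
  fixes I :: "'r::comm_ring_1 set"
  assumes I: "ideal.subspace I" and x: "\<And>n::nat. x ^ n \<notin> I"
  obtains p where "prime_ideal p" "I \<subseteq> p" "x \<notin> p"
proof -
  define \<A> where "\<A> = {J. ideal.subspace J \<and> I \<subseteq> J \<and> (\<forall>n::nat. x ^ n \<notin> J)}"
  have "\<exists>M\<in>\<A>. \<forall>J\<in>\<A>. M \<subseteq> J \<longrightarrow> J = M"
  proof (rule subset_Zorn_nonempty)
    show "\<A> \<noteq> {}" using assms by (auto simp: \<A>_def)
    fix \<C> assume ne: "\<C> \<noteq> {}" and chain: "subset.chain \<A> \<C>"
    have sub: "ideal.subspace J" "I \<subseteq> J" "x ^ n \<notin> J" if "J \<in> \<C>" for J and n :: nat
    proof -
      have "J \<in> \<A>" using chain that by (auto simp: subset.chain_def)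
      then show "ideal.subspace J" "I \<subseteq> J" "x ^ n \<notin> J" unfolding \<A>_def by blast+
    qed
    have lin: "J \<subseteq> L \<or> L \<subseteq> J" if "J \<in> \<C>" "L \<in> \<C>" for J L
      using chain that by (auto simp: subset.chain_def)
    have "ideal.subspace (\<Union>\<C>)"
    proof (rule ideal.subspaceI)
      obtain J where "J \<in> \<C>" using ne by blast
      then have "0 \<in> J" using sub(1) ideal.subspace_0 by blast
      then show "0 \<in> \<Union>\<C>" using \<open>J \<in> \<C>\<close> by blast
      fix a b assume "a \<in> \<Union>\<C>" "b \<in> \<Union>\<C>"
      then obtain J L where JL: "J \<in> \<C>" "a \<in> J" "L \<in> \<C>" "b \<in> L" by auto
      then obtain M where "M \<in> \<C>" "a \<in> M" "b \<in> M" using lin[of J L] by blast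
      then have "a + b \<in> M" using sub(1) ideal.subspace_add by blast
      then show "a + b \<in> \<Union>\<C>" using \<open>M \<in> \<C>\<close> by blast
    next
      fix a c assume "a \<in> \<Union>\<C>"
      then obtain M where "M \<in> \<C>" "a \<in> M" by blast
      then have "c * a \<in> M" using sub(1) ideal.subspace_scale by blast
      then show "c * a \<in> \<Union>\<C>" using \<open>M \<in> \<C>\<close> by blast
    qed
    moreover obtain J where "J \<in> \<C>" using ne by blast
    then have "I \<subseteq> \<Union>\<C>" using sub(2) by blast
    moreover have "x ^ n \<notin> \<Union>\<C>" for n :: nat using sub(3) by blast
    ultimately show "\<Union>\<C> \<in> \<A>" unfolding \<A>_def by blast
  qed
  then obtain M where M: "M \<in> \<A>" and max: "\<And>J. J \<in> \<A> \<Longrightarrow> M \<subseteq> J \<Longrightarrow> J = M" by blast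
  have subM: "ideal.subspace M" "I \<subseteq> M" "\<And>n::nat. x ^ n \<notin> M" using M by (auto simp: \<A>_def)
  have hit: "\<exists>n m r. m \<in> M \<and> x ^ n = m + r * a" if a: "a \<notin> M" for a
  proof (rule ccontr)
    assume no: "\<not> ?thesis"
    define J where "J = {m + r * a | m r. m \<in> M}"
    have mem: "y \<in> J" if "y = m + r * a" "m \<in> M" for y m r unfolding J_def using that by blast
    have memD: "\<exists>m r. y = m + r * a \<and> m \<in> M" if "y \<in> J" for y using that unfolding J_def by blast
    have "ideal.subspace J"
    proof (rule ideal.subspaceI)
      show "0 \<in> J" using mem[of 0 0 0] ideal.subspace_0[OF subM(1)] by simp
      fix y z assume "y \<in> J" "z \<in> J"
      then obtain m r m' r' where "y = m + r * a" "z = m' + r' * a" "m \<in> M" "m' \<in> M" using memD by metis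
      then show "y + z \<in> J" using ideal.subspace_add[OF subM(1)]
        by (intro mem[of _ "m + m'" "r + r'"]) (auto simp: algebra_simps)
    next
      fix y c assume "y \<in> J"
      then obtain m r where "y = m + r * a" "m \<in> M" using memD by metis
      then show "c * y \<in> J" using ideal.subspace_scale[OF subM(1)]
        by (intro mem[of _ "c * m" "c * r"]) (simp_all add: distrib_left mult.assoc)
    qed
    moreover have MJ: "M \<subseteq> J" using mem[of _ _ 0] by auto
    ultimately have "J \<in> \<A>" using subM(2) no memD unfolding \<A>_def by blast
    then have "J = M" using max MJ by blast
    moreover have "a \<in> J" using mem[of a 0 1] ideal.subspace_0[OF subM(1)] by simp
    ultimately show False using a by blast
  qed
  have "a \<in> M \<or> b \<in> M" if ab: "a * b \<in> M" for a b
  proof (rule ccontr)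
    assume "\<not> ?thesis"
    then obtain k l m r m' r' where *: "m \<in> M" "x ^ k = m + r * a" "m' \<in> M" "x ^ l = m' + r' * b"
      using hit by metis
    have "x ^ (k + l) = m * x ^ l + (r * a * m' + r * r' * (a * b))"
      by (simp add: power_add *(2,4)) (simp add: algebra_simps)
    also have "\<dots> \<in> M"
      using ideal_mult_right[OF subM(1) *(1)] ideal.subspace_scale[OF subM(1) *(3)]
        ideal.subspace_scale[OF subM(1) ab] by (intro ideal.subspace_add[OF subM(1)])
    finally show False using subM(3) by blast
  qed
  then have "prime_ideal M" using subM(1) subM(3)[of 0] by (auto simp: prime_ideal_def)
  then show ?thesis using that subM(2) subM(3)[of 1] by auto
qed

section \<open>Minimal equations modulo a prime ideal\<close>

definition subring :: "'r::comm_ring_1 set \<Rightarrow> bool" where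
  "subring B \<longleftrightarrow> 0 \<in> B \<and> 1 \<in> B \<and> (\<forall>x\<in>B. - x \<in> B) \<and> (\<forall>x\<in>B. \<forall>y\<in>B. x + y \<in> B \<and> x * y \<in> B)"

lemma subringD:
  assumes "subring B"
  shows "0 \<in> B" "1 \<in> B" "x \<in> B \<Longrightarrow> - x \<in> B" "x \<in> B \<Longrightarrow> y \<in> B \<Longrightarrow> x + y \<in> B"
    "x \<in> B \<Longrightarrow> y \<in> B \<Longrightarrow> x * y \<in> B" "x \<in> B \<Longrightarrow> y \<in> B \<Longrightarrow> x - y \<in> B"
  using assms unfolding subring_def
  by (auto, metis (no_types, opaque_lifting) add_uminus_conv_diff)

lemma subring_sum: "subring B \<Longrightarrow> (\<And>x. x \<in> A \<Longrightarrow> g x \<in> B) \<Longrightarrow> (\<Sum>x\<in>A. g x) \<in> B"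
  by (induction A rule: infinite_finite_induct) (auto intro: subringD)

lemma subring_power: "subring B \<Longrightarrow> x \<in> B \<Longrightarrow> x ^ n \<in> B"
  by (induction n) (auto intro: subringD)

definition coeffs_in :: "'r::comm_ring_1 set \<Rightarrow> 'r poly set" where
  "coeffs_in B = {p. \<forall>i. coeff p i \<in> B}"

lemma coeffs_in_closed:
  assumes B: "subring B"
  shows "0 \<in> coeffs_in B" "b \<in> B \<Longrightarrow> monom b n \<in> coeffs_in B" "b \<in> B \<Longrightarrow> [:b:] \<in> coeffs_in B"
    "p \<in> coeffs_in B \<Longrightarrow> q \<in> coeffs_in B \<Longrightarrow> p + q \<in> coeffs_in B"
    "p \<in> coeffs_in B \<Longrightarrow> q \<in> coeffs_in B \<Longrightarrow> p - q \<in> coeffs_in B"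
    "p \<in> coeffs_in B \<Longrightarrow> q \<in> coeffs_in B \<Longrightarrow> p * q \<in> coeffs_in B"
    "b \<in> B \<Longrightarrow> p \<in> coeffs_in B \<Longrightarrow> smult b p \<in> coeffs_in B"
    "p \<in> coeffs_in B \<Longrightarrow> - p \<in> coeffs_in B"
  using subringD[OF B]
  by (auto simp: coeffs_in_def coeff_mult coeff_pCons split: nat.split intro!: subring_sum[OF B])

text \<open>Pseudo-division. The leading coefficient of the divisor is the coefficient of a prescribed
  degree \<open>d\<close>, since in a ring with zero divisors degrees need not be additive; for the same
  reason the degree of the quotient is part of the claim.\<close>

lemma pseudo_division:
  assumes B: "subring B" and p: "p \<in> coeffs_in B" "\<And>i. i > d \<Longrightarrow> coeff p i = 0"
    and q: "q \<in> coeffs_in B" "\<And>i. i \<ge> d + n \<Longrightarrow> coeff q i = 0"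
  shows "\<exists>k s r. s \<in> coeffs_in B \<and> r \<in> coeffs_in B \<and> smult (coeff p d ^ k) q = p * s + r \<and>
    (\<forall>i\<ge>d. coeff r i = 0) \<and> (\<forall>i\<ge>n. coeff s i = 0)"
  using q
proof (induction n arbitrary: q)
  case 0
  then show ?case using B
    by (intro exI[of _ 0] exI[of _ "0::'a poly"] exI[of _ q]) (auto intro: coeffs_in_closed)
next
  case (Suc n)
  let ?b = "coeff p d" and ?a = "coeff q (d + n)"
  have ab: "?b \<in> B" "?a \<in> B" using p(1) Suc.prems(1) by (auto simp: coeffs_in_def)
  let ?q = "smult ?b q - monom ?a n * p"
  have "coeff ?q i = 0" if "i \<ge> d + n" for i
  proof (cases "i = d + n")
    case True
    then show ?thesis by (simp add: coeff_monom_mult mult.commute[of ?b ?a])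
  next
    case False
    then show ?thesis using that Suc.prems(2)[of i] p(2)[of "i - n"]
      by (simp add: coeff_monom_mult)
  qed
  moreover have "?q \<in> coeffs_in B"
    using B ab p Suc.prems by (intro coeffs_in_closed)
  ultimately obtain k s r where IH: "s \<in> coeffs_in B" "r \<in> coeffs_in B"
    "smult (?b ^ k) ?q = p * s + r" "\<forall>i\<ge>d. coeff r i = 0" "\<forall>i\<ge>n. coeff s i = 0"
    using Suc.IH by blast
  have "smult (?b ^ Suc k) q = smult (?b ^ k) ?q + smult (?b ^ k) (monom ?a n) * p"
    by (simp add: smult_diff_right mult.commute)
  also have "\<dots> = p * (s + smult (?b ^ k) (monom ?a n)) + r"
    unfolding IH(3) by (simp add: algebra_simps)
  finally show ?case
    using IH B ab
    by (intro exI[of _ "Suc k"] exI[of _ "s + smult (?b ^ k) (monom ?a n)"] exI[of _ r])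
      (auto intro!: coeffs_in_closed subring_power)
qed

text \<open>Modulo a prime ideal the coefficients above the last one outside it may be discarded.\<close>

lemma cut_leading_coeffs:
  assumes B: "subring B" and I: "ideal.subspace I" and p: "p \<in> coeffs_in B" "coeff p j \<notin> I"
    and n: "\<And>i. i \<ge> n \<Longrightarrow> coeff p i = 0"
  obtains p' d where "p' \<in> coeffs_in B" "poly p x - poly p' x \<in> I" "coeff p' d \<notin> I"
    "\<And>i. i > d \<Longrightarrow> coeff p' i = 0" "d < n"
proof -
  let ?D = "{i. coeff p i \<notin> I}"
  have 0: "0 \<in> I" using I ideal.subspace_0 by blast
  have fin: "finite ?D" using n 0 by (intro finite_subset[of ?D "{..<n}"]) (auto, metis not_le)
  define d where "d = Max ?D"
  have d: "coeff p d \<notin> I" using Max_in[OF fin] p(2) unfolding d_def by blast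
  have above: "coeff p i \<in> I" if "i > d" for i
    using Max_ge[OF fin, of i] that unfolding d_def by force
  define p' where "p' = (\<Sum>i\<le>d. monom (coeff p i) i)"
  have coeff: "coeff p' i = (if i \<le> d then coeff p i else 0)" for i
    by (simp add: p'_def coeff_sum)
  have diff: "coeff (p - p') i \<in> I" for i using above 0 by (auto simp: coeff)
  have "poly (p - p') x \<in> I"
    unfolding poly_altdef using diff I by (intro ideal.subspace_sum ideal_mult_right)
  moreover have "p' \<in> coeffs_in B" using p(1) subringD(1)[OF B] by (auto simp: coeffs_in_def coeff)
  moreover have "d < n" using d n[of d] 0 by (metis not_le)
  ultimately show ?thesis using that[of p' d] d by (simp add: coeff)
qed

lemma poly_in_ideal: "ideal.subspace I \<Longrightarrow> (\<And>i. coeff p i \<in> I) \<Longrightarrow> poly p x \<in> I"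
  unfolding poly_altdef by (intro ideal.subspace_sum ideal_mult_right)

lemma LEAST_attained:
  fixes P :: "nat \<Rightarrow> bool"
  assumes "P k" obtains d where "P d" "\<And>i. P i \<Longrightarrow> d \<le> i"
  using assms LeastI Least_le by metis

text \<open>Modulo \<open>I\<close>, the polynomial has degree \<open>d\<close>; that the higher coefficients vanish exactly, and
  not only modulo \<open>I\<close>, is what pseudo-division requires.\<close>

definition has_lead :: "'r::comm_ring_1 set \<Rightarrow> 'r poly \<Rightarrow> nat \<Rightarrow> bool" where
  "has_lead I p d \<longleftrightarrow> coeff p d \<notin> I \<and> (\<forall>i>d. coeff p i = 0)"

text \<open>The algebraic case: \<open>x\<close> satisfies modulo \<open>I\<close> a nontrivial equation over \<open>B\<close>. Let \<open>p\<close> be one of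
  least degree. Over the field of fractions of \<open>B\<close> modulo \<open>I\<close> it is irreducible, hence \<open>c\<close>, which is
  nonzero, is invertible there: modulo \<open>I\<close> it divides some \<open>b'\<close> from \<open>B\<close> outside \<open>I\<close>. The proof
  avoids fractions. Among the polynomials whose value at \<open>x\<close> is modulo \<open>I\<close> a multiple of \<open>c\<close>, one
  of least degree turns out to be constant.\<close>

lemma minimal_equation:
  fixes I B :: "'r::comm_ring_1 set"
  assumes B: "subring B" and I: "prime_ideal I"
    and c: "c = poly q x" "q \<in> coeffs_in B" "c \<notin> I"
    and alg: "p\<^sub>0 \<in> coeffs_in B" "poly p\<^sub>0 x \<in> I" "coeff p\<^sub>0 j\<^sub>0 \<notin> I"
  obtains p d b' h where "p \<in> coeffs_in B" "poly p x \<in> I" "has_lead I p d"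
    "\<And>r i. r \<in> coeffs_in B \<Longrightarrow> poly r x \<in> I \<Longrightarrow> (\<And>i. i \<ge> d \<Longrightarrow> coeff r i = 0) \<Longrightarrow> coeff r i \<in> I"
    "b' \<in> B" "b' \<notin> I" "h \<in> coeffs_in B" "b' - poly h x * c \<in> I"
proof -
  have idl: "ideal.subspace I" and prime: "\<And>x y. x * y \<in> I \<Longrightarrow> x \<in> I \<or> y \<in> I"
    using I by (auto simp: prime_ideal_def)
  have lead_pow: "coeff w e ^ k \<notin> I" if "has_lead I w e" for w e k
    using prime_ideal_power[OF I] that by (auto simp: has_lead_def)
  \<comment> \<open>\<open>Z\<close> consists of the equations of \<open>x\<close> modulo \<open>I\<close>, and \<open>W\<close> of the polynomials whose value at
    \<open>x\<close> is modulo \<open>I\<close> a multiple of \<open>c\<close>.\<close>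
  define Z where "Z = {w \<in> coeffs_in B. poly w x \<in> I}"
  define W where "W = {w \<in> coeffs_in B. \<exists>h\<in>coeffs_in B. poly w x - poly h x * c \<in> I}"
  have ZW: "Z \<subseteq> W"
    using coeffs_in_closed(1)[OF B] by (force simp: Z_def W_def)
  have cut: "\<exists>w'\<in>U. \<exists>d<n. has_lead I w' d"
    if U: "U = Z \<or> U = W" and w: "w \<in> U" "coeff w j \<notin> I" "\<And>i. i \<ge> n \<Longrightarrow> coeff w i = 0"
    for U w j n
  proof -
    have wB: "w \<in> coeffs_in B" using U w(1) by (auto simp: Z_def W_def)
    obtain w' d where w': "w' \<in> coeffs_in B" "poly w x - poly w' x \<in> I" "coeff w' d \<notin> I"
      "\<And>i. i > d \<Longrightarrow> coeff w' i = 0" "d < n"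
      using cut_leading_coeffs[OF B idl wB w(2,3)] by metis
    have "poly w' x - y \<in> I" if "poly w x - y \<in> I" for y
      using ideal.subspace_diff[OF idl that w'(2)] by simp
    from this[of 0] this have "w' \<in> U"
      using U w(1) w'(1) by (auto simp: Z_def W_def)
    then show ?thesis using w' by (auto simp: has_lead_def)
  qed
  have "p\<^sub>0 \<in> Z" using alg by (simp add: Z_def)
  then obtain k\<^sub>0 where "\<exists>w\<in>Z. has_lead I w k\<^sub>0"
    using cut[of Z p\<^sub>0 j\<^sub>0 "Suc (degree p\<^sub>0)"] alg(3) by (metis Suc_le_eq coeff_eq_0)
  then obtain d where d: "\<exists>p\<in>Z. has_lead I p d" "\<And>i. \<exists>p\<in>Z. has_lead I p i \<Longrightarrow> d \<le> i"
    using LEAST_attained[of "\<lambda>d. \<exists>p\<in>Z. has_lead I p d"] by metis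
  then obtain p where p: "p \<in> Z" "has_lead I p d" by blast
  then have "\<exists>w\<in>W. has_lead I w d" using ZW by blast
  then obtain e where e: "\<exists>w\<in>W. has_lead I w e" "\<And>i. \<exists>w\<in>W. has_lead I w i \<Longrightarrow> e \<le> i"
    using LEAST_attained[of "\<lambda>e. \<exists>w\<in>W. has_lead I w e"] by metis
  then obtain w where w: "w \<in> W" "has_lead I w e" by blast
  have ed: "e \<le> d" using e(2) p ZW by blast
  have min_d: "coeff r i \<in> I" if "r \<in> Z" "\<And>i. i \<ge> d \<Longrightarrow> coeff r i = 0" for r i
    using cut[of Z r i d] that d(2) by (meson not_le)
  have min_e: "poly r x \<in> I" if "r \<in> W" "\<And>i. i \<ge> e \<Longrightarrow> coeff r i = 0" for r
  proof (rule poly_in_ideal[OF idl], rule ccontr)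
    fix i assume "coeff r i \<notin> I"
    then show False using cut[of W r i e] that e(2) by (meson not_le)
  qed
  have pB: "p \<in> coeffs_in B" "poly p x \<in> I" and wB: "w \<in> coeffs_in B"
    using p w by (auto simp: Z_def W_def)
  obtain h where h: "h \<in> coeffs_in B" "poly w x - poly h x * c \<in> I"
    using w by (auto simp: W_def)
  \<comment> \<open>Dividing \<open>p\<close> by \<open>w\<close> leaves a remainder in \<open>W\<close> of smaller degree, so \<open>p\<close> is modulo \<open>I\<close> the
    product of \<open>w\<close> and the quotient \<open>s\<close>. As \<open>I\<close> is prime, one of the factors has \<open>x\<close> as a zero.\<close>
  have "e = 0"
  proof (rule ccontr)
    assume "e \<noteq> 0"
    let ?b = "coeff w e"
    obtain k s r where div: "s \<in> coeffs_in B" "r \<in> coeffs_in B" "smult (?b ^ k) p = w * s + r"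
      "\<forall>i\<ge>e. coeff r i = 0" "\<forall>i\<ge>Suc d - e. coeff s i = 0"
      using pseudo_division[OF B wB _ pB(1), of e "Suc d - e"] w(2) p(2) ed
      by (auto simp: has_lead_def)
    have r: "poly r x = ?b ^ k * poly p x - poly w x * poly s x"
      using arg_cong[OF div(3), of "\<lambda>p. poly p x"] by simp
    have "poly r x - poly (- (h * s)) x * c
        = ?b ^ k * poly p x - (poly w x - poly h x * c) * poly s x"
      unfolding r by (simp add: algebra_simps)
    also have "\<dots> \<in> I" 
      by (rule ideal.subspace_diff[OF idl ideal.subspace_scale[OF idl pB(2)]
          ideal_mult_right[OF idl h(2)]])
    finally have "r \<in> W" using B div h by (auto simp: W_def intro!: coeffs_in_closed bexI[of _ "- (h * s)"])
    then have rI: "poly r x \<in> I" using min_e div(4) by blast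
    have "poly w x * poly s x = ?b ^ k * poly p x - poly r x" using r by simp
    also have "\<dots> \<in> I" 
      by (rule ideal.subspace_diff[OF idl ideal.subspace_scale[OF idl pB(2)] rI])
    finally consider "poly w x \<in> I" | "poly s x \<in> I" using prime by blast
    then show False
    proof cases
      case 1
      \<comment> \<open>Then \<open>p\<close> has least degree in \<open>W\<close> too, and dividing \<open>q\<close> by \<open>p\<close> would put \<open>c\<close> into \<open>I\<close>.\<close>
      then have "d \<le> e" using d(2) w wB by (auto simp: Z_def)
      let ?a = "coeff p d"
      obtain k s r where div: "s \<in> coeffs_in B" "r \<in> coeffs_in B" "smult (?a ^ k) q = p * s + r"
        "\<forall>i\<ge>d. coeff r i = 0"
        using pseudo_division[OF B pB(1) _ c(2), of d "Suc (degree q)"] p(2)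
        by (auto simp: has_lead_def coeff_eq_0)
      have r: "poly r x = ?a ^ k * c - poly p x * poly s x"
        using arg_cong[OF div(3), of "\<lambda>p. poly p x"] by (simp add: c(1))
      have "?a ^ k \<in> B" using pB(1) B by (auto simp: coeffs_in_def intro: subring_power)
      then have "r \<in> W" using div(2) pB(2) r B
        by (auto simp: W_def intro!: coeffs_in_closed bexI[of _ "[:?a ^ k:]"]
            ideal.subspace_neg[OF idl] ideal_mult_right[OF idl])
      then have "poly r x \<in> I" using min_e div(4) \<open>d \<le> e\<close> by simp
      then have "poly r x + poly p x * poly s x \<in> I" 
        by (rule ideal.subspace_add[OF idl _ ideal_mult_right[OF idl pB(2)]])
      then have "?a ^ k * c \<in> I" using r by simp
      then show False using prime lead_pow[OF p(2)] c(3) by blast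
    next
      case 2
      \<comment> \<open>The quotient has degree less than \<open>d\<close>, so it vanishes modulo \<open>I\<close> and \<open>p\<close> cannot have
        degree \<open>d\<close>.\<close>
      have "coeff s i \<in> I" for i
        using min_d[of s i] div(1,5) 2 \<open>e \<noteq> 0\<close> by (auto simp: Z_def)
      then have "coeff (w * s) d \<in> I"
        unfolding coeff_mult using idl by (intro ideal.subspace_sum ideal.subspace_scale)
      then have "?b ^ k * coeff p d \<in> I"
        using arg_cong[OF div(3), of "\<lambda>p. coeff p d"] div(4) ed by simp
      then show False using prime lead_pow[OF w(2)] p(2) by (auto simp: has_lead_def)
    qed
  qed
  then have "w = [:coeff w 0:]" using w(2)
    by (intro poly_eqI) (auto simp: has_lead_def coeff_pCons split: nat.split)
  then have "poly w x = coeff w 0" by (metis poly_pCons poly_0 mult_zero_right add.right_neutral)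
  moreover have "coeff w 0 \<in> B" "coeff w 0 \<notin> I"
    using w(2) wB \<open>e = 0\<close> by (auto simp: has_lead_def coeffs_in_def)
  ultimately show ?thesis
    using that[OF pB p(2) _ _ _ h(1)] min_d h(2) by (force simp: Z_def)
qed

section \<open>The Nullstellensatz\<close>

text \<open>A family of homomorphisms \<open>e t\<close> that agree on \<open>B\<close> and send \<open>x\<close> to \<open>t\<close>. It stands for the
  evaluations at the points that extend a given one by a further coordinate \<open>t\<close>. The base point,
  that is the common restriction to \<open>B\<close>, is referred to as \<open>e 0\<close>.\<close>

locale simple_extension =
  fixes B :: "'r::comm_ring_1 set" and x :: 'r and e :: "'a::alg_closed_field \<Rightarrow> 'r \<Rightarrow> 'a"
  assumes subring: "subring B"
    and e_add: "e t (F + G) = e t F + e t G" and e_mult: "e t (F * G) = e t F * e t G"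
    and e_1: "e t 1 = 1" and e_x: "e t x = t" and e_B: "F \<in> B \<Longrightarrow> e t F = e 0 F"
begin

lemma e_0: "e t 0 = 0"
  by (metis add_cancel_right_right add_0 e_add)

lemma e_uminus: "e t (- F) = - e t F"
  using e_add[of t F "- F"] e_0 by (simp add: eq_neg_iff_add_eq_0 add.commute)

lemma e_diff: "e t (F - G) = e t F - e t G"
  using e_add[of t F "- G"] by (simp add: e_uminus)

lemma e_power: "e t (F ^ n) = e t F ^ n"
  by (induction n) (auto simp: e_mult e_1)

lemma e_sum: "e t (\<Sum>i\<in>A. g i) = (\<Sum>i\<in>A. e t (g i))"
  by (induction A rule: infinite_finite_induct) (auto simp: e_0 e_add)

definition spec :: "'r poly \<Rightarrow> 'a poly" where
  "spec p = map_poly (e 0) p"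

lemma coeff_spec: "coeff (spec p) i = e 0 (coeff p i)"
  unfolding spec_def by (rule coeff_map_poly) (rule e_0)

lemma e_poly: "p \<in> coeffs_in B \<Longrightarrow> e t (poly p x) = poly (spec p) t"
proof -
  assume p: "p \<in> coeffs_in B"
  have coeff: "coeff (spec p) i = e t (coeff p i)" for i
    using p e_B[of "coeff p i" t] by (simp add: coeff_spec coeffs_in_def)
  have "degree (spec p) \<le> degree p" unfolding spec_def by (rule map_poly_degree_leq)
  then have "poly (spec p) t = (\<Sum>i\<le>degree p. coeff (spec p) i * t ^ i)"
    unfolding poly_altdef by (intro sum.mono_neutral_left) (auto simp: coeff_eq_0)
  then show ?thesis by (simp add: poly_altdef coeff e_sum e_mult e_power e_x)
qed

end

text \<open>A point of the variety of \<open>I \<inter> B\<close> outside the zeros of a suitable \<open>b\<close> lifts to a point of the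
  variety of \<open>I\<close> outside the zeros of \<open>c\<close>. If \<open>x\<close> is transcendental modulo \<open>I\<close>, all but finitely
  many \<open>t\<close> do. Otherwise \<open>t\<close> is a root of the specialised minimal equation \<open>p\<close>; the factor of \<open>b\<close>
  that is the leading coefficient of \<open>p\<close> keeps the degree of \<open>p\<close> from dropping and makes division
  by \<open>p\<close> possible after specialisation, and the factor \<open>b'\<close> keeps \<open>c\<close> from vanishing.\<close>

lemma extend_zero:
  fixes I B :: "'r::comm_ring_1 set"
  assumes subring: "subring B" and I: "prime_ideal I"
    and c: "c = poly q x" "q \<in> coeffs_in B" "c \<notin> I"
  shows "\<exists>b\<in>B. b \<notin> I \<and> (\<forall>e :: 'a::alg_closed_field \<Rightarrow> 'r \<Rightarrow> 'a. simple_extension B x e \<longrightarrow>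
    (\<forall>F\<in>B \<inter> I. e 0 F = 0) \<longrightarrow> e 0 b \<noteq> 0 \<longrightarrow>
    (\<exists>t. (\<forall>p\<in>coeffs_in B. poly p x \<in> I \<longrightarrow> e t (poly p x) = 0) \<and> e t c \<noteq> 0))"
    (is "\<exists>b\<in>B. b \<notin> I \<and> (\<forall>e. _ e \<longrightarrow> ?kills e \<longrightarrow> e 0 b \<noteq> 0 \<longrightarrow> ?lifts e)")
proof (cases "\<exists>p\<in>coeffs_in B. poly p x \<in> I \<and> (\<exists>i. coeff p i \<notin> I)")
  case False
  have idl: "ideal.subspace I" using I by (simp add: prime_ideal_def)
  obtain i where i: "coeff q i \<notin> I" using poly_in_ideal[OF idl] c by metis
  have "?lifts e" if ext: "simple_extension B x e" and kills: "?kills e"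
    and nz: "e 0 (coeff q i) \<noteq> 0" for e :: "'a \<Rightarrow> 'r \<Rightarrow> 'a"
  proof -
    interpret simple_extension B x e by (rule ext)
    have "spec q \<noteq> 0" using nz coeff_spec by (metis coeff_0)
    then have "{t. poly (spec q) t = 0} \<noteq> UNIV"
      using poly_roots_finite infinite_UNIV_alg_closed by metis
    then obtain t where t: "poly (spec q) t \<noteq> 0" by blast
    have "e t (poly p x) = 0" if p: "p \<in> coeffs_in B" "poly p x \<in> I" for p
    proof -
      have "spec p = 0"
        using False p kills by (intro poly_eqI) (auto simp: coeff_spec coeffs_in_def)
      then show ?thesis using e_poly[OF p(1)] by simp
    qed
    moreover have "e t c \<noteq> 0" using t e_poly[OF c(2)] c(1) by simp
    ultimately show ?thesis by blast
  qed
  moreover have "coeff q i \<in> B" using c(2) by (simp add: coeffs_in_def)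
  ultimately show ?thesis using i by blast
next
  case True
  have idl: "ideal.subspace I" and prime: "\<And>x y. x * y \<in> I \<Longrightarrow> x \<in> I \<or> y \<in> I"
    using I by (auto simp: prime_ideal_def)
  obtain p d b' h where p: "p \<in> coeffs_in B" "poly p x \<in> I" "has_lead I p d"
    and min: "\<And>r i. r \<in> coeffs_in B \<Longrightarrow> poly r x \<in> I \<Longrightarrow> (\<And>i. i \<ge> d \<Longrightarrow> coeff r i = 0) \<Longrightarrow> coeff r i \<in> I"
    and b': "b' \<in> B" "b' \<notin> I" and h: "h \<in> coeffs_in B" "b' - poly h x * c \<in> I"
    using minimal_equation[OF subring I c] True by metis
  let ?a = "coeff p d"
  have a: "?a \<in> B" "?a \<notin> I" using p by (auto simp: coeffs_in_def has_lead_def)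
  have b: "b' * ?a \<in> B" "b' * ?a \<notin> I" using a b' prime subringD(5)[OF subring] by auto
  have "?lifts e" if ext: "simple_extension B x e" and kills: "?kills e"
    and nz: "e 0 (b' * ?a) \<noteq> 0" for e :: "'a \<Rightarrow> 'r \<Rightarrow> 'a"
  proof -
    interpret simple_extension B x e by (rule ext)
    have nz: "e 0 b' \<noteq> 0" "e 0 ?a \<noteq> 0" using nz by (auto simp: e_mult)
    have "d \<noteq> 0"
    proof
      assume "d = 0"
      then have "p = [:?a:]" using p(3)
        by (intro poly_eqI) (auto simp: has_lead_def coeff_pCons split: nat.split)
      then have "poly p x = ?a" by (metis poly_pCons poly_0 mult_zero_right add.right_neutral)
      then show False using p(2) a(2) by simp
    qed
    moreover have "d \<le> degree (spec p)" using nz(2) by (intro le_degree) (simp add: coeff_spec)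
    ultimately have "degree (spec p) > 0" by linarith
    then obtain t where t: "poly (spec p) t = 0" using alg_closed_imp_poly_has_root by blast
    have zero: "e t (poly g x) = 0" if g: "g \<in> coeffs_in B" "poly g x \<in> I" for g
    proof -
      obtain k s r where div: "s \<in> coeffs_in B" "r \<in> coeffs_in B" "smult (?a ^ k) g = p * s + r"
        "\<forall>i\<ge>d. coeff r i = 0"
        using pseudo_division[OF subring p(1) _ g(1), of d "Suc (degree g)"] p(3)
        by (auto simp: has_lead_def coeff_eq_0)
      have eq: "?a ^ k * poly g x = poly p x * poly s x + poly r x"
        using arg_cong[OF div(3), of "\<lambda>p. poly p x"] by simp
      then have "poly r x = ?a ^ k * poly g x - poly p x * poly s x" by simp
      also have "\<dots> \<in> I"
        by (rule ideal.subspace_diff[OF idl ideal.subspace_scale[OF idl g(2)]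
            ideal_mult_right[OF idl p(2)]])
      finally have "coeff r i \<in> I" for i using min div(2,4) by blast
      then have "spec r = 0"
        using div(2) kills by (intro poly_eqI) (auto simp: coeff_spec coeffs_in_def)
      then have "e t (?a ^ k * poly g x) = 0"
        unfolding eq using e_poly[OF p(1)] e_poly[OF div(2)] t by (simp add: e_add e_mult)
      then show ?thesis using nz(2) e_B[OF a(1), of t] by (simp add: e_mult e_power)
    qed
    have "poly ([:b':] - h * q) x = b' - poly h x * c" by (simp add: c(1))
    moreover have "[:b':] - h * q \<in> coeffs_in B"
      using subring b'(1) h(1) c(2) by (intro coeffs_in_closed)
    ultimately have "e t (b' - poly h x * c) = 0" using zero h(2) by metis
    then have "e t c \<noteq> 0" using nz(1) e_B[OF b'(1), of t] by (auto simp: e_diff e_mult)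
    then show ?thesis using zero by blast
  qed
  then show ?thesis using b by blast
qed

inductive_set polys_in :: "'v set \<Rightarrow> ('v::finite, 'a::comm_ring_1) mpoly set" for V where
  const: "mconst a \<in> polys_in V"
| var: "j \<in> V \<Longrightarrow> mvar j \<in> polys_in V"
| add: "F \<in> polys_in V \<Longrightarrow> G \<in> polys_in V \<Longrightarrow> F + G \<in> polys_in V"
| mult: "F \<in> polys_in V \<Longrightarrow> G \<in> polys_in V \<Longrightarrow> F * G \<in> polys_in V"

lemma polys_in_UNIV: "Q \<in> polys_in UNIV"
  by (induction Q rule: mpoly_induct) (auto intro: polys_in.intros)

lemma subring_polys_in: "subring (polys_in V :: ('v::finite, 'a::comm_ring_1) mpoly set)"
proof -
  have "- F \<in> polys_in V" if "F \<in> polys_in V" for F :: "('v, 'a) mpoly"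
    using polys_in.mult[OF polys_in.const[of "-1"] that]
    by (simp add: mconst_def single_uminus)
  then show ?thesis
    using polys_in.const[of 0 V] polys_in.const[of 1 V]
    by (auto simp: subring_def mconst_def intro: polys_in.intros)
qed

lemma polys_in_eval_cong:
  assumes "F \<in> polys_in V" "\<And>j. j \<in> V \<Longrightarrow> a $ j = b $ j"
  shows "mpoly_eval F a = mpoly_eval F b"
  using assms by induction auto

lemma polys_in_insert:
  assumes "F \<in> polys_in (insert u V)"
  shows "\<exists>p\<in>coeffs_in (polys_in V). F = poly p (mvar u)"
  using assms
proof induction
  case (const a)
  then show ?case using coeffs_in_closed(3)[OF subring_polys_in polys_in.const]
    by (intro bexI[of _ "[:mconst a:]"]) auto
next
  case (var j)
  show ?case
  proof (cases "j = u")
    case True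
    then show ?thesis using coeffs_in_closed(2)[OF subring_polys_in, of 1 V 1]
      subringD(2)[OF subring_polys_in] by (intro bexI[of _ "monom 1 1"]) (auto simp: poly_monom)
  next
    case False
    then show ?thesis using coeffs_in_closed(3)[OF subring_polys_in polys_in.var[of j]] var
      by (intro bexI[of _ "[:mvar j:]"]) auto
  qed
next
  case (add F G)
  then show ?case using coeffs_in_closed(4)[OF subring_polys_in] by (metis poly_add)
next
  case (mult F G)
  then show ?case using coeffs_in_closed(6)[OF subring_polys_in] by (metis poly_mult)
qed

text \<open>The coordinates of the point are found one at a time: a condition \<open>c \<noteq> 0\<close> on the new point
  becomes a condition \<open>b \<noteq> 0\<close> on the point with one coordinate less.\<close>

lemma zero_of_prime_ideal_in:
  fixes I :: "('v::finite, 'a::alg_closed_field) mpoly set"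
  assumes I: "prime_ideal I" and "finite V" and "c \<in> polys_in V" "c \<notin> I"
  shows "\<exists>a. (\<forall>F\<in>polys_in V \<inter> I. mpoly_eval F a = 0) \<and> mpoly_eval c a \<noteq> 0"
  using \<open>finite V\<close> assms(3,4)
proof (induction V arbitrary: c rule: finite_induct)
  case empty
  have idl: "ideal.subspace I" "1 \<notin> I" using I by (auto simp: prime_ideal_def)
  have const: "\<exists>k. F = mconst k" if "F \<in> polys_in {}" for F :: "('v, 'a) mpoly"
    using that by induction (auto simp: mconst_def mult_single simp flip: single_add)
  have "k = 0" if "mconst k \<in> I" for k
  proof (rule ccontr)
    assume "k \<noteq> 0"
    then have "mconst (inverse k) * mconst k = (1 :: ('v, 'a) mpoly)"
      by (simp add: mconst_def mult_single)
    then show False using ideal.subspace_scale[OF idl(1) that] idl(2) by metis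
  qed
  moreover obtain k where "c = mconst k" using const empty by blast
  moreover have "k \<noteq> 0"
    using empty(2) ideal.subspace_0[OF idl(1)] \<open>c = mconst k\<close> by (auto simp: mconst_def)
  ultimately show ?case using const by (metis IntE eval.insert_mconst mpoly_eval_def)
next
  case (insert u V)
  define e where "e a t F = mpoly_eval F (\<chi> j. if j = u then t else a $ j)"
    for a :: "'a ^ 'v" and t and F :: "('v, 'a) mpoly"
  have ext: "simple_extension (polys_in V) (mvar u) (e a)" for a
  proof
    fix t and F :: "('v, 'a) mpoly" assume "F \<in> polys_in V"
    then show "e a t F = e a 0 F"
      unfolding e_def using insert.hyps by (intro polys_in_eval_cong) auto
  qed (auto simp: e_def subring_polys_in)
  obtain q where q: "q \<in> coeffs_in (polys_in V)" "c = poly q (mvar u)"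
    using polys_in_insert[OF insert.prems(1)] by blast
  have e0: "e a 0 F = mpoly_eval F a" if "F \<in> polys_in V" for a F
    unfolding e_def using that insert.hyps by (intro polys_in_eval_cong) auto
  obtain b where b: "b \<in> polys_in V" "b \<notin> I" and lift: "\<And>a. \<forall>F\<in>polys_in V \<inter> I. e a 0 F = 0 \<Longrightarrow>
    e a 0 b \<noteq> 0 \<Longrightarrow> \<exists>t. (\<forall>p\<in>coeffs_in (polys_in V). poly p (mvar u) \<in> I \<longrightarrow>
      e a t (poly p (mvar u)) = 0) \<and> e a t c \<noteq> 0"
    using extend_zero[OF subring_polys_in I q(2,1) insert.prems(2), where ?'a = 'a] ext by metis
  obtain a where "\<forall>F\<in>polys_in V \<inter> I. mpoly_eval F a = 0" "mpoly_eval b a \<noteq> 0"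
    using insert.IH[OF b] by blast
  then obtain t where t: "\<And>p. p \<in> coeffs_in (polys_in V) \<Longrightarrow> poly p (mvar u) \<in> I \<Longrightarrow>
      e a t (poly p (mvar u)) = 0" "e a t c \<noteq> 0"
    using lift[of a] e0 b(1) by (metis IntD1)
  have "e a t F = 0" if "F \<in> polys_in (insert u V)" "F \<in> I" for F
    using polys_in_insert[OF that(1)] that(2) t(1) by blast
  then show ?case using t(2) unfolding e_def by blast
qed

text \<open>If no power of \<open>U\<close> is in \<open>I\<close>, some prime ideal above \<open>I\<close> avoids \<open>U\<close>, and its variety has a
  point at which \<open>U\<close> does not vanish.\<close>

theorem nullstellensatz:
  fixes I :: "('v::finite, 'a::alg_closed_field) mpoly set"
  assumes I: "ideal.subspace I"
    and U: "\<And>a. (\<And>F. F \<in> I \<Longrightarrow> mpoly_eval F a = 0) \<Longrightarrow> mpoly_eval U a = 0"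
  obtains n where "U ^ n \<in> I"
proof (rule ccontr)
  assume "\<not> thesis"
  then have "U ^ n \<notin> I" for n using that by blast
  then obtain p where p: "prime_ideal p" "I \<subseteq> p" "U \<notin> p"
    using exists_prime_ideal_avoiding[OF I] by metis
  then obtain a where "\<forall>F\<in>p. mpoly_eval F a = 0" "mpoly_eval U a \<noteq> 0"
    using zero_of_prime_ideal_in[OF p(1) finite polys_in_UNIV p(3)] polys_in_UNIV by blast
  then show False using U p(2) by blast
qed

section \<open>Forms, tangent spaces and local equations\<close>

lemma homogeneousD: "homogeneous d F \<Longrightarrow> m \<in> Poly_Mapping.keys F \<Longrightarrow>
    (\<Sum>j\<in>UNIV. Poly_Mapping.lookup m j) = d"
  by (simp add: homogeneous_def)

lemma homogeneous_0 [simp]: "homogeneous d 0"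
  by (simp add: homogeneous_def)

lemma homogeneous_single: "(\<Sum>j\<in>UNIV. Poly_Mapping.lookup m j) = d \<Longrightarrow>
    homogeneous d (Poly_Mapping.single m a)"
  by (auto simp: homogeneous_def)

lemma homogeneous_mconst [simp]: "homogeneous 0 (mconst a)"
  unfolding mconst_def by (rule homogeneous_single) simp

lemma homogeneous_1 [simp]: "homogeneous 0 (1 :: ('v::finite, 'a::comm_ring_1) mpoly)"
  using homogeneous_mconst[of "1 :: 'a", where ?'a = 'v] by (simp add: mconst_def)

lemma homogeneous_mvar [simp]: "homogeneous 1 (mvar j)"
  unfolding mvar_def by (rule homogeneous_single) (simp add: Poly_Mapping.lookup_single when_def)

lemma homogeneous_add:
  fixes F G :: "('v::finite, 'a::comm_ring_1) mpoly"
  shows "homogeneous d F \<Longrightarrow> homogeneous d G \<Longrightarrow> homogeneous d (F + G)"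
  using Poly_Mapping.keys_add[of F G] unfolding homogeneous_def by blast

lemma homogeneous_mult:
  fixes F G :: "('v::finite, 'a::comm_ring_1) mpoly"
  assumes "homogeneous d F" "homogeneous e G"
  shows "homogeneous (d + e) (F * G)"
  unfolding homogeneous_def
proof
  fix m assume "m \<in> Poly_Mapping.keys (F * G)"
  then obtain k l where "m = k + l" "k \<in> Poly_Mapping.keys F" "l \<in> Poly_Mapping.keys G"
    using Poly_Mapping.keys_mult[of F G] by blast
  then show "(\<Sum>j\<in>UNIV. Poly_Mapping.lookup m j) = d + e"
    using assms by (simp add: Poly_Mapping.lookup_add sum.distrib homogeneousD)
qed

lemma homogeneous_mconst_mult: "homogeneous d F \<Longrightarrow> homogeneous d (mconst a * F)"
  using homogeneous_mult[OF homogeneous_mconst] by fastforce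

lemma homogeneous_uminus:
  fixes F :: "('v::finite, 'a::comm_ring_1) mpoly"
  shows "homogeneous d F \<Longrightarrow> homogeneous d (- F)"
  by (simp add: homogeneous_def)

lemma homogeneous_diff:
  fixes F G :: "('v::finite, 'a::comm_ring_1) mpoly"
  shows "homogeneous d F \<Longrightarrow> homogeneous d G \<Longrightarrow> homogeneous d (F - G)"
  using homogeneous_add[of d F "- G"] homogeneous_uminus by fastforce

lemma homogeneous_sum:
  fixes g :: "'i \<Rightarrow> ('v::finite, 'a::comm_ring_1) mpoly"
  shows "(\<And>i. i \<in> A \<Longrightarrow> homogeneous d (g i)) \<Longrightarrow> homogeneous d (\<Sum>i\<in>A. g i)"
  by (induction A rule: infinite_finite_induct) (auto intro: homogeneous_add)

lemma homogeneous_prod: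
  fixes g :: "'i \<Rightarrow> ('v::finite, 'a::comm_ring_1) mpoly"
  shows "(\<And>i. i \<in> A \<Longrightarrow> homogeneous (d i) (g i)) \<Longrightarrow>
    homogeneous (\<Sum>i\<in>A. d i) (\<Prod>i\<in>A. g i)"
  by (induction A rule: infinite_finite_induct) (auto intro: homogeneous_mult)

lemma homogeneous_power:
  fixes F :: "('v::finite, 'a::comm_ring_1) mpoly"
  shows "homogeneous d F \<Longrightarrow> homogeneous (n * d) (F ^ n)"
  by (induction n) (auto intro: homogeneous_mult)

text \<open>The degree of a nonzero form. For the zero form, which is homogeneous of every degree, the
  value is arbitrary.\<close>

definition form_degree :: "('v::finite, 'a::zero) mpoly \<Rightarrow> nat" where
  "form_degree F = (SOME d. homogeneous d F)"

lemma homogeneous_form_degree: "homogeneous d F \<Longrightarrow> homogeneous (form_degree F) F"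
  unfolding form_degree_def by (rule someI)

lemma form_degree_eq: "homogeneous d F \<Longrightarrow> F \<noteq> 0 \<Longrightarrow> form_degree F = d"
  using homogeneous_form_degree[of d F] by (metis ex_in_conv homogeneousD keys_eq_empty)

text \<open>Directional derivatives are computed along the line through \<open>P\<close>, that is by
  a ring homomorphism to polynomials in one variable; this gives the product rule for free.\<close>

definition on_line :: "('v::finite, 'a::comm_ring_1) mpoly \<Rightarrow> 'a ^ 'v \<Rightarrow> 'a ^ 'v \<Rightarrow> 'a poly" where
  "on_line F P w = mpoly_insert (\<lambda>a. [:a:]) F (\<chi> j. [:P $ j, w $ j:])"

interpretation line: coeff_hom "\<lambda>a::'a::comm_ring_1. [:a:]"
  by standard auto

lemma on_line_simps [simp]:
  "on_line (F + G) P w = on_line F P w + on_line G P w"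
  "on_line (F - G) P w = on_line F P w - on_line G P w"
  "on_line (F * G) P w = on_line F P w * on_line G P w"
  "on_line (mconst a) P w = [:a:]"
  "on_line (mvar j) P w = [:P $ j, w $ j:]"
  "on_line 0 P w = 0"
  by (simp_all add: on_line_def line.insert_simps)

lemma poly_on_line_0: "poly (on_line F P w) 0 = mpoly_eval F P"
  by (simp add: on_line_def mpoly_eval_def mpoly_insert_def poly_sum poly_prod poly_power)

definition dir_deriv :: "('v::finite, 'a::idom) mpoly \<Rightarrow> 'a ^ 'v \<Rightarrow> 'a ^ 'v \<Rightarrow> 'a" where
  "dir_deriv F P w = poly (pderiv (on_line F P w)) 0"

lemma dir_deriv_simps [simp]:
  "dir_deriv (F + G) P w = dir_deriv F P w + dir_deriv G P w"
  "dir_deriv (F - G) P w = dir_deriv F P w - dir_deriv G P w"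
  "dir_deriv (F * G) P w = mpoly_eval F P * dir_deriv G P w + dir_deriv F P w * mpoly_eval G P"
  "dir_deriv (mconst a) P w = 0"
  "dir_deriv (mvar j) P w = w $ j"
  "dir_deriv 0 P w = 0"
  by (auto simp: dir_deriv_def pderiv_add pderiv_diff pderiv_mult poly_on_line_0 pderiv_pCons)

lemma dir_deriv_sum [simp]: "dir_deriv (\<Sum>i\<in>A. g i) P w = (\<Sum>i\<in>A. dir_deriv (g i) P w)"
  by (induction A rule: infinite_finite_induct) auto

lemma eval_monomial:
  fixes a :: "'a::comm_ring_1"
  shows "mpoly_eval (Poly_Mapping.single m a) P = a * (\<Prod>j\<in>UNIV. (P $ j) ^ Poly_Mapping.lookup m j)"
  unfolding mpoly_eval_def by (rule eval.insert_single)

lemma dir_deriv_monomial: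
  "dir_deriv (Poly_Mapping.single m a) P w =
    (\<Sum>j\<in>UNIV. mpoly_eval (Poly_Mapping.single (m - Poly_Mapping.single j 1)
      (of_nat (Poly_Mapping.lookup m j) * a)) P * w $ j)"
proof -
  let ?m = "Poly_Mapping.lookup m"
  have "pderiv (\<Prod>j\<in>UNIV. [:P $ j, w $ j:] ^ ?m j)
      = (\<Sum>j\<in>UNIV. (\<Prod>i\<in>UNIV - {j}. [:P $ i, w $ i:] ^ ?m i) *
          (smult (of_nat (?m j)) ([:P $ j, w $ j:] ^ (?m j - 1) * [:w $ j:])))"
    by (subst pderiv_prod) (simp add: pderiv_power pderiv_pCons)
  then have "dir_deriv (Poly_Mapping.single m a) P w = a * (\<Sum>j\<in>UNIV.
      (\<Prod>i\<in>UNIV - {j}. (P $ i) ^ ?m i) * (of_nat (?m j) * ((P $ j) ^ (?m j - 1) * w $ j)))"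
    by (simp add: dir_deriv_def on_line_def line.insert_single poly_sum poly_prod poly_power pderiv_smult mult_ac)
  also have "\<dots> = (\<Sum>j\<in>UNIV. mpoly_eval (Poly_Mapping.single (m - Poly_Mapping.single j 1)
      (of_nat (?m j) * a)) P * w $ j)"
    unfolding sum_distrib_left
  proof (intro sum.cong refl)
    fix j
    have "(\<Prod>i\<in>UNIV. (P $ i) ^ Poly_Mapping.lookup (m - Poly_Mapping.single j 1) i)
        = (P $ j) ^ (?m j - 1) * (\<Prod>i\<in>UNIV - {j}. (P $ i) ^ ?m i)"
      by (subst prod.remove[of UNIV j])
        (auto simp: Poly_Mapping.lookup_minus Poly_Mapping.lookup_single intro!: prod.cong)
    then show "a * ((\<Prod>i\<in>UNIV - {j}. (P $ i) ^ ?m i) * (of_nat (?m j) * ((P $ j) ^ (?m j - 1) * w $ j)))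
        = mpoly_eval (Poly_Mapping.single (m - Poly_Mapping.single j 1) (of_nat (?m j) * a)) P * w $ j"
      by (simp add: eval_monomial)
  qed
  finally show ?thesis .
qed

lemma dir_deriv_eq: "dir_deriv F P w = (\<Sum>j\<in>UNIV. mpoly_eval (mpoly_deriv j F) P * w $ j)"
proof -
  have "dir_deriv F P w =
      (\<Sum>m\<in>Poly_Mapping.keys F. dir_deriv (Poly_Mapping.single m (Poly_Mapping.lookup F m)) P w)"
    by (subst mpoly_eq_sum_monomials[of F]) (rule dir_deriv_sum)
  also have "\<dots> = (\<Sum>j\<in>UNIV. mpoly_eval (mpoly_deriv j F) P * w $ j)"
    unfolding mpoly_deriv_def dir_deriv_monomial
    by (subst sum.swap) (simp add: sum_distrib_right)
  finally show ?thesis .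
qed

lemma tangent_eq: "tangent S P = {w. \<forall>F\<in>S. dir_deriv F P w = 0}"
  by (simp add: tangent_def dir_deriv_eq)

text \<open>Euler's relation: restricted to the line through \<open>P\<close> in direction \<open>P\<close>, a form is a multiple
  of a power of \<open>1 + t\<close>.\<close>

lemma dir_deriv_self:
  fixes F :: "('v::finite, 'a::idom) mpoly"
  assumes "homogeneous d F"
  shows "dir_deriv F P P = of_nat d * mpoly_eval F P"
proof -
  have "on_line F P P = smult (mpoly_eval F P) ([:1, 1:] ^ d)"
  proof -
    have "[:P $ j, P $ j:] = smult (P $ j) [:1, 1:]" for j by simp
    then have "on_line F P P = (\<Sum>m\<in>Poly_Mapping.keys F. smult (Poly_Mapping.lookup F m *
        (\<Prod>j\<in>UNIV. (P $ j) ^ Poly_Mapping.lookup m j)) ([:1, 1:] ^ (\<Sum>j\<in>UNIV. Poly_Mapping.lookup m j)))"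
      by (simp only: on_line_def mpoly_insert_def vec_lambda_beta smult_power prod_smult flip: power_sum)
        (simp add: mult.commute)
    also have "\<dots> = (\<Sum>m\<in>Poly_Mapping.keys F. smult (Poly_Mapping.lookup F m *
        (\<Prod>j\<in>UNIV. (P $ j) ^ Poly_Mapping.lookup m j)) ([:1, 1:] ^ d))"
      using assms by (intro sum.cong) (auto simp: homogeneousD)
    finally show ?thesis by (simp add: mpoly_eval_def mpoly_insert_def smult_sum)
  qed
  moreover have "poly (pderiv ([:1, 1:] ^ d)) 0 = (of_nat d :: 'a)"
    by (simp only: pderiv_power) (simp add: pderiv_pCons poly_power)
  ultimately show ?thesis by (simp add: dir_deriv_def pderiv_smult mult.commute)
qed

lemma point_in_tangent:
  assumes "P \<in> proj_zeros S" "\<And>F. F \<in> S \<Longrightarrow> \<exists>d. homogeneous d F"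
  shows "P \<in> tangent S P"
  using assms dir_deriv_self by (fastforce simp: tangent_eq proj_zeros_def)

text \<open>The linear forms vanishing at \<open>P\<close> are spanned by these, for a fixed \<open>p\<close> with \<open>P $ p \<noteq> 0\<close>. The one
  with \<open>j = p\<close> is zero and is kept so that the coefficients in an expansion form a square matrix.\<close>

definition line_form :: "'a::comm_ring_1 ^ 'v \<Rightarrow> 'v \<Rightarrow> 'v \<Rightarrow> ('v::finite, 'a) mpoly" where
  "line_form P p j = mconst (P $ p) * mvar j - mconst (P $ j) * mvar p"

text \<open>Modulo the linear forms vanishing at \<open>P\<close> each variable \<open>mvar j\<close> is \<open>P $ j / P $ p\<close> times
  \<open>mvar p\<close>, so a form is its value at \<open>P\<close> times a power of \<open>mvar p\<close>. The induction replaces one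
  variable of the monomial at a time.\<close>

lemma monomial_expansion:
  fixes P :: "'a::comm_ring_1 ^ 'v::finite"
  assumes "(\<Sum>j\<in>UNIV. Poly_Mapping.lookup m j) = d"
  shows "\<exists>b. (\<forall>j. homogeneous (d - 1) (b j) \<and> (d = 0 \<longrightarrow> b j = 0)) \<and>
    mconst ((P $ p) ^ d) * Poly_Mapping.single m a -
      mconst (mpoly_eval (Poly_Mapping.single m a) P) * mvar p ^ d
    = (\<Sum>j\<in>UNIV. b j * line_form P p j)"
  using assms
proof (induction d arbitrary: m)
  case 0
  then have "m = 0" by (intro poly_mapping_eqI) auto
  then have "Poly_Mapping.single m a = mconst a" by (simp add: mconst_def)
  moreover from this have "mpoly_eval (Poly_Mapping.single m a) P = a" by simp
  ultimately show ?case by (intro exI[of _ "\<lambda>_. 0"]) (simp add: mconst_def)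
next
  case (Suc d)
  then obtain k where k: "Poly_Mapping.lookup m k \<noteq> 0" by (metis nat.distinct(1) sum.neutral)
  define n where "n = m - Poly_Mapping.single k 1"
  have m: "m = n + Poly_Mapping.single k 1"
    unfolding n_def using k
    by (intro poly_mapping_eqI)
      (auto simp: Poly_Mapping.lookup_add Poly_Mapping.lookup_minus Poly_Mapping.lookup_single when_def)
  have "(\<Sum>j\<in>UNIV. Poly_Mapping.lookup n j) = d"
    using Suc.prems unfolding m
    by (simp add: Poly_Mapping.lookup_add sum.distrib Poly_Mapping.lookup_single when_def)
  then obtain b where b: "\<And>j. homogeneous (d - 1) (b j)" "\<And>j. d = 0 \<Longrightarrow> b j = 0"
    and eq: "mconst ((P $ p) ^ d) * Poly_Mapping.single n a -
      mconst (mpoly_eval (Poly_Mapping.single n a) P) * mvar p ^ d = (\<Sum>j\<in>UNIV. b j * line_form P p j)"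
    using Suc.IH by blast
  let ?M = "Poly_Mapping.single n a" and ?y = "mpoly_eval (Poly_Mapping.single n a) P"
  have split: "Poly_Mapping.single m a = mvar k * ?M"
    by (simp add: m mvar_def mult_single add.commute)
  have mc: "mconst (x * y) = mconst x * (mconst y :: ('v, 'a) mpoly)" for x y
    by (simp add: mconst_def mult_single)
  define b' where "b' j = mvar k * (mconst (P $ p) * b j) +
    (if j = k then mconst ?y * mvar p ^ d else 0)" for j
  have "homogeneous d (b' j)" for j
  proof -
    have "homogeneous d (mvar k * (mconst (P $ p) * b j))"
    proof (cases d)
      case (Suc d')
      then show ?thesis
        using homogeneous_mult[OF homogeneous_mvar homogeneous_mconst_mult[OF b(1)], of k "P $ p" j]
        by simp
    qed (simp add: b)
    moreover have "homogeneous d (mconst ?y * mvar p ^ d)"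
    proof -
      have "homogeneous (d * 1) (mvar p ^ d :: ('v, 'a) mpoly)"
        by (rule homogeneous_power[OF homogeneous_mvar])
      then show ?thesis by (simp add: homogeneous_mconst_mult)
    qed
    ultimately show ?thesis unfolding b'_def by (auto intro: homogeneous_add)
  qed
  moreover have "(\<Sum>j\<in>UNIV. b' j * line_form P p j) =
      mvar k * (mconst (P $ p) * (\<Sum>j\<in>UNIV. b j * line_form P p j))
      + mconst ?y * mvar p ^ d * line_form P p k"
    unfolding b'_def
    by (simp add: distrib_right sum.distrib sum_distrib_left mult.assoc if_distrib[of "\<lambda>x. x * _"]
        cong: if_cong)
  moreover have "\<dots> = mconst ((P $ p) ^ Suc d) * Poly_Mapping.single m a
      - mconst (mpoly_eval (Poly_Mapping.single m a) P) * mvar p ^ Suc d"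
    unfolding eq[symmetric] split by (simp add: line_form_def mc algebra_simps)
  ultimately show ?case by (intro exI[of _ b']) auto
qed

text \<open>For a form vanishing at \<open>P\<close> the power of \<open>mvar p\<close> disappears from the expansions of its
  monomials.\<close>

lemma form_expansion:
  fixes P :: "'a::comm_ring_1 ^ 'v::finite"
  assumes F: "homogeneous d F" "mpoly_eval F P = 0"
  obtains b where "\<And>j. homogeneous (d - 1) (b j)"
    "mconst ((P $ p) ^ d) * F = (\<Sum>j\<in>UNIV. b j * line_form P p j)"
proof -
  let ?c = "Poly_Mapping.lookup F" and ?K = "Poly_Mapping.keys F"
  define expands where "expands m b \<longleftrightarrow> (\<forall>j. homogeneous (d - 1) (b j)) \<and>
    mconst ((P $ p) ^ d) * Poly_Mapping.single m (?c m) -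
      mconst (mpoly_eval (Poly_Mapping.single m (?c m)) P) * mvar p ^ d
    = (\<Sum>j\<in>UNIV. b j * line_form P p j)" for m b
  have "\<forall>m\<in>?K. \<exists>b. expands m b"
    using monomial_expansion[OF homogeneousD[OF F(1)], of _ P p] unfolding expands_def by blast
  then obtain b where "\<And>m. m \<in> ?K \<Longrightarrow> expands m (b m)"
    using bchoice[of ?K expands] by blast
  then have b: "\<And>m j. m \<in> ?K \<Longrightarrow> homogeneous (d - 1) (b m j)"
    and eq: "\<And>m. m \<in> ?K \<Longrightarrow> mconst ((P $ p) ^ d) * Poly_Mapping.single m (?c m) -
      mconst (mpoly_eval (Poly_Mapping.single m (?c m)) P) * mvar p ^ d
      = (\<Sum>j\<in>UNIV. b m j * line_form P p j)"
    by (simp_all add: expands_def)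
  have mc: "mconst (\<Sum>i\<in>A. g i) = (\<Sum>i\<in>A. mconst (g i) :: ('v, 'a) mpoly)" for A :: "('v \<Rightarrow>\<^sub>0 nat) set" and g
    by (induction A rule: infinite_finite_induct) (auto simp: mconst_def single_add)
  have "mconst ((P $ p) ^ d) * F = mconst ((P $ p) ^ d) * F - mconst (mpoly_eval F P) * mvar p ^ d"
    using F(2) by (simp add: mconst_def)
  also have "\<dots> = (\<Sum>m\<in>?K. mconst ((P $ p) ^ d) * Poly_Mapping.single m (?c m) -
      mconst (mpoly_eval (Poly_Mapping.single m (?c m)) P) * mvar p ^ d)"
  proof -
    have sum: "(\<Sum>m\<in>?K. Poly_Mapping.single m (?c m)) = F"
      by (rule mpoly_eq_sum_monomials[symmetric])
    have "(\<Sum>m\<in>?K. mpoly_eval (Poly_Mapping.single m (?c m)) P) = mpoly_eval F P"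
      using arg_cong[OF sum, of "\<lambda>F. mpoly_eval F P"] by simp
    then show ?thesis
      unfolding sum_subtractf sum_distrib_left[symmetric] sum_distrib_right[symmetric]
        mc[symmetric] sum by simp
  qed
  also have "\<dots> = (\<Sum>m\<in>?K. \<Sum>j\<in>UNIV. b m j * line_form P p j)"
    using eq by (rule sum.cong[OF refl])
  also have "\<dots> = (\<Sum>j\<in>UNIV. (\<Sum>m\<in>?K. b m j) * line_form P p j)"
    by (subst sum.swap) (simp add: sum_distrib_right)
  finally show ?thesis using b that[of "\<lambda>j. \<Sum>m\<in>?K. b m j"] by (auto intro: homogeneous_sum)
qed


lemma mpoly_eval_det:
  fixes B :: "('v::finite, 'a::comm_ring_1) mpoly ^ 'b ^ 'b::finite"
  shows "mpoly_eval (det B) P = det (\<chi> i j. mpoly_eval (B $ i $ j) P)"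
proof -
  have "mpoly_eval (of_int (sign p)) P = of_int (sign p)" for p :: "'b \<Rightarrow> 'b"
    by (simp add: sign_def)
  then show ?thesis by (simp add: det_def)
qed

lemma homogeneous_det:
  fixes B :: "('v::finite, 'a::comm_ring_1) mpoly ^ 'b ^ 'b::finite"
  assumes "\<And>i j. homogeneous (e i) (B $ i $ j)"
  shows "homogeneous (\<Sum>i\<in>UNIV. e i) (det B)"
  unfolding det_def
proof (rule homogeneous_sum)
  fix p :: "'b \<Rightarrow> 'b"
  have "homogeneous (\<Sum>i\<in>UNIV. e i) (\<Prod>i\<in>UNIV. B $ i $ p i)"
    using assms by (rule homogeneous_prod)
  then show "homogeneous (\<Sum>i\<in>UNIV. e i) (of_int (sign p) * (\<Prod>i\<in>UNIV. B $ i $ p i))"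
    by (simp add: sign_def homogeneous_uminus)
qed

text \<open>Cramer's rule over a commutative ring: the matrix \<open>M\<close> below, the identity with its column \<open>k\<close>
  replaced by \<open>x\<close>, has determinant \<open>x $ k\<close>, and column \<open>k\<close> of \<open>B ** M\<close> is \<open>B *v x\<close>.\<close>

lemma det_mult_in_ideal:
  fixes B :: "'r::comm_ring_1 ^ 'n ^ 'n"
  assumes I: "ideal.subspace I" and B: "\<And>i. (\<Sum>j\<in>UNIV. B $ i $ j * x $ j) \<in> I"
  shows "det B * x $ k \<in> I"
proof -
  define M :: "'r ^ 'n ^ 'n" where "M = (\<chi> i j. if j = k then x $ i else if i = j then 1 else 0)"
  have perm_id: "p = id" if p: "p permutes UNIV" and nz: "(\<Prod>i\<in>UNIV. M $ i $ p i) \<noteq> 0"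
    for p :: "'n \<Rightarrow> 'n"
  proof -
    have ne: "M $ i $ p i \<noteq> 0" for i
      using nz by (metis finite_UNIV iso_tuple_UNIV_I finite prod_zero)
    then have fixed: "p i = i" if "p i \<noteq> k" for i
      using that by (force simp: M_def split: if_splits)
    have "p k = k"
    proof -
      obtain i where "p i = k" using p by (metis permutes_def)
      then show ?thesis using fixed[of k] by metis
    qed
    then show "p = id" using fixed p permutes_inj[OF p] by (metis eq_id_iff injD)
  qed
  have "det M = (\<Sum>p\<in>{id}. of_int (sign p) * (\<Prod>i\<in>UNIV. M $ i $ p i))"
    unfolding det_def
  proof (rule sum.mono_neutral_right)
    show "\<forall>p\<in>{p. p permutes UNIV} - {id}. of_int (sign p) * (\<Prod>i\<in>UNIV. M $ i $ p i) = 0"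
      using perm_id by fastforce
  qed (auto simp: permutes_id finite_permutations)
  also have "\<dots> = (\<Prod>i\<in>UNIV. if i = k then x $ i else 1)"
    by (simp add: M_def cong: if_cong)
  also have "\<dots> = x $ k" by simp
  finally have "det B * x $ k = det (B ** M)" by (simp add: det_mul)
  also have "\<dots> \<in> I"
    unfolding det_def
  proof (intro ideal.subspace_sum[OF I] ideal.subspace_scale[OF I])
    fix p :: "'n \<Rightarrow> 'n" assume "p \<in> {p. p permutes UNIV}"
    then obtain i where i: "p i = k" by (metis mem_Collect_eq permutes_def)
    have "(B ** M) $ i $ k \<in> I"
      using B[of i] by (simp add: matrix_matrix_mult_def M_def)
    then show "(\<Prod>i\<in>UNIV. (B ** M) $ i $ p i) \<in> I"
      using i by (subst prod.remove[of UNIV i]) (auto intro: ideal_mult_right[OF I])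
  qed
  finally show ?thesis .
qed

text \<open>If only the zero vector is orthogonal to \<open>T\<close>, then \<open>T\<close> contains the rows of an invertible
  matrix.\<close>

lemma invertible_rows_from:
  fixes T :: "('a::field ^ 'v::finite) set"
  assumes T: "\<And>w. (\<And>t. t \<in> T \<Longrightarrow> (\<Sum>j\<in>UNIV. t $ j * w $ j) = 0) \<Longrightarrow> w = 0"
  obtains A :: "'a ^ 'v ^ 'v" where "\<And>i. A $ i \<in> T" "det A \<noteq> 0"
proof -
  obtain C where C: "C \<subseteq> T" "vec.independent C" "T \<subseteq> vec.span C"
    using vec.maximal_independent_subset by blast
  have orth: "w = 0" if w: "\<And>t. t \<in> C \<Longrightarrow> (\<Sum>j\<in>UNIV. t $ j * w $ j) = 0" for w
  proof (rule T)
    let ?K = "{t. (\<Sum>j\<in>UNIV. t $ j * w $ j) = 0}"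
    have "vec.subspace ?K"
      by (rule vec.subspaceI)
        (auto simp: distrib_right sum.distrib mult.assoc simp flip: sum_distrib_left)
    then have "vec.span C \<subseteq> ?K" using w by (intro vec.span_minimal) auto
    then show "(\<Sum>j\<in>UNIV. t $ j * w $ j) = 0" if "t \<in> T" for t using C(3) that by blast
  qed
  have "finite C" using C(2) by (rule vec.finiteI_independent)
  have "card C \<le> CARD('v)"
    using vec.independent_card_le_dim[OF subset_UNIV C(2)] by (simp add: card_cart_basis)
  then obtain g where g: "inj_on g C" "g ` C \<subseteq> (UNIV :: 'v set)"
    using card_le_inj[OF \<open>finite C\<close> finite] by blast
  have "C \<noteq> {}"
  proof
    assume "C = {}"
    then have "(1 :: 'a ^ 'v) = 0" by (intro orth) auto
    then show False by (simp add: vec_eq_iff)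
  qed
  then obtain c where c: "c \<in> C" by blast
  define A :: "'a ^ 'v ^ 'v" where "A = (\<chi> i. if i \<in> g ` C then inv_into C g i else c)"
  have rows: "A $ i \<in> C" for i using c by (auto simp: A_def inv_into_into)
  have hit: "A $ g t = t" if "t \<in> C" for t using that g by (simp add: A_def)
  have "w = 0" if "A *v w = 0" for w
  proof (rule orth)
    fix t assume "t \<in> C"
    then have "(A *v w) $ g t = (\<Sum>j\<in>UNIV. t $ j * w $ j)"
      by (simp add: matrix_vector_mult_def hit)
    then show "(\<Sum>j\<in>UNIV. t $ j * w $ j) = 0" using that by simp
  qed
  then have "invertible A"
    unfolding invertible_left_inverse matrix_left_invertible_ker by blast
  then show ?thesis using that rows C(1) invertible_det_nz by blast
qed

text \<open>Local structure at a reduced isolated point of the scheme defined by \<open>S\<close>: some \<open>G\<close> not vanishing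
  at \<open>P\<close> multiplies all linear forms vanishing at \<open>P\<close> into the ideal of \<open>S\<close>. Expand forms from \<open>S\<close> in
  these linear forms. The values at \<open>P\<close> of the coefficients are essentially the gradients, so the
  hypothesis on the tangent space yields a square matrix of such coefficients that is invertible at
  \<open>P\<close>. By Cramer's rule its determinant has the property of \<open>G\<close>.\<close>

lemma local_equations:
  fixes P :: "'a::field ^ 'v::finite"
  assumes P: "P \<in> proj_zeros S" and S: "\<And>F. F \<in> S \<Longrightarrow> \<exists>d. homogeneous d F"
    and tan: "\<And>w. w \<in> tangent S P \<Longrightarrow> \<exists>c. w = c *s P" and p: "P $ p \<noteq> 0"
  obtains G e where "homogeneous e G" "mpoly_eval G P \<noteq> 0"
    "\<And>k. G * line_form P p k \<in> ideal.span S"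
proof -
  let ?H = "line_form P p"
  \<comment> \<open>\<open>T\<close> collects the values at \<open>P\<close> of the rows \<open>b\<close> that can serve in the matrix. The axis vector
    belongs to it because the linear form with index \<open>p\<close> is zero; it removes the ambiguity of the
    coefficient of that form.\<close>
  define good where "good t b \<longleftrightarrow> (\<exists>e. \<forall>j. homogeneous e (b j)) \<and>
    (\<forall>j. mpoly_eval (b j) P = t $ j) \<and> (\<Sum>j\<in>UNIV. b j * ?H j) \<in> ideal.span S"
    for t :: "'a ^ 'v" and b
  define T where "T = {t. \<exists>b. good t b}"
  have axis: "axis p 1 \<in> T"
  proof -
    have "(\<Sum>j\<in>UNIV. (if j = p then 1 else 0) * ?H j) = ?H p"
      by (simp add: if_distrib[of "\<lambda>x. x * _"] cong: if_cong)
    also have "\<dots> = 0" by (simp add: line_form_def)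
    finally have "good (axis p 1) (\<lambda>j. if j = p then 1 else 0)"
      using ideal.span_zero by (auto simp: good_def axis_def intro!: exI[of _ 0])
    then show ?thesis by (auto simp: T_def)
  qed
  have "w = 0" if w: "\<And>t. t \<in> T \<Longrightarrow> (\<Sum>j\<in>UNIV. t $ j * w $ j) = 0" for w
  proof -
    have wp: "w $ p = 0"
      using w[OF axis] by (simp add: axis_def if_distrib[of "\<lambda>x. x * _"] cong: if_cong)
    have "dir_deriv F P w = 0" if F: "F \<in> S" for F
    proof -
      obtain d where d: "homogeneous d F" using S F by blast
      have FP: "mpoly_eval F P = 0" using P F by (simp add: proj_zeros_def)
      obtain b where b: "\<And>j. homogeneous (d - 1) (b j)"
        "mconst ((P $ p) ^ d) * F = (\<Sum>j\<in>UNIV. b j * ?H j)"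
        using form_expansion[OF d FP] by metis
      have "good (\<chi> j. mpoly_eval (b j) P) b"
        using b ideal.span_scale[OF ideal.span_base[OF F]] by (auto simp: good_def simp flip: b(2))
      then have bw: "(\<Sum>j\<in>UNIV. mpoly_eval (b j) P * w $ j) = 0"
        using w[of "\<chi> j. mpoly_eval (b j) P"] by (auto simp: T_def)
      \<comment> \<open>The derivative of the expansion at \<open>P\<close> only sees the derivatives of the linear forms.\<close>
      have "(P $ p) ^ d * dir_deriv F P w = dir_deriv (mconst ((P $ p) ^ d) * F) P w" by simp
      also have "\<dots> = P $ p * (\<Sum>j\<in>UNIV. mpoly_eval (b j) P * w $ j)"
        unfolding b(2) using wp by (simp add: line_form_def sum_distrib_left mult_ac)
      finally show ?thesis using bw p by simp
    qed
    then have "\<exists>c. w = c *s P" by (intro tan) (simp add: tangent_eq)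
    then obtain c where "w = c *s P" ..
    then show "w = 0" using wp p by simp
  qed
  then obtain A where A: "\<And>i. A $ i \<in> T" "det A \<noteq> 0"
    using invertible_rows_from[of T] by metis
  then have "\<forall>i. \<exists>b. good (A $ i) b" by (simp add: T_def)
  then obtain b where b: "\<And>i. good (A $ i) (b i)" by metis
  then have "\<forall>i. \<exists>e. \<forall>j. homogeneous e (b i j)" by (simp add: good_def)
  then obtain e where e: "\<And>i j. homogeneous (e i) (b i j)" by metis
  define B where "B = (\<chi> i j. b i j)"
  show ?thesis
  proof
    show "homogeneous (\<Sum>i\<in>UNIV. e i) (det B)"
      by (rule homogeneous_det) (simp add: B_def e)
    have "(\<chi> i j. mpoly_eval (B $ i $ j) P) = A"
      using b by (simp add: B_def good_def vec_eq_iff)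
    then show "mpoly_eval (det B) P \<noteq> 0" using A(2) by (simp add: mpoly_eval_det)
    fix k
    show "det B * ?H k \<in> ideal.span S"
      using det_mult_in_ideal[OF ideal.subspace_span, of B "\<chi> j. ?H j" S k] b
      by (simp add: B_def good_def)
  qed
qed

section \<open>Lower bounds for the size of forms along an entire tuple\<close>

interpretation graded: coeff_hom "\<lambda>a::'a::comm_ring_1. [:fps_const a:]"
  by standard (auto simp: one_pCons mult.commute)

locale entire_tuple = nonarch_field v for v :: "'a::alg_closed_field \<Rightarrow> real" +
  fixes f :: "'a fps ^ 'v::finite"
  assumes decay: "rapidly_decaying (f $ j)" and nonzero: "f \<noteq> 0"
begin

lemma norm_le_map_norm: "fps_norm v (f $ j) r \<le> map_norm v f r"
  unfolding map_norm_def by (intro Max_ge) auto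

lemma map_norm_attained: obtains j where "map_norm v f r = fps_norm v (f $ j) r"
proof -
  have "map_norm v f r \<in> range (\<lambda>j. fps_norm v (f $ j) r)"
    unfolding map_norm_def by (intro Max_in) auto
  then show ?thesis using that by blast
qed

lemma map_norm_pos: "0 < r \<Longrightarrow> 0 < map_norm v f r"
proof -
  assume r: "0 < r"
  obtain j where "f $ j \<noteq> 0" using nonzero by (auto simp: vec_eq_iff)
  then have "0 < fps_norm v (f $ j) r" using norm_pos decay r by blast
  then show ?thesis using norm_le_map_norm[of j r] by linarith
qed

lemma rapidly_decaying_comp: "rapidly_decaying (mpoly_comp F f)"
  unfolding mpoly_comp_def mpoly_insert_def
  by (intro rapidly_decaying_sum rapidly_decaying_mult rapidly_decaying_prod
      rapidly_decaying_power rapidly_decaying_const decay)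

text \<open>The size of \<open>F \<circ> f\<close> relative to a \<open>d\<close>-th power of the norm of \<open>f\<close>; its negative logarithm is
  the proximity function.\<close>

definition rel_size :: "nat \<Rightarrow> ('v, 'a) mpoly \<Rightarrow> real \<Rightarrow> real" where
  "rel_size d F r = fps_norm v (mpoly_comp F f) r / map_norm v f r ^ d"

lemma rel_size_nonneg: "0 < r \<Longrightarrow> 0 \<le> rel_size d F r"
  unfolding rel_size_def using rapidly_decaying_comp norm_nonneg map_norm_pos[of r]
  by (intro divide_nonneg_nonneg) auto

text \<open>Substituting \<open>f $ j\<close> times an auxiliary variable for the \<open>j\<close>-th variable separates the
  homogeneous components of a polynomial.\<close>

definition graded :: "('v, 'a) mpoly \<Rightarrow> 'a fps poly" where
  "graded F = mpoly_insert (\<lambda>a. [:fps_const a:]) F (\<chi> j. monom (f $ j) 1)"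

lemma graded_eq:
  "graded F = (\<Sum>m\<in>Poly_Mapping.keys F. monom (fps_const (Poly_Mapping.lookup F m) *
     (\<Prod>j\<in>UNIV. (f $ j) ^ Poly_Mapping.lookup m j)) (\<Sum>j\<in>UNIV. Poly_Mapping.lookup m j))"
proof -
  have "(\<Prod>j\<in>A. monom (f $ j) 1 ^ k j) = monom (\<Prod>j\<in>A. (f $ j) ^ k j) (\<Sum>j\<in>A. k j)"
    for A and k :: "'v \<Rightarrow> nat"
    by (induction A rule: infinite_finite_induct) (auto simp: monom_power mult_monom)
  then show ?thesis
    by (simp add: graded_def mpoly_insert_def smult_monom)
qed

lemma graded_homogeneous:
  assumes "homogeneous d F" shows "graded F = monom (mpoly_comp F f) d"
proof -
  have sum: "monom (\<Sum>i\<in>A. g i) d = (\<Sum>i\<in>A. monom (g i) d)" for A and g :: "_ \<Rightarrow> 'a fps"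
    by (induction A rule: infinite_finite_induct) (auto simp: add_monom[symmetric])
  show ?thesis
    unfolding graded_eq mpoly_comp_def mpoly_insert_def sum
    using assms by (intro sum.cong refl) (simp add: homogeneousD)
qed

lemma coeff_graded:
  "coeff (graded F) k = (\<Sum>m\<in>Poly_Mapping.keys F.
     if (\<Sum>j\<in>UNIV. Poly_Mapping.lookup m j) = k then fps_const (Poly_Mapping.lookup F m) *
       (\<Prod>j\<in>UNIV. (f $ j) ^ Poly_Mapping.lookup m j) else 0)"
  unfolding graded_eq by (simp add: coeff_sum)

lemma rapidly_decaying_coeff_graded: "rapidly_decaying (coeff (graded F) k)"
  unfolding coeff_graded
  by (intro rapidly_decaying_sum)
    (auto intro!: rapidly_decaying_mult rapidly_decaying_prod rapidly_decaying_power decay)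

lemma norm_coeff_graded_le:
  assumes r: "0 < r"
  shows "fps_norm v (coeff (graded F) k) r
    \<le> (\<Sum>m\<in>Poly_Mapping.keys F. v (Poly_Mapping.lookup F m)) * map_norm v f r ^ k"
    (is "_ \<le> ?C * _")
  unfolding coeff_graded
proof (rule norm_sum_le)
  have C: "0 \<le> ?C" by (intro sum_nonneg) simp
  show "0 \<le> ?C * map_norm v f r ^ k" using C map_norm_pos[OF r] by simp
  fix m assume m: "m \<in> Poly_Mapping.keys F"
  let ?t = "fps_const (Poly_Mapping.lookup F m) * (\<Prod>j\<in>UNIV. (f $ j) ^ Poly_Mapping.lookup m j)"
  show "rapidly_decaying (if (\<Sum>j\<in>UNIV. Poly_Mapping.lookup m j) = k then ?t else 0)"
    by (auto intro!: rapidly_decaying_mult rapidly_decaying_prod rapidly_decaying_power decay)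
  have "fps_norm v ?t r \<le> ?C * map_norm v f r ^ k" if k: "(\<Sum>j\<in>UNIV. Poly_Mapping.lookup m j) = k"
  proof -
    have "fps_norm v ?t r = v (Poly_Mapping.lookup F m) *
        (\<Prod>j\<in>UNIV. fps_norm v (f $ j) r ^ Poly_Mapping.lookup m j)"
      using r decay
      by (simp add: norm_mult norm_const norm_prod norm_power rapidly_decaying_prod rapidly_decaying_power)
    also have "\<dots> \<le> ?C * (\<Prod>j\<in>UNIV. map_norm v f r ^ Poly_Mapping.lookup m j)"
      using r decay C m norm_le_map_norm norm_nonneg
      by (intro mult_mono prod_mono prod_nonneg conjI member_le_sum power_mono zero_le_power) auto
    also have "(\<Prod>j\<in>UNIV. map_norm v f r ^ Poly_Mapping.lookup m j) = map_norm v f r ^ k"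
      using k by (simp flip: power_sum)
    finally show ?thesis .
  qed
  then show "fps_norm v (if (\<Sum>j\<in>UNIV. Poly_Mapping.lookup m j) = k then ?t else 0) r
      \<le> ?C * map_norm v f r ^ k"
    using C map_norm_pos[OF r] by simp
qed (use r in simp)

lemma norm_sum_attained:
  assumes "finite A" "A \<noteq> {}" "\<And>x. x \<in> A \<Longrightarrow> rapidly_decaying (g x)" "0 \<le> r"
  shows "\<exists>x\<in>A. fps_norm v (\<Sum>x\<in>A. g x) r \<le> fps_norm v (g x) r"
proof -
  let ?M = "Max ((\<lambda>x. fps_norm v (g x) r) ` A)"
  have "?M \<in> (\<lambda>x. fps_norm v (g x) r) ` A" using assms by (intro Max_in) auto
  then obtain x where x: "x \<in> A" "?M = fps_norm v (g x) r" by blast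
  have "fps_norm v (\<Sum>x\<in>A. g x) r \<le> ?M"
  proof (rule norm_sum_le)
    show "0 \<le> ?M" unfolding x(2) using assms x(1) by (intro norm_nonneg)
  qed (use assms in auto)
  then show ?thesis using x by auto
qed

text \<open>Writing \<open>U\<close> as a combination of elements \<open>F\<close> of \<open>S\<close> and comparing components of degree \<open>e\<close>, one
  may take the factor of \<open>F\<close> to be homogeneous of complementary degree. The relative size of that
  factor is bounded by its coefficients, so by the ultrametric inequality some \<open>F\<close> is relatively as
  large as \<open>U\<close>, up to a constant.\<close>

lemma rel_size_ideal:
  assumes U: "homogeneous e U" "U \<in> ideal.span S" and S: "\<And>F. F \<in> S \<Longrightarrow> \<exists>d. homogeneous d F"
  obtains T C where "finite T" "T \<subseteq> S" "0 < C"
    "\<And>r. 0 < r \<Longrightarrow> 0 < rel_size e U r \<Longrightarrow>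
      \<exists>F\<in>T. rel_size e U r \<le> C * rel_size (form_degree F) F r"
proof -
  obtain T A where T: "finite T" "T \<subseteq> S" and U_eq: "U = (\<Sum>F\<in>T. A F * F)"
    using U(2) by (auto simp: ideal.span_explicit)
  let ?c = "\<lambda>F. \<Sum>m\<in>Poly_Mapping.keys F. v (Poly_Mapping.lookup F m)"
  define C where "C = (\<Sum>F\<in>T. ?c (A F)) + 1"
  have nonneg: "0 \<le> ?c F" for F by (intro sum_nonneg) simp
  have cC: "?c (A F) \<le> C" if "F \<in> T" for F
    using member_le_sum[of F T "\<lambda>F. ?c (A F)"] that T(1) nonneg unfolding C_def by fastforce
  have "0 \<le> (\<Sum>F\<in>T. ?c (A F))" by (intro sum_nonneg nonneg)
  then have "0 < C" unfolding C_def by linarith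
  let ?d = form_degree
  have hom: "homogeneous (?d F) F" if "F \<in> T" for F
    using that T(2) S homogeneous_form_degree by blast
  define t where "t F = (if ?d F \<le> e then coeff (graded (A F)) (e - ?d F) * mpoly_comp F f else 0)" for F
  have "mpoly_comp U f = coeff (graded U) e"
    by (simp add: graded_homogeneous[OF U(1)])
  also have "graded U = (\<Sum>F\<in>T. graded (A F) * graded F)"
    unfolding U_eq graded_def by (simp add: graded.insert_simps)
  also have "coeff \<dots> e = (\<Sum>F\<in>T. t F)"
    unfolding coeff_sum
  proof (intro sum.cong refl)
    fix F assume "F \<in> T"
    then show "coeff (graded (A F) * graded F) e = t F"
      using coeff_monom_mult[of "mpoly_comp F f" "?d F" "graded (A F)" e]
      by (simp add: graded_homogeneous[OF hom] t_def mult.commute)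
  qed
  finally have eq: "mpoly_comp U f = (\<Sum>F\<in>T. t F)" .
  have "\<exists>F\<in>T. rel_size e U r \<le> C * rel_size (?d F) F r" if r: "0 < r" and pos: "0 < rel_size e U r" for r
  proof -
    have "T \<noteq> {}" using pos eq by (auto simp: rel_size_def)
    then obtain F where F: "F \<in> T" "fps_norm v (mpoly_comp U f) r \<le> fps_norm v (t F) r"
      using norm_sum_attained[OF T(1), of t r] r unfolding eq
      by (metis less_imp_le rapidly_decaying_0 rapidly_decaying_coeff_graded rapidly_decaying_comp
          rapidly_decaying_mult t_def)
    let ?n = "map_norm v f r"
    have n: "0 < ?n" by (rule map_norm_pos[OF r])
    have "0 < fps_norm v (t F) r"
      using F(2) pos n by (simp add: rel_size_def zero_less_divide_iff)
    then have le: "?d F \<le> e" by (auto simp: t_def split: if_splits)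
    have "fps_norm v (t F) r
        = fps_norm v (coeff (graded (A F)) (e - ?d F)) r * fps_norm v (mpoly_comp F f) r"
      using le r rapidly_decaying_coeff_graded rapidly_decaying_comp by (simp add: t_def norm_mult)
    also have "\<dots> \<le> (C * ?n ^ (e - ?d F)) * fps_norm v (mpoly_comp F f) r"
    proof (rule mult_right_mono)
      have "fps_norm v (coeff (graded (A F)) (e - ?d F)) r \<le> ?c (A F) * ?n ^ (e - ?d F)"
        by (rule norm_coeff_graded_le[OF r])
      also have "\<dots> \<le> C * ?n ^ (e - ?d F)" using cC[OF F(1)] n by (intro mult_right_mono) auto
      finally show "fps_norm v (coeff (graded (A F)) (e - ?d F)) r \<le> C * ?n ^ (e - ?d F)" .
      show "0 \<le> fps_norm v (mpoly_comp F f) r"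
        using norm_nonneg rapidly_decaying_comp r by simp
    qed
    finally have "fps_norm v (mpoly_comp U f) r \<le> C * ?n ^ (e - ?d F) * fps_norm v (mpoly_comp F f) r"
      using F(2) by linarith
    moreover have "?n ^ e = ?n ^ (e - ?d F) * ?n ^ ?d F" using le by (simp flip: power_add)
    ultimately have "rel_size e U r \<le> C * rel_size (?d F) F r"
      using n by (simp add: rel_size_def divide_simps mult_ac)
    then show ?thesis using F(1) by blast
  qed
  then show ?thesis using that[OF T \<open>0 < C\<close>] by blast
qed

lemma rel_size_mult:
  "0 < r \<Longrightarrow> rel_size (d + e) (F * G) r = rel_size d F r * rel_size e G r"
  by (simp add: rel_size_def norm_mult rapidly_decaying_comp power_add)

text \<open>Forms without a common zero cannot all be small at the same radius: by the Nullstellensatz they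
  generate a power of each variable, and at each radius the norm of \<open>f\<close> is that of some coordinate.\<close>

lemma no_common_zero_bound:
  assumes S: "\<And>F. F \<in> S \<Longrightarrow> \<exists>d. homogeneous d F" and empty: "proj_zeros S = {}"
  obtains T C where "finite T" "T \<subseteq> S" "0 < C"
    "\<And>r. 0 < r \<Longrightarrow> \<exists>F\<in>T. C \<le> rel_size (form_degree F) F r"
proof -
  define bounds where "bounds j TC \<longleftrightarrow> finite (fst TC) \<and> fst TC \<subseteq> S \<and> 0 < snd TC \<and>
    (\<forall>r>0. map_norm v f r = fps_norm v (f $ j) r \<longrightarrow>
      (\<exists>F\<in>fst TC. 1 \<le> snd TC * rel_size (form_degree F) F r))" for j TC
  have "\<exists>TC. bounds j TC" for j
  proof -
    have "mpoly_eval (mvar j) a = 0" if "\<And>F. F \<in> ideal.span S \<Longrightarrow> mpoly_eval F a = 0" for a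
    proof -
      have "a = 0" using empty that ideal.span_base by (fastforce simp: proj_zeros_def)
      then show ?thesis by simp
    qed
    then obtain n where n: "mvar j ^ n \<in> ideal.span S"
      using nullstellensatz[OF ideal.subspace_span] by blast
    have hom: "homogeneous n (mvar j ^ n :: ('v, 'a) mpoly)"
      using homogeneous_power[OF homogeneous_mvar, of n j] by simp
    obtain T C where TC: "finite T" "T \<subseteq> S" "0 < C"
      "\<And>r. 0 < r \<Longrightarrow> 0 < rel_size n (mvar j ^ n) r \<Longrightarrow>
        \<exists>F\<in>T. rel_size n (mvar j ^ n) r \<le> C * rel_size (form_degree F) F r"
      using rel_size_ideal[OF hom n S] by blast
    have "rel_size n (mvar j ^ n) r = 1" if "0 < r" "map_norm v f r = fps_norm v (f $ j) r" for r
      using that map_norm_pos[of r] decay by (simp add: rel_size_def norm_power)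
    then have "bounds j (T, C)" using TC unfolding bounds_def by fastforce
    then show ?thesis ..
  qed
  then obtain TC where TC: "\<And>j. bounds j (TC j)" by metis
  define C where "C = Max (range (\<lambda>j. snd (TC j)))"
  have C: "0 < snd (TC j)" "snd (TC j) \<le> C" for j
    using TC[of j] by (auto simp: bounds_def C_def)
  then have "0 < C" by (meson less_le_trans)
  show ?thesis
  proof
    show "finite (\<Union>j. fst (TC j))" "(\<Union>j. fst (TC j)) \<subseteq> S"
      using TC unfolding bounds_def by auto
    show "0 < 1 / C" using \<open>0 < C\<close> by simp
    fix r :: real assume r: "0 < r"
    obtain j where "map_norm v f r = fps_norm v (f $ j) r" by (rule map_norm_attained)
    then obtain F where F: "F \<in> fst (TC j)" "1 \<le> snd (TC j) * rel_size (form_degree F) F r"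
      using TC[of j] r unfolding bounds_def by blast
    have "1 \<le> C * rel_size (form_degree F) F r"
      using F(2) mult_right_mono[OF C(2)[of j] rel_size_nonneg[OF r, of "form_degree F" F]] by linarith
    then have "1 / C \<le> rel_size (form_degree F) F r" using \<open>0 < C\<close> by (simp add: field_simps)
    then show "\<exists>F\<in>\<Union>j. fst (TC j). 1 / C \<le> rel_size (form_degree F) F r" using F(1) by blast
  qed
qed

lemma norm_bounded_below:
  assumes "rapidly_decaying g" "g \<noteq> 0"
  obtains c where "0 < c" "\<And>r. 1 \<le> r \<Longrightarrow> c \<le> fps_norm v g r"
proof -
  obtain i where i: "fps_nth g i \<noteq> 0" using assms(2) by (auto simp: fps_nonzero_nth)
  have "v (fps_nth g i) \<le> fps_norm v g r" if "1 \<le> r" for r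
  proof -
    have "v (fps_nth g i) * 1 \<le> v (fps_nth g i) * r ^ i"
      using that by (intro mult_left_mono) auto
    then show ?thesis using term_le_norm[OF assms(1), of r i] that by simp
  qed
  then show ?thesis using that v_pos[OF i] by blast
qed

lemma map_norm_bounded_below:
  obtains c where "0 < c" "\<And>r. 1 \<le> r \<Longrightarrow> c \<le> map_norm v f r"
proof -
  obtain j where "f $ j \<noteq> 0" using nonzero by (auto simp: vec_eq_iff)
  then show ?thesis using norm_bounded_below[OF decay] norm_le_map_norm order_trans that by metis
qed

text \<open>If the common zeros of \<open>S\<close> are reduced isolated points, then \<open>f\<close> cannot approach them faster
  than \<open>1 / map_norm v f r\<close>. For each zero \<open>P\<close> take \<open>G\<close> as in the local equations. The forms \<open>G\<close> and
  those in \<open>S\<close> have no common zero, so at each radius one of them is not small. If it is some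
  \<open>G\<close>, choose a linear form \<open>H\<close> vanishing at the corresponding \<open>P\<close> with \<open>H \<circ> f \<noteq> 0\<close>: its
  norm is bounded below, and \<open>G * H\<close> lies in the ideal of \<open>S\<close>.\<close>

lemma isolated_zeros_bound:
  assumes S: "\<And>F. F \<in> S \<Longrightarrow> \<exists>d. homogeneous d F"
    and tan: "\<And>P w. P \<in> proj_zeros S \<Longrightarrow> w \<in> tangent S P \<Longrightarrow> \<exists>c. w = c *s P"
    and nonconst: "\<And>P p. P $ p \<noteq> 0 \<Longrightarrow> \<exists>k. mpoly_comp (line_form P p k) f \<noteq> 0"
  obtains T C where "finite T" "T \<subseteq> S" "0 < C"
    "\<And>r. 1 \<le> r \<Longrightarrow> \<exists>F\<in>T. C \<le> rel_size (form_degree F) F r * map_norm v f r"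
proof -
  define Gs where "Gs = {G. \<exists>e H. homogeneous e G \<and> homogeneous 1 H \<and> mpoly_comp H f \<noteq> 0 \<and>
    G * H \<in> ideal.span S}"
  have hom: "\<exists>d. homogeneous d F" if "F \<in> S \<union> Gs" for F
    using that S by (auto simp: Gs_def)
  have "proj_zeros (S \<union> Gs) = {}"
  proof (rule equals0I)
    fix P assume P: "P \<in> proj_zeros (S \<union> Gs)"
    then have PS: "P \<in> proj_zeros S" and "P \<noteq> 0" by (auto simp: proj_zeros_def)
    then obtain p where p: "P $ p \<noteq> 0" by (auto simp: vec_eq_iff)
    obtain G e where G: "homogeneous e G" "mpoly_eval G P \<noteq> 0" "\<And>k. G * line_form P p k \<in> ideal.span S"
      using local_equations[OF PS S tan[OF PS] p] by metis
    obtain k where "mpoly_comp (line_form P p k) f \<noteq> 0" using nonconst p by blast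
    moreover have "homogeneous 1 (line_form P p k)"
      unfolding line_form_def
      by (intro homogeneous_diff homogeneous_mconst_mult homogeneous_mvar)
    ultimately have "G \<in> Gs" using G unfolding Gs_def by blast
    then show False using P G(2) by (auto simp: proj_zeros_def)
  qed
  then obtain T C where T: "finite T" "T \<subseteq> S \<union> Gs" "0 < C"
    and TC: "\<And>r. 0 < r \<Longrightarrow> \<exists>F\<in>T. C \<le> rel_size (form_degree F) F r"
    using no_common_zero_bound[OF hom] by blast
  define bounds where "bounds G UK \<longleftrightarrow> finite (fst UK) \<and> fst UK \<subseteq> S \<and> 0 < snd UK \<and>
    (\<forall>r\<ge>1. C \<le> rel_size (form_degree G) G r \<longrightarrow>
      (\<exists>F\<in>fst UK. snd UK \<le> rel_size (form_degree F) F r * map_norm v f r))" for G UK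
  have "\<exists>UK. bounds G UK" if "G \<in> T" for G
  proof (cases "G \<in> S")
    case True
    obtain c where c: "0 < c" "\<And>r. 1 \<le> r \<Longrightarrow> c \<le> map_norm v f r"
      by (rule map_norm_bounded_below) blast
    have "C * c \<le> rel_size (form_degree G) G r * map_norm v f r"
      if "1 \<le> r" "C \<le> rel_size (form_degree G) G r" for r
      using that c T(3) by (intro mult_mono) auto
    then have "bounds G ({G}, C * c)" using True T(3) c(1) by (auto simp: bounds_def)
    then show ?thesis ..
  next
    case False
    then have "G \<in> Gs" using that T(2) by blast
    then obtain e H where H: "homogeneous e G" "homogeneous 1 H" "mpoly_comp H f \<noteq> 0"
      "G * H \<in> ideal.span S"
      by (auto simp: Gs_def)
    let ?e = "form_degree G"
    have "homogeneous (?e + 1) (G * H)"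
      using homogeneous_form_degree[OF H(1)] H(2) by (rule homogeneous_mult)
    then obtain U K where U: "finite U" "U \<subseteq> S" "0 < K"
      and UK: "\<And>r. 0 < r \<Longrightarrow> 0 < rel_size (?e + 1) (G * H) r \<Longrightarrow>
        \<exists>F\<in>U. rel_size (?e + 1) (G * H) r \<le> K * rel_size (form_degree F) F r"
      using rel_size_ideal[OF _ H(4) S] by blast
    obtain c where c: "0 < c" "\<And>r. 1 \<le> r \<Longrightarrow> c \<le> fps_norm v (mpoly_comp H f) r"
      using norm_bounded_below[OF rapidly_decaying_comp H(3)] by blast
    have "\<exists>F\<in>U. C * c / K \<le> rel_size (form_degree F) F r * map_norm v f r"
      if r: "1 \<le> r" and GC: "C \<le> rel_size ?e G r" for r
    proof -
      let ?n = "map_norm v f r"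
      have n: "0 < ?n" using r by (intro map_norm_pos) simp
      have "C * (c / ?n) \<le> rel_size ?e G r * rel_size 1 H r"
        using GC c r n T(3) by (intro mult_mono) (auto simp: rel_size_def divide_right_mono)
      also have "\<dots> = rel_size (?e + 1) (G * H) r" using rel_size_mult[of r ?e 1 G H] r by simp
      finally have le: "C * (c / ?n) \<le> rel_size (?e + 1) (G * H) r" .
      have "0 < C * (c / ?n)" using T(3) c n by simp
      then obtain F where F: "F \<in> U" "rel_size (?e + 1) (G * H) r \<le> K * rel_size (form_degree F) F r"
        using UK[of r] r le by force
      have "C * (c / ?n) \<le> K * rel_size (form_degree F) F r" using le F(2) by linarith
      then have "C * c / K \<le> rel_size (form_degree F) F r * ?n"
        using n U(3) by (simp add: field_simps)
      then show ?thesis using F(1) by blast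
    qed
    then have "bounds G (U, C * c / K)" using U T(3) c(1) by (simp add: bounds_def)
    then show ?thesis ..
  qed
  then obtain UK where UK: "\<And>G. G \<in> T \<Longrightarrow> bounds G (UK G)" by metis
  define K where "K = Min ((\<lambda>G. snd (UK G)) ` T)"
  have "T \<noteq> {}" using TC[of 1] by auto
  then have "K \<in> (\<lambda>G. snd (UK G)) ` T" unfolding K_def using T(1) by (intro Min_in) auto
  then have "0 < K" using UK by (auto simp: bounds_def)
  show ?thesis
  proof
    show "finite (\<Union>G\<in>T. fst (UK G))" "(\<Union>G\<in>T. fst (UK G)) \<subseteq> S"
      using UK T(1) unfolding bounds_def by auto
    show "0 < K" by fact
    fix r :: real assume r: "1 \<le> r"
    then obtain G where G: "G \<in> T" "C \<le> rel_size (form_degree G) G r" using TC[of r] by auto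
    then obtain F where F: "F \<in> fst (UK G)" "snd (UK G) \<le> rel_size (form_degree F) F r * map_norm v f r"
      using UK[OF G(1)] r unfolding bounds_def by blast
    moreover have "K \<le> snd (UK G)" unfolding K_def using T(1) G(1) by (intro Min_le) auto
    ultimately show "\<exists>F\<in>\<Union>G\<in>T. fst (UK G). K \<le> rel_size (form_degree F) F r * map_norm v f r"
      using G(1) by force
  qed
qed

end

section \<open>The defect relation\<close>

text \<open>At most \<open>n\<close> of the numbers exceed \<open>L\<close>. They are at most \<open>L + T\<close> each, and if there are exactly
  \<open>n\<close> of them, the smallest one is at most \<open>L + \<mu> * T\<close>.\<close>

lemma counting_bound:
  fixes y :: "'i \<Rightarrow> real"
  assumes I: "finite I" and n: "1 \<le> n"
    and A: "\<And>J. J \<subseteq> I \<Longrightarrow> card J = n + 1 \<Longrightarrow> \<exists>i\<in>J. y i \<le> L"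
    and B: "\<And>J. J \<subseteq> I \<Longrightarrow> card J = n \<Longrightarrow> \<exists>i\<in>J. y i \<le> L + \<mu> * T"
    and C: "\<And>i. i \<in> I \<Longrightarrow> y i \<le> L + T"
    and nonneg: "0 \<le> T" "0 \<le> L" "0 \<le> \<mu>"
  shows "(\<Sum>i\<in>I. y i) \<le> (real n - 1 + \<mu>) * T + (real (card I) + real n) * L"
proof -
  define K where "K = {i \<in> I. L < y i}"
  have fin: "finite K" "K \<subseteq> I" using I by (auto simp: K_def)
  have "card K \<le> n"
  proof (rule ccontr)
    assume "\<not> ?thesis"
    then obtain J where "J \<subseteq> K" "card J = n + 1"
      by (metis Suc_eq_plus1 not_less_eq_eq obtain_subset_with_card_n)
    then show False using A[of J] fin by (fastforce simp: K_def)
  qed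
  have part: "(\<Sum>i\<in>J. y i) \<le> (real n - 1) * (L + T)" if J: "J \<subseteq> K" "card J \<le> n - 1" for J
  proof -
    have "(\<Sum>i\<in>J. y i) \<le> real (card J) * (L + T)"
      using J(1) fin C by (intro sum_bounded_above) auto
    also have "\<dots> \<le> (real n - 1) * (L + T)"
      using J(2) n nonneg by (intro mult_right_mono) auto
    finally show ?thesis .
  qed
  have K: "(\<Sum>i\<in>K. y i) \<le> (real n - 1) * (L + T) + (L + \<mu> * T)"
  proof (cases "card K = n")
    case True
    then obtain i where i: "i \<in> K" "y i \<le> L + \<mu> * T" using B fin by blast
    have "(\<Sum>j\<in>K - {i}. y j) \<le> (real n - 1) * (L + T)"
      using True i by (intro part) auto
    then show ?thesis using i fin by (simp add: sum.remove)
  next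
    case False
    then have "(\<Sum>i\<in>K. y i) \<le> (real n - 1) * (L + T)" using \<open>card K \<le> n\<close> by (intro part) auto
    moreover have "0 \<le> L + \<mu> * T" using nonneg by simp
    ultimately show ?thesis by linarith
  qed
  have "(\<Sum>i\<in>I - K. y i) \<le> real (card (I - K)) * L"
    by (intro sum_bounded_above) (auto simp: K_def)
  also have "\<dots> \<le> real (card I) * L"
    using I nonneg by (intro mult_right_mono) (auto intro: card_mono)
  finally have "(\<Sum>i\<in>I. y i) \<le> real (card I) * L + ((real n - 1) * (L + T) + (L + \<mu> * T))"
    using K sum.subset_diff[OF fin(2) I, of y] by linarith
  then show ?thesis by (simp add: algebra_simps)
qed

lemma sum_Liminf_le:
  fixes g :: "'i \<Rightarrow> 'b \<Rightarrow> ereal"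
  assumes "F \<noteq> bot" "\<And>i x. 0 \<le> g i x"
  shows "(\<Sum>i\<in>A. Liminf F (g i)) \<le> Liminf F (\<lambda>x. \<Sum>i\<in>A. g i x)"
proof (induction A rule: infinite_finite_induct)
  case (insert i A)
  have "Liminf F (g i) + (\<Sum>i\<in>A. Liminf F (g i)) \<le> Liminf F (g i) + Liminf F (\<lambda>x. \<Sum>i\<in>A. g i x)"
    using insert.IH by (rule add_left_mono)
  also have "\<dots> \<le> Liminf F (\<lambda>x. g i x + (\<Sum>i\<in>A. g i x))"
    using assms by (intro Liminf_add_le always_eventually allI sum_nonneg) auto
  finally show ?case using insert.hyps by simp
qed (use assms(1) in \<open>auto simp: Liminf_const\<close>)

lemma uniform_constant:
  assumes "finite A" "\<And>a. a \<in> A \<Longrightarrow> \<exists>c>0. P a c"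
    and mono: "\<And>a c c'. P a c \<Longrightarrow> c' \<le> c \<Longrightarrow> P a c'"
  shows "\<exists>c>0::real. \<forall>a\<in>A. P a c"
  using assms(1,2)
proof (induction A rule: finite_induct)
  case (insert a A)
  then obtain b c where "0 < b" "P a b" "0 < c" "\<forall>a\<in>A. P a c" by (metis insert_iff)
  then show ?case using mono by (intro exI[of _ "min b c"]) auto
qed (auto intro: exI[of _ 1])

lemma dim_le_1_multiple:
  fixes P :: "'a::field ^ 'v::finite"
  assumes W: "vec.dim W \<le> 1" "P \<in> W" "P \<noteq> 0" "w \<in> W"
  shows "\<exists>c. w = c *s P"
proof (rule ccontr)
  assume no: "\<not> ?thesis"
  then have "w \<notin> vec.span {P}" by (auto simp: vec.span_singleton)
  moreover have "vec.independent {P}" using W(3) by simp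
  ultimately have "vec.independent {w, P}" by (rule vec.independent_insertI)
  moreover have "w \<noteq> P" using no by (metis vector_smult_lid)
  ultimately have "vec.dim {w, P} = 2" by (simp add: vec.dim_eq_card_independent)
  moreover have "vec.dim {w, P} \<le> vec.dim W" using W by (intro vec.dim_subset) auto
  ultimately show False using W(1) by simp
qed

text \<open>By Euler's relation the tangent space at a common point contains that point, so its codimension
  is less than the number \<open>N + 1\<close> of variables. But for \<open>n + 1\<close> hypersurfaces transversality with \<open>X\<close>
  would make the codimension \<open>(N - n) + (n + 1)\<close>; for \<open>n\<close> of them it is \<open>N\<close>, so the tangent space is
  the line through the point.\<close>

lemma transverse_tangent:
  fixes X :: "('a::field ^ 'v::finite) set" and Q :: "nat \<Rightarrow> ('v, 'a) mpoly"
  assumes trans: "all_intersections_transverse q Q X n" and J: "J \<subseteq> {1..q}" "J \<noteq> {}"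
    and Q: "\<And>i. i \<in> {1..q} \<Longrightarrow> hypersurface (d i) (Q i)"
    and P: "P \<in> proj_zeros (vanishing_forms X \<union> Q ` J)"
  shows "card J \<le> n" "card J = n \<Longrightarrow> w \<in> tangent (vanishing_forms X \<union> Q ` J) P \<Longrightarrow> \<exists>c. w = c *s P"
proof -
  let ?S = "case_option (vanishing_forms X) (\<lambda>i. {Q i})" and ?I = "insert None (Some ` J)"
  let ?W = "tangent (vanishing_forms X \<union> Q ` J) P"
  have fin: "finite J" using J(1) by (rule finite_subset) simp
  have card: "card ?I = card J + 1" using fin by (simp add: card_image)
  have "?W = (\<Inter>j\<in>?I. tangent (?S j) P)" by (auto simp: tangent_def)
  moreover have "codim (\<Inter>j\<in>?I. tangent (?S j) P) = (\<Sum>j\<in>?I. case_option (CARD('v) - 1 - n) (\<lambda>i. 1) j)"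
  proof -
    have "2 \<le> card ?I" using card J(2) fin by (simp add: Suc_le_eq card_gt_0_iff)
    moreover have "?I \<subseteq> insert None (Some ` {1..q})" using J(1) by auto
    moreover have "\<forall>j\<in>?I. P \<in> proj_zeros (?S j)" using P by (auto simp: proj_zeros_def)
    moreover have "finite ?I" using fin by simp
    ultimately have "finite ?I \<and> ?I \<subseteq> insert None (Some ` {1..q}) \<and> 2 \<le> card ?I \<and>
        (\<forall>j\<in>?I. P \<in> proj_zeros (?S j))"
      by (intro conjI)
    from trans[unfolded all_intersections_transverse_def transverse_family_def, THEN spec, THEN spec,
        THEN mp, OF this]
    show ?thesis by (rule conjunct2)
  qed
  moreover have "(\<Sum>j\<in>?I. case_option (CARD('v) - 1 - n) (\<lambda>i. 1) j) = CARD('v) - 1 - n + card J"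
    using fin by (simp add: sum.reindex card_image)
  ultimately have codim: "CARD('v) - vec.dim ?W = CARD('v) - 1 - n + card J"
    by (simp add: codim_def)
  have PW: "P \<in> ?W"
  proof (rule point_in_tangent[OF P])
    fix F assume "F \<in> vanishing_forms X \<union> Q ` J"
    then show "\<exists>d. homogeneous d F"
      using J(1) Q unfolding vanishing_forms_def hypersurface_def by blast
  qed
  have "P \<noteq> 0" using P by (simp add: proj_zeros_def)
  then have "1 \<le> vec.dim ?W" using vec.dim_subset[of "{P}" ?W] PW by simp
  moreover have "0 < CARD('v)" by simp
  ultimately have lt: "CARD('v) - vec.dim ?W < CARD('v)" by linarith
  then show "card J \<le> n" using codim by linarith
  show "\<exists>c. w = c *s P" if "card J = n" "w \<in> ?W"
  proof (rule dim_le_1_multiple[OF _ PW \<open>P \<noteq> 0\<close> that(2)])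
    have "vec.dim ?W \<le> CARD('v)"
      using vec.dim_subset_UNIV[of ?W] by (simp add: card_cart_basis vec.dimension_def)
    then show "vec.dim ?W \<le> 1" using codim that(1) by linarith
  qed
qed

lemma (in nonarch_field) has_value_comp:
  assumes "\<And>j. fps_has_value v (f $ j) z (x $ j)" "\<And>j. rapidly_decaying (f $ j)"
  shows "fps_has_value v (mpoly_comp F f) z (mpoly_eval F x)"
  unfolding mpoly_comp_def mpoly_eval_def mpoly_insert_def
  using assms
  by (intro has_value_sum has_value_mult has_value_prod has_value_power has_value_const conjI
      rapidly_decaying_const rapidly_decaying_power rapidly_decaying_prod)

lemma (in nonarch_field) analytic_map_has_value:
  assumes "analytic_map v f"
  shows "fps_has_value v (mpoly_comp F f) z (mpoly_eval F (map_value v f z))"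
  using assms entire_has_value entire_rapidly_decaying
  by (intro has_value_comp) (auto simp: analytic_map_def map_value_def)

lemma (in nonarch_field) comp_eq_0_iff:
  assumes "analytic_map v f" "infinite (UNIV :: 'a set)"
  shows "mpoly_comp F f = 0 \<longleftrightarrow> (\<forall>z. mpoly_eval F (map_value v f z) = 0)"
proof
  assume "mpoly_comp F f = 0"
  then show "\<forall>z. mpoly_eval F (map_value v f z) = 0"
    using analytic_map_has_value[OF assms(1), of F] has_value_const[of 0] has_value_unique by fastforce
next
  assume "\<forall>z. mpoly_eval F (map_value v f z) = 0"
  moreover have "rapidly_decaying (mpoly_comp F f)"
    using assms(1) entire_rapidly_decaying unfolding mpoly_comp_def mpoly_insert_def
    by (intro rapidly_decaying_sum rapidly_decaying_mult rapidly_decaying_prod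
      rapidly_decaying_power rapidly_decaying_const) (auto simp: analytic_map_def)
  ultimately show "mpoly_comp F f = 0"
    using analytic_map_has_value[OF assms(1), of F] assms(2) by (intro eq_0_if_values_0) auto
qed

context nonarch_field
begin

text \<open>If all these linear forms vanished on the image, every value of \<open>f\<close> would be a multiple of \<open>P\<close>.\<close>

lemma line_form_comp_nonzero:
  assumes f: "analytic_map v f" "nonconstant_map v f" and inf: "infinite (UNIV :: 'a set)"
    and p: "P $ p \<noteq> 0"
  shows "\<exists>k. mpoly_comp (line_form P p k) f \<noteq> 0"
proof (rule ccontr)
  assume "\<not> ?thesis"
  then have eq: "P $ p * map_value v f z $ k = P $ k * map_value v f z $ p" for z k
    using comp_eq_0_iff[OF f(1) inf, of "line_form P p k"] by (simp add: line_form_def)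
  have mult: "map_value v f z = (map_value v f z $ p / P $ p) *s P" for z
    using eq[of z] p by (simp add: vec_eq_iff field_simps)
  have nz: "map_value v f z $ p \<noteq> 0" for z
    using mult[of z] f(1) by (metis analytic_map_def div_0 vector_smult_lzero)
  have "map_value v f w = (map_value v f w $ p / map_value v f z $ p) *s map_value v f z" for z w
    unfolding vec_eq_iff
  proof
    fix k
    have "map_value v f z $ k = map_value v f z $ p / P $ p * P $ k" for z
      using eq[of z k] p by (simp add: field_simps)
    from this[of w] this[of z]
    show "map_value v f w $ k =
        ((map_value v f w $ p / map_value v f z $ p) *s map_value v f z) $ k"
      using nz[of z] p by simp
  qed
  then show False using f(2) unfolding nonconstant_map_def by blast
qed

text \<open>A coordinate of \<open>f\<close> that is not a constant series has norm growing at least linearly.\<close>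

lemma map_norm_at_top:
  assumes f: "analytic_map v f" "nonconstant_map v f"
  shows "filterlim (map_norm v f) at_top at_top"
proof -
  have decay: "rapidly_decaying (f $ j)" for j
    using f(1) entire_rapidly_decaying by (auto simp: analytic_map_def)
  have "\<exists>j i. 1 \<le> i \<and> fps_nth (f $ j) i \<noteq> 0"
  proof (rule ccontr)
    assume no: "\<not> ?thesis"
    have "f $ j = fps_const (fps_nth (f $ j) 0)" for j
      using no by (auto simp: fps_eq_iff)
    then have "fps_value v (f $ j) z = fps_nth (f $ j) 0" for j z
      using fps_value_eq has_value_const by metis
    then have "map_value v f w = 1 *s map_value v f z" for z w
      by (simp add: map_value_def)
    then show False using f(2) unfolding nonconstant_map_def by blast
  qed
  then obtain j i where i: "1 \<le> i" "fps_nth (f $ j) i \<noteq> 0" by blast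
  have "v (fps_nth (f $ j) i) * r \<le> map_norm v f r" if "1 \<le> r" for r
  proof -
    have "v (fps_nth (f $ j) i) * r \<le> v (fps_nth (f $ j) i) * r ^ i"
      using that i power_increasing[of 1 i r] by (intro mult_left_mono) auto
    also have "\<dots> \<le> fps_norm v (f $ j) r" using that by (intro term_le_norm decay) simp
    also have "\<dots> \<le> map_norm v f r" unfolding map_norm_def by (intro Max_ge) auto
    finally show ?thesis .
  qed
  then have "\<forall>\<^sub>F r in at_top. v (fps_nth (f $ j) i) * r \<le> map_norm v f r"
    by (intro eventually_at_top_linorderI[of 1])
  moreover have "filterlim (\<lambda>r. v (fps_nth (f $ j) i) * r) at_top at_top"
    using v_pos[OF i(2)] by (intro filterlim_tendsto_pos_mult_at_top[OF tendsto_const]) (auto intro: filterlim_ident)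
  ultimately show ?thesis by (rule filterlim_at_top_mono[rotated])
qed

end

text \<open>The estimates \<open>a\<close>, \<open>b\<close> and \<open>c\<close> in the proof are those for \<open>n + 1\<close>, for \<open>n\<close> and for single
  hypersurfaces. Each becomes a bound on proximity functions by taking logarithms, with the common
  error \<open>L\<close>.\<close>

theorem defect_sum_bound:
  fixes v :: "'a::alg_closed_field \<Rightarrow> real"
    and X :: "('a ^ 'v::finite) set"
    and Q :: "nat \<Rightarrow> ('v, 'a) mpoly"
  assumes v: "nonarch_abs v" and n: "1 \<le> n"
    and Q: "\<And>i. i \<in> {1..q} \<Longrightarrow> hypersurface (d i) (Q i)"
    and trans: "all_intersections_transverse q Q X n"
    and f: "analytic_map_into v f X" "nonconstant_map v f"
    and notin: "\<And>i. i \<in> {1..q} \<Longrightarrow> \<exists>z. map_value v f z \<notin> proj_zeros {Q i}"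
    and \<mu>: "\<And>i. i \<in> {1..q} \<Longrightarrow> 1 / real (d i) \<le> \<mu>" "0 \<le> \<mu>"
  shows "(\<Sum>i = 1..q. defect v f (d i) (Q i)) \<le> ereal (real n - 1 + \<mu>)"
proof -
  interpret nonarch_field v by standard (rule v)
  note inf = infinite_UNIV_alg_closed[where ?'a = 'a]
  have f1: "analytic_map v f" using f(1) by (simp add: analytic_map_into_def)
  interpret entire_tuple v f
  proof
    show "rapidly_decaying (f $ j)" for j
      using f1 entire_rapidly_decaying by (simp add: analytic_map_def)
    show "f \<noteq> 0"
    proof
      assume "f = 0"
      moreover have "fps_value v 0 z = 0" for z
        using fps_value_eq[OF has_value_const[of 0]] by simp
      ultimately have "map_value v f 0 = 0" by (simp add: map_value_def vec_eq_iff)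
      then show False using f1 by (simp add: analytic_map_def)
    qed
  qed
  let ?M = "map_norm v f" and ?T = "characteristic v f"
  define rel where "rel i r = rel_size (d i) (Q i) r" for i r
  have Qf: "mpoly_comp (Q i) f \<noteq> 0" if i: "i \<in> {1..q}" for i
  proof -
    obtain z where "map_value v f z \<notin> proj_zeros {Q i}" using notin[OF i] ..
    then have "mpoly_eval (Q i) (map_value v f z) \<noteq> 0"
      using f1 by (auto simp: proj_zeros_def analytic_map_def)
    then show ?thesis using comp_eq_0_iff[OF f1 inf] by blast
  qed
  have rel_pos: "0 < rel i r" if "i \<in> {1..q}" "0 < r" for i r
    using that Qf norm_pos rapidly_decaying_comp map_norm_pos by (simp add: rel_def rel_size_def)
  define S where "S J = vanishing_forms X \<union> Q ` J" for J
  have S_hom: "\<exists>d. homogeneous d F" if "J \<subseteq> {1..q}" "F \<in> S J" for J F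
    using that Q unfolding S_def vanishing_forms_def hypersurface_def by blast
  have S_member: "\<exists>i\<in>J. F = Q i \<and> form_degree F = d i"
    if J: "J \<subseteq> {1..q}" and F: "F \<in> S J" "0 < rel_size (form_degree F) F r" for J F r
  proof -
    have "F \<notin> vanishing_forms X"
    proof
      assume "F \<in> vanishing_forms X"
      then have "mpoly_comp F f = 0"
        using f(1) unfolding comp_eq_0_iff[OF f1 inf]
        by (auto simp: vanishing_forms_def analytic_map_into_def)
      then show False using F(2) by (simp add: rel_size_def)
    qed
    then obtain i where "i \<in> J" "F = Q i" using F(1) by (auto simp: S_def)
    moreover from this have "form_degree F = d i"
      using Q J by (intro form_degree_eq) (auto simp: hypersurface_def)
    ultimately show ?thesis by blast
  qed
  have "\<exists>c>0. \<forall>r\<ge>1. \<exists>i\<in>J. c \<le> rel i r" if J: "J \<subseteq> {1..q}" "card J = n + 1" for J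
  proof -
    have "J \<noteq> {}" using J by auto
    have "proj_zeros (S J) = {}"
      using transverse_tangent(1)[OF trans J(1) \<open>J \<noteq> {}\<close> Q] J(2) unfolding S_def by fastforce
    then obtain U c where c: "U \<subseteq> S J" "0 < c"
      "\<And>r. 0 < r \<Longrightarrow> \<exists>F\<in>U. c \<le> rel_size (form_degree F) F r"
      using no_common_zero_bound[OF S_hom[OF J(1)]] by metis
    have "\<exists>i\<in>J. c \<le> rel i r" if r: "1 \<le> r" for r
    proof -
      obtain F where F: "F \<in> U" "c \<le> rel_size (form_degree F) F r" using c(3)[of r] r by auto
      then show ?thesis using S_member[OF J(1), of F r] c(1,2) unfolding rel_def by fastforce
    qed
    then show ?thesis using c(2) by blast
  qed
  then have "\<exists>c>0. \<forall>J\<in>{J. J \<subseteq> {1..q} \<and> card J = n + 1}. \<forall>r\<ge>1. \<exists>i\<in>J. c \<le> rel i r"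
    by (intro uniform_constant) (auto, meson order_trans)
  then obtain a where a: "0 < a"
    "\<And>J r. J \<subseteq> {1..q} \<Longrightarrow> card J = n + 1 \<Longrightarrow> 1 \<le> r \<Longrightarrow> \<exists>i\<in>J. a \<le> rel i r" by blast
  have "\<exists>c>0. \<forall>r\<ge>1. \<exists>i\<in>J. c \<le> rel i r * ?M r" if J: "J \<subseteq> {1..q}" "card J = n" for J
  proof -
    have "J \<noteq> {}" using J n by auto
    have tan: "\<exists>c. w = c *s P" if "P \<in> proj_zeros (S J)" "w \<in> tangent (S J) P" for P w
      using transverse_tangent(2)[OF trans J(1) \<open>J \<noteq> {}\<close> Q, of P w] that J(2) unfolding S_def by blast
    obtain U c where c: "U \<subseteq> S J" "0 < c"
      "\<And>r. 1 \<le> r \<Longrightarrow> \<exists>F\<in>U. c \<le> rel_size (form_degree F) F r * ?M r"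
    proof (rule isolated_zeros_bound[of "S J"])
      show "\<exists>d. homogeneous d F" if "F \<in> S J" for F using S_hom J(1) that by blast
      show "\<exists>c. w = c *s P" if "P \<in> proj_zeros (S J)" "w \<in> tangent (S J) P" for P w
        using that by (rule tan)
      show "\<exists>k. mpoly_comp (line_form P p k) f \<noteq> 0" if "P $ p \<noteq> 0" for P p
        using that by (rule line_form_comp_nonzero[OF f1 f(2) inf])
    qed (rule that)
    have "\<exists>i\<in>J. c \<le> rel i r * ?M r" if r: "1 \<le> r" for r
    proof -
      obtain F where F: "F \<in> U" "c \<le> rel_size (form_degree F) F r * ?M r" using c(3) r by blast
      have "0 < ?M r" using r by (intro map_norm_pos) simp
      then have "0 < rel_size (form_degree F) F r"
        using F(2) c(2) by (metis less_le_trans zero_less_mult_pos2)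
      then show ?thesis using S_member[OF J(1), of F r] c(1) F unfolding rel_def by fastforce
    qed
    then show ?thesis using c(2) by blast
  qed
  then have "\<exists>c>0. \<forall>J\<in>{J. J \<subseteq> {1..q} \<and> card J = n}. \<forall>r\<ge>1. \<exists>i\<in>J. c \<le> rel i r * ?M r"
    by (intro uniform_constant) (auto, meson order_trans)
  then obtain b where b: "0 < b"
    "\<And>J r. J \<subseteq> {1..q} \<Longrightarrow> card J = n \<Longrightarrow> 1 \<le> r \<Longrightarrow> \<exists>i\<in>J. b \<le> rel i r * ?M r" by blast
  have "\<exists>c>0. \<forall>r\<ge>1. c \<le> fps_norm v (mpoly_comp (Q i) f) r" if "i \<in> {1..q}" for i
    using norm_bounded_below[OF rapidly_decaying_comp Qf[OF that]] by metis
  then have "\<exists>c>0. \<forall>i\<in>{1..q}. \<forall>r\<ge>1. c \<le> fps_norm v (mpoly_comp (Q i) f) r"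
    by (intro uniform_constant) (simp, blast, meson order_trans)
  then obtain c where c: "0 < c"
    "\<And>i r. i \<in> {1..q} \<Longrightarrow> 1 \<le> r \<Longrightarrow> c \<le> fps_norm v (mpoly_comp (Q i) f) r" by blast
  define L where "L = max 0 (max (- ln a) (max (- ln b) (- ln c)))"
  have L: "0 \<le> L" "- ln a \<le> L" "- ln b \<le> L" "- ln c \<le> L" by (auto simp: L_def)
  have prox: "proximity v f (d i) (Q i) r = - ln (rel i r)" if "i \<in> {1..q}" "1 \<le> r" for i r
  proof -
    have "proximity v f (d i) (Q i) r = ln (inverse (rel i r))"
      by (simp add: proximity_def rel_def rel_size_def)
    then show ?thesis using rel_pos[OF that(1), of r] that(2) by (simp add: ln_inverse)
  qed
  \<comment> \<open>Negative parts are cut off: this only increases the lower limits, and it keeps infinite negative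
    values out of the sum of lower limits.\<close>
  define y where "y i r = max 0 (proximity v f (d i) (Q i) r / real (d i))" for i r
  have d: "1 \<le> d i" if "i \<in> {1..q}" for i using Q[OF that] by (simp add: hypersurface_def)
  have bound: "(\<Sum>i=1..q. y i r) \<le> (real n - 1 + \<mu>) * ?T r + (real q + real n) * L"
    if r: "1 \<le> r" "1 \<le> ?M r" for r
  proof -
    have M: "0 < ?M r" "0 \<le> ?T r" "?T r = ln (?M r)" using r by (auto simp: characteristic_def)
    have "(\<Sum>i\<in>{1..q}. y i r) \<le> (real n - 1 + \<mu>) * ?T r + (real (card {1..q}) + real n) * L"
    proof (rule counting_bound)
      fix J assume J: "J \<subseteq> {1..q}" "card J = n + 1"
      then obtain i where i: "i \<in> J" "a \<le> rel i r" using a(2) r by blast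
      then have iq: "i \<in> {1..q}" using J by blast
      have "ln a \<le> ln (rel i r)" using a(1) i(2) by simp
      then have "proximity v f (d i) (Q i) r \<le> L" using prox[OF iq r(1)] L by linarith
      also have "L \<le> L * d i" using mult_left_mono[of 1 "real (d i)" L] d[OF iq] L(1) by simp
      finally have "y i r \<le> L" using d[OF iq] L(1) by (simp add: y_def field_simps)
      then show "\<exists>i\<in>J. y i r \<le> L" using i(1) by blast
    next
      fix J assume J: "J \<subseteq> {1..q}" "card J = n"
      then obtain i where i: "i \<in> J" "b \<le> rel i r * ?M r" using b(2) r by blast
      then have iq: "i \<in> {1..q}" using J by blast
      have "ln b \<le> ln (rel i r * ?M r)" using b(1) i(2) by simp
      also have "\<dots> = ln (rel i r) + ?T r"
        using rel_pos[OF iq, of r] r(1) M by (simp add: ln_mult)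
      finally have "proximity v f (d i) (Q i) r \<le> L + ?T r" using prox[OF iq r(1)] L by linarith
      then have "proximity v f (d i) (Q i) r / d i \<le> (L + ?T r) / d i"
        by (intro divide_right_mono) auto
      also have "\<dots> = L / d i + 1 / d i * ?T r" by (simp add: add_divide_distrib)
      also have "\<dots> \<le> L + \<mu> * ?T r"
      proof (rule add_mono)
        show "L / d i \<le> L" using d[OF iq] L(1) mult_left_mono[of 1 "real (d i)" L] by (simp add: field_simps)
        show "1 / d i * ?T r \<le> \<mu> * ?T r" using \<mu>(1)[OF iq] M(2) by (rule mult_right_mono)
      qed
      finally have "y i r \<le> L + \<mu> * ?T r" using L(1) \<mu>(2) M(2) by (simp add: y_def)
      then show "\<exists>i\<in>J. y i r \<le> L + \<mu> * ?T r" using i(1) by blast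
    next
      fix i assume i: "i \<in> {1..q}"
      have "ln c \<le> ln (fps_norm v (mpoly_comp (Q i) f) r)" using c(1) c(2)[OF i r(1)] by simp
      also have "fps_norm v (mpoly_comp (Q i) f) r = rel i r * ?M r ^ d i"
        using M(1) by (simp add: rel_def rel_size_def)
      also have "ln (rel i r * ?M r ^ d i) = ln (rel i r) + d i * ?T r"
        using rel_pos[OF i, of r] r(1) M by (simp add: ln_mult ln_realpow)
      finally have "proximity v f (d i) (Q i) r \<le> L + d i * ?T r" using prox[OF i r(1)] L by linarith
      also have "\<dots> \<le> L * d i + d i * ?T r"
        using mult_left_mono[of 1 "real (d i)" L] d[OF i] L(1) by simp
      finally show "y i r \<le> L + ?T r" using d[OF i] L(1) M(2) by (simp add: y_def field_simps)
    qed (use n M L \<mu> in auto)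
    then show ?thesis by simp
  qed
  have T_top: "filterlim ?T at_top at_top"
    unfolding characteristic_def using filterlim_compose[OF ln_at_top map_norm_at_top[OF f1 f(2)]] .
  let ?B = "real n - 1 + \<mu>" and ?K = "(real q + real n) * L"
  have "(\<Sum>i=1..q. defect v f (d i) (Q i))
      \<le> (\<Sum>i=1..q. Liminf at_top (\<lambda>r. ereal (max 0 (proximity v f (d i) (Q i) r / (real (d i) * ?T r)))))"
    unfolding defect_def by (intro sum_mono Liminf_mono always_eventually) auto
  also have "\<dots> \<le> Liminf at_top (\<lambda>r. \<Sum>i=1..q. ereal (max 0 (proximity v f (d i) (Q i) r / (real (d i) * ?T r))))"
    by (intro sum_Liminf_le) (simp_all add: le_max_iff_disj zero_ereal_def)
  also have "\<dots> \<le> Liminf at_top (\<lambda>r. ereal (?B + ?K / ?T r))"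
  proof (rule Liminf_mono)
    have "\<forall>\<^sub>F r in at_top. 1 \<le> r \<and> 1 \<le> ?M r \<and> 0 < ?T r"
    proof (intro eventually_conj eventually_ge_at_top)
      show "\<forall>\<^sub>F r in at_top. 1 \<le> ?M r"
        using map_norm_at_top[OF f1 f(2)] unfolding filterlim_at_top by blast
      show "\<forall>\<^sub>F r in at_top. 0 < ?T r"
        using T_top unfolding filterlim_at_top_dense by blast
    qed
    then show "\<forall>\<^sub>F r in at_top. (\<Sum>i=1..q. ereal (max 0 (proximity v f (d i) (Q i) r / (real (d i) * ?T r))))
        \<le> ereal (?B + ?K / ?T r)"
    proof (rule eventually_mono)
      fix r assume r: "1 \<le> r \<and> 1 \<le> ?M r \<and> 0 < ?T r"
      then have T: "0 < ?T r" by blast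
      have "(\<Sum>i=1..q. max 0 (proximity v f (d i) (Q i) r / (real (d i) * ?T r))) = (\<Sum>i=1..q. y i r) / ?T r"
        unfolding sum_divide_distrib y_def
        using T by (intro sum.cong refl) (auto simp: max_def divide_simps)
      also have "\<dots> \<le> (?B * ?T r + ?K) / ?T r" using bound r T by (intro divide_right_mono) auto
      also have "\<dots> = ?B + ?K / ?T r" using T by (simp add: field_simps)
      finally show "(\<Sum>i=1..q. ereal (max 0 (proximity v f (d i) (Q i) r / (real (d i) * ?T r))))
        \<le> ereal (?B + ?K / ?T r)" by (simp del: ereal_max)
    qed
  qed
  also have "\<dots> = ereal ?B"
  proof (rule lim_imp_Liminf)
    have "((\<lambda>r. ?B + ?K / ?T r) \<longlongrightarrow> ?B + 0) at_top"
      by (intro tendsto_add tendsto_const real_tendsto_divide_at_top[OF tendsto_const T_top])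
    then show "((\<lambda>r. ereal (?B + ?K / ?T r)) \<longlongrightarrow> ereal ?B) at_top" by simp
  qed simp
  finally show ?thesis .
qed

theorem corollary6:
  fixes v :: "'a::alg_closed_field \<Rightarrow> real"
    and X :: "('a ^ 'v::finite) set"
    and Q :: "nat \<Rightarrow> ('v, 'a) mpoly"
    and d :: "nat \<Rightarrow> nat"
    and f :: "'a fps ^ 'v"
    and N n q :: nat
  assumes "complete_nonarch_abs v"
    and "CARD('v) = N + 1"
    and "proj_variety X"
    and "proj_dim X = enat n"
    and "n \<ge> 1"
    and "q \<ge> 1"
    and "\<forall>i\<in>{1..q}. hypersurface (d i) (Q i)"
    and "all_intersections_transverse q Q X n"
    and "analytic_map_into v f X"
    and "nonconstant_map v f"
    and "\<forall>i\<in>{1..q}. \<exists>z. map_value v f z \<notin> proj_zeros {Q i}"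
  shows "(\<Sum>i = 1..q. defect v f (d i) (Q i))
           \<le> ereal (real n - 1 + Max ((\<lambda>i. 1 / real (d i)) ` {1..q}))
       \<and> (\<forall>e. (\<forall>i\<in>{1..q}. d i = e) \<longrightarrow>
             (\<Sum>i = 1..q. defect v f (d i) (Q i)) \<le> ereal (real n - 1 + 1 / real e))"
proof -
  have bound: "(\<Sum>i = 1..q. defect v f (d i) (Q i)) \<le> ereal (real n - 1 + \<mu>)"
    if "\<And>i. i \<in> {1..q} \<Longrightarrow> 1 / real (d i) \<le> \<mu>" "0 \<le> \<mu>" for \<mu>
    using defect_sum_bound[of v n q d Q X f \<mu>] assms that by (auto simp: complete_nonarch_abs_def)
  have le: "1 / real (d i) \<le> Max ((\<lambda>i. 1 / real (d i)) ` {1..q})" if "i \<in> {1..q}" for i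
    using that by (intro Max_ge) auto
  have "0 \<le> 1 / real (d 1)" by simp
  also have "\<dots> \<le> Max ((\<lambda>i. 1 / real (d i)) ` {1..q})" using le \<open>q \<ge> 1\<close> by simp
  finally show ?thesis using bound[OF le] bound by auto
qed

end
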